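(* Let $\mathfrak H$ be a (real or complex, possibly infinite dimensional) Hilbert space, let $B_1,\dots,B_k\in\mathcal B(\mathfrak H)$ with $\|B_i\|_2=1$, and let $s_1,\dots,s_k>0$ with $s_1+\dots+s_k=\pi$. For a scalar $t$ put $E(t)=\exp(ts_kB_k)\cdots\exp(ts_1B_1)$, and let $\mu_n$ ($n\ge1$) be defined by $\log E(t)=\sum_{n\ge1}\mu_nt^n$ for small $|t|$. (a) Unless the operators $B_i$ have approximate common eigenvectors for $\mathrm i$ or for $-\mathrm i$ (complex case), or a common approximate eigenblock $\begin{bmatrix}0&-1\\1&0\end{bmatrix}$ (real case), $E(1)$ is $\log$-able and the Magnus expansion is Abel summable to its logarithm: $$\log E(1)=\lim_{t\nearrow1}\sum_{n=1}^\infty t^n\mu_n .$$ (b) Unless the operators $B_i$ have approximate common eigenvectors for some complex number of absolute value $1$ (complex case), or a common approximate eigenvalue $1$ or $-1$, or a common approximate eigenblock $\begin{bmatrix}\cos\alpha&-\sin\alpha\\\sin\alpha&\cos\alpha\end{bmatrix}$ for some $\alpha$ (real case), for every $t\in\mathbb C$ with $|t|\le1$ the operator $E(t)$ is $\log$-able and the Magnus expansion converges absolutely to its logarithm: $\log E(t)=\sum_{n=1}^\infty t^n\mu_n$. Thus the $\log$-able radius of the expansion is also greater than $1$. In particular, the conclusion of (b) holds if the operators $B_i-B_j$ $(i<j)$ have no common approximate $0$.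
   Context: $\|\cdot\|_2$ is the operator norm. In the real case, spectra and expressions with complex $t$ are understood in the complexification. An operator $A$ is $\log$-able if its spectrum is disjoint from $(-\infty,0]$; then $\log A=\int_0^1 (A-\mathrm{Id})(\lambda\,\mathrm{Id}+(1-\lambda)A)^{-1}d\lambda$. $E(t)$ is the left time-ordered exponential of $t\psi$, where $\psi$ is the mass-normalized multiple BCH measure given by $(B_i,s_i)$, of cumulative norm $\pi$; $\sum\mu_n$ is its Magnus (BCH) expansion. The $B_i$ have approximate common eigenvectors for $\lambda$ (common approximate eigenvalue $\lambda$) if there is a sequence of unit vectors $\mathbf x_m$ with $B_i\mathbf x_m-\lambda\mathbf x_m\to0$ for all $i$. In the real case, they have a common approximate eigenblock $\begin{bmatrix}\cos\alpha&-\sin\alpha\\\sin\alpha&\cos\alpha\end{bmatrix}$ if there are sequences of unit vectors $\mathbf x_m\perp\mathbf y_m$ with $B_i\mathbf x_m-((\cos\alpha)\mathbf x_m+(\sin\alpha)\mathbf y_m)\to0$ and $B_i\mathbf y_m-(-(\sin\alpha)\mathbf x_m+(\cos\alpha)\mathbf y_m)\to0$ for all $i$. The operators $B_i-B_j$ $(i<j)$ have a common approximate $0$ if there is a sequence of unit vectors $\mathbf x_m$ with $(B_i-B_j)\mathbf x_m\to0$ for all $i<j$. The $\log$-able radius is the supremum of the $R>0$ such that $E(t)$ is $\log$-able for all complex $t$ with $|t|<R$. *)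

theory Defs
  imports "HOL-Analysis.Analysis"
begin

section \<open>Complex Hilbert spaces\<close>

class complex_vector = real_vector +
  fixes scaleC :: "complex \<Rightarrow> 'a \<Rightarrow> 'a"  (infixr \<open>*\<^sub>C\<close> 75)
  assumes scaleC_add_right: "a *\<^sub>C (x + y) = a *\<^sub>C x + a *\<^sub>C y"
    and scaleC_add_left: "(a + b) *\<^sub>C x = a *\<^sub>C x + b *\<^sub>C x"
    and scaleC_scaleC: "a *\<^sub>C (b *\<^sub>C x) = (a * b) *\<^sub>C x"
    and scaleC_of_real: "complex_of_real r *\<^sub>C x = r *\<^sub>R x"

class complex_normed_vector = complex_vector + real_normed_vector +
  assumes norm_scaleC: "norm (a *\<^sub>C x) = cmod a * norm x"

text \<open>The inner product is antilinear in the first argument; the last axiom makes it positive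
  definite and says that it induces the norm.\<close>

class complex_inner = complex_normed_vector +
  fixes cinner :: "'a \<Rightarrow> 'a \<Rightarrow> complex"
  assumes cinner_commute: "cinner x y = cnj (cinner y x)"
    and cinner_add_right: "cinner x (y + z) = cinner x y + cinner x z"
    and cinner_scaleC_right: "cinner x (a *\<^sub>C y) = a * cinner x y"
    and cinner_self: "cinner x x = complex_of_real ((norm x)\<^sup>2)"

class chilbert_space = complex_inner + banach

text \<open>Operators on a complex space are real-bounded linear maps that commute with complex scalars;
  the norm of \<^typ>\<open>'a \<Rightarrow>\<^sub>L 'b\<close> is then also the complex operator norm. Since the inverse of a
  complex-linear bijection is complex-linear, invertibility is unaffected.\<close>

definition complex_linear :: "('a::complex_normed_vector \<Rightarrow>\<^sub>L 'b::complex_normed_vector) \<Rightarrow> bool" where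
  "complex_linear A \<longleftrightarrow> (\<forall>c x. A (c *\<^sub>C x) = c *\<^sub>C A x)"

lemma bounded_linear_scaleC: "bounded_linear (\<lambda>x::'a::complex_normed_vector. c *\<^sub>C x)"
proof (rule bounded_linear_intro[where K = "cmod c"])
  fix r and x :: 'a
  show "c *\<^sub>C (r *\<^sub>R x) = r *\<^sub>R (c *\<^sub>C x)"
    by (simp add: scaleC_of_real[symmetric] scaleC_scaleC mult.commute)
qed (simp_all add: scaleC_add_right norm_scaleC)

instantiation blinfun :: (real_normed_vector, complex_normed_vector) complex_normed_vector
begin

lift_definition scaleC_blinfun :: "complex \<Rightarrow> 'a \<Rightarrow>\<^sub>L 'b \<Rightarrow> 'a \<Rightarrow>\<^sub>L 'b" is "\<lambda>c f x. c *\<^sub>C f x"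
  by (rule bounded_linear_compose[OF bounded_linear_scaleC])

instance
proof
  fix a b :: complex and r :: real and A B :: "'a \<Rightarrow>\<^sub>L 'b"
  show "a *\<^sub>C (A + B) = a *\<^sub>C A + a *\<^sub>C B" by transfer (simp add: scaleC_add_right)
  show "(a + b) *\<^sub>C A = a *\<^sub>C A + b *\<^sub>C A" by transfer (simp add: scaleC_add_left)
  show "a *\<^sub>C (b *\<^sub>C A) = (a * b) *\<^sub>C A" by transfer (simp add: scaleC_scaleC)
  show "complex_of_real r *\<^sub>C A = r *\<^sub>R A" by transfer (simp add: scaleC_of_real)
  have le: "norm (c *\<^sub>C X) \<le> cmod c * norm X" for c and X :: "'a \<Rightarrow>\<^sub>L 'b"
  proof (rule norm_blinfun_bound)
    show "norm ((c *\<^sub>C X) x) \<le> cmod c * norm X * norm x" for x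
      using mult_left_mono[OF norm_blinfun[of X x], of "cmod c"]
      by (simp add: scaleC_blinfun.rep_eq norm_scaleC mult.assoc)
  qed simp
  show "norm (a *\<^sub>C A) = cmod a * norm A"
  proof (cases "a = 0")
    case True
    then show ?thesis using le[of a A] by simp
  next
    case False
    have "inverse a *\<^sub>C (a *\<^sub>C A) = complex_of_real 1 *\<^sub>C A"
      using False by transfer (simp add: scaleC_scaleC)
    also have "\<dots> = A"
      by transfer (simp add: scaleC_of_real del: of_real_1)
    finally have "norm A \<le> inverse (cmod a) * norm (a *\<^sub>C A)"
      using le[of "inverse a" "a *\<^sub>C A"] by (simp add: norm_inverse)
    with False have "cmod a * norm A \<le> norm (a *\<^sub>C A)"
      by (simp add: field_simps)
    with le[of a A] show ?thesis by simp
  qed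
qed

end


section \<open>Complexification of a real Hilbert space\<close>

datatype 'a complexification = Complexification (repart: 'a) (impart: 'a)

instantiation complexification :: (real_normed_vector) real_normed_vector
begin

definition "0 = Complexification 0 0"
definition "x + y = Complexification (repart x + repart y) (impart x + impart y)"
definition "x - y = Complexification (repart x - repart y) (impart x - impart y)"
definition "- x = Complexification (- repart x) (- impart x)"
definition "r *\<^sub>R x = Complexification (r *\<^sub>R repart x) (r *\<^sub>R impart x)"
definition norm_complexification_def:
  "norm (x :: 'a complexification) = sqrt ((norm (repart x))\<^sup>2 + (norm (impart x))\<^sup>2)"
definition "sgn (x :: 'a complexification) = inverse (norm x) *\<^sub>R x"
definition "dist (x :: 'a complexification) y = norm (x - y)"
definition [code del]:
  "(uniformity :: ('a complexification \<times> 'a complexification) filter)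
     = (INF e\<in>{0<..}. principal {(x, y). dist x y < e})"
definition [code del]:
  "open (U :: 'a complexification set)
     \<longleftrightarrow> (\<forall>x\<in>U. eventually (\<lambda>(x', y). x' = x \<longrightarrow> y \<in> U) uniformity)"

lemmas complexification_ops = zero_complexification_def plus_complexification_def
  minus_complexification_def uminus_complexification_def scaleR_complexification_def

lemma norm_complexification_Pair: "norm (x :: 'a complexification) = norm (repart x, impart x)"
  by (simp add: norm_complexification_def norm_Pair)

instance
proof
  fix x y z :: "'a complexification" and r q :: real and U :: "'a complexification set"
  show "x + y + z = x + (y + z)" "x + y = y + x" "0 + x = x" "- x + x = 0" "x - y = x + - y"
    "r *\<^sub>R (x + y) = r *\<^sub>R x + r *\<^sub>R y" "(r + q) *\<^sub>R x = r *\<^sub>R x + q *\<^sub>R x"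
    "r *\<^sub>R q *\<^sub>R x = (r * q) *\<^sub>R x" "1 *\<^sub>R x = x"
    by (simp_all add: complexification_ops algebra_simps)
  show "sgn x = inverse (norm x) *\<^sub>R x" by (rule sgn_complexification_def)
  show "dist x y = norm (x - y)" by (rule dist_complexification_def)
  show "(uniformity :: ('a complexification \<times> 'a complexification) filter)
     = (INF e\<in>{0<..}. principal {(x, y). dist x y < e})"
    by (rule uniformity_complexification_def)
  show "open U \<longleftrightarrow> (\<forall>x\<in>U. eventually (\<lambda>(x', y). x' = x \<longrightarrow> y \<in> U) uniformity)"
    by (rule open_complexification_def)
  show "norm x = 0 \<longleftrightarrow> x = 0"
    by (cases x) (simp add: norm_complexification_Pair zero_complexification_def prod_eq_iff)
  show "norm (x + y) \<le> norm x + norm y"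
    using norm_triangle_ineq[of "(repart x, impart x)" "(repart y, impart y)"]
    by (simp add: norm_complexification_Pair plus_complexification_def)
  show "norm (r *\<^sub>R x) = \<bar>r\<bar> * norm x"
    using norm_scaleR[of r "(repart x, impart x)"]
    by (simp add: norm_complexification_Pair scaleR_complexification_def del: norm_scaleR)
qed

end

instance complexification :: (banach) banach
proof
  fix X :: "nat \<Rightarrow> 'a complexification"
  assume X: "Cauchy X"
  let ?p = "\<lambda>x :: 'a complexification. (repart x, impart x)"
  have d: "dist x y = dist (?p x) (?p y)" for x y :: "'a complexification"
    by (simp add: dist_norm norm_complexification_Pair minus_complexification_def)
  from X have "Cauchy (\<lambda>n. ?p (X n))"
    by (simp add: Cauchy_def d)
  then obtain l where l: "(\<lambda>n. ?p (X n)) \<longlonglongrightarrow> l"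
    using Cauchy_convergent_iff convergent_def by blast
  have "X \<longlonglongrightarrow> Complexification (fst l) (snd l)"
    using l by (simp add: lim_sequentially d)
  then show "convergent X" by (auto simp: convergent_def)
qed

text \<open>\<^term>\<open>Complexification x y\<close> stands for \<open>x + \<i> y\<close>.\<close>

instantiation complexification :: (real_inner) complex_inner
begin

definition scaleC_complexification_def:
  "c *\<^sub>C x = Complexification (Re c *\<^sub>R repart x - Im c *\<^sub>R impart x)
                     (Re c *\<^sub>R impart x + Im c *\<^sub>R repart x)"

definition cinner_complexification_def:
  "cinner x y = Complex (repart x \<bullet> repart y + impart x \<bullet> impart y)
                        (repart x \<bullet> impart y - impart x \<bullet> repart y)"

instance
proof
  fix x y z :: "'a complexification" and a b :: complex and r :: real
  show "a *\<^sub>C (x + y) = a *\<^sub>C x + a *\<^sub>C y" "(a + b) *\<^sub>C x = a *\<^sub>C x + b *\<^sub>C x"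
    "a *\<^sub>C (b *\<^sub>C x) = (a * b) *\<^sub>C x" "complex_of_real r *\<^sub>C x = r *\<^sub>R x"
    by (simp_all add: scaleC_complexification_def complexification_ops algebra_simps)
  have n2: "(norm z)\<^sup>2 = (norm (repart z))\<^sup>2 + (norm (impart z))\<^sup>2" for z :: "'a complexification"
    by (simp add: norm_complexification_def)
  show "norm (a *\<^sub>C x) = cmod a * norm x"
  proof (rule power2_eq_imp_eq)
    show "(norm (a *\<^sub>C x))\<^sup>2 = (cmod a * norm x)\<^sup>2"
      unfolding power_mult_distrib cmod_power2 n2
      by (simp add: scaleC_complexification_def power2_norm_eq_inner inner_diff inner_add)
        (simp add: algebra_simps power2_eq_square inner_commute)
  qed simp_all
  show "cinner x y = cnj (cinner y x)"
    by (simp add: cinner_complexification_def complex_eq_iff inner_commute)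
  show "cinner x (y + z) = cinner x y + cinner x z"
    by (simp add: cinner_complexification_def plus_complexification_def complex_eq_iff inner_add_right)
  show "cinner x (a *\<^sub>C y) = a * cinner x y"
    by (simp add: cinner_complexification_def scaleC_complexification_def complex_eq_iff
        inner_add_right inner_diff_right algebra_simps)
  show "cinner x x = complex_of_real ((norm x)\<^sup>2)"
    by (simp add: cinner_complexification_def norm_complexification_def complex_eq_iff
        power2_norm_eq_inner inner_commute)
qed

end

instance complexification :: ("{real_inner, banach}") chilbert_space ..

lift_definition complexify ::
  "('a::real_normed_vector \<Rightarrow>\<^sub>L 'b::real_normed_vector) \<Rightarrow> 'a complexification \<Rightarrow>\<^sub>L 'b complexification"
  is "\<lambda>f z. Complexification (f (repart z)) (f (impart z))"
proof -
  fix f :: "'a \<Rightarrow> 'b"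
  assume "bounded_linear f"
  then interpret bounded_linear f .
  obtain K where K: "\<And>x. norm (f x) \<le> norm x * K" and "K \<ge> 0"
    using nonneg_bounded by blast
  show "bounded_linear (\<lambda>z. Complexification (f (repart z)) (f (impart z)))"
  proof (rule bounded_linear_intro[where K = K])
    fix x y :: "'a complexification" and r :: real
    show "Complexification (f (repart (x + y))) (f (impart (x + y)))
        = Complexification (f (repart x)) (f (impart x)) + Complexification (f (repart y)) (f (impart y))"
      "Complexification (f (repart (r *\<^sub>R x))) (f (impart (r *\<^sub>R x)))
        = r *\<^sub>R Complexification (f (repart x)) (f (impart x))"
      by (simp_all add: complexification_ops add scaleR)
    have "(norm (f (repart x)))\<^sup>2 + (norm (f (impart x)))\<^sup>2
        \<le> (norm (repart x) * K)\<^sup>2 + (norm (impart x) * K)\<^sup>2"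
      by (intro add_mono power_mono K) simp_all
    also have "\<dots> = (norm x * K)\<^sup>2"
      by (simp add: norm_complexification_def power_mult_distrib algebra_simps)
    finally show "norm (Complexification (f (repart x)) (f (impart x))) \<le> norm x * K"
      using \<open>K \<ge> 0\<close> by (simp add: norm_complexification_def real_le_lsqrt)
  qed
qed


section \<open>Exponential, spectrum and logarithm of bounded operators\<close>

text \<open>The library function \<^const>\<open>exp\<close> is not available here, because
  \<^typ>\<open>'a \<Rightarrow>\<^sub>L 'a\<close> is not an instance of \<^class>\<open>real_normed_algebra_1\<close>.\<close>

definition op_exp :: "('a::real_normed_vector \<Rightarrow>\<^sub>L 'a) \<Rightarrow> ('a \<Rightarrow>\<^sub>L 'a)" where
  "op_exp A = (\<Sum>n. (1 / fact n) *\<^sub>R (((o\<^sub>L) A ^^ n) id_blinfun))"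

definition op_invertible :: "('a::real_normed_vector \<Rightarrow>\<^sub>L 'a) \<Rightarrow> bool" where
  "op_invertible A \<longleftrightarrow> (\<exists>C. A o\<^sub>L C = id_blinfun \<and> C o\<^sub>L A = id_blinfun)"

definition op_inverse :: "('a::real_normed_vector \<Rightarrow>\<^sub>L 'a) \<Rightarrow> ('a \<Rightarrow>\<^sub>L 'a)" where
  "op_inverse A = (THE C. A o\<^sub>L C = id_blinfun \<and> C o\<^sub>L A = id_blinfun)"

definition spectrum :: "('a::complex_normed_vector \<Rightarrow>\<^sub>L 'a) \<Rightarrow> complex set" where
  "spectrum A = {z. \<not> op_invertible (A - z *\<^sub>C id_blinfun)}"

definition logable :: "('a::complex_normed_vector \<Rightarrow>\<^sub>L 'a) \<Rightarrow> bool" where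
  "logable A \<longleftrightarrow> spectrum A \<inter> \<real>\<^sub>\<le>\<^sub>0 = {}"

text \<open>Only real scalars occur in the formula for the logarithm, so the same definition serves
  for real and for complex spaces.\<close>

definition op_log :: "('a::real_normed_vector \<Rightarrow>\<^sub>L 'a) \<Rightarrow> ('a \<Rightarrow>\<^sub>L 'a)" where
  "op_log A = integral {0..1}
     (\<lambda>l::real. (A - id_blinfun) o\<^sub>L op_inverse (l *\<^sub>R id_blinfun + (1 - l) *\<^sub>R A))"

definition logable_radius :: "(complex \<Rightarrow> ('a::complex_normed_vector \<Rightarrow>\<^sub>L 'a)) \<Rightarrow> ereal" where
  "logable_radius E = Sup {ereal R | R. R > 0 \<and> (\<forall>t. cmod t < R \<longrightarrow> logable (E t))}"


section \<open>Multiple BCH products and their Magnus expansion\<close>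

text \<open>\<open>ordered_exp A k\<close> is \<open>exp A\<^sub>k \<cdots> exp A\<^sub>1\<close>.\<close>

primrec ordered_exp :: "(nat \<Rightarrow> ('a::real_normed_vector \<Rightarrow>\<^sub>L 'a)) \<Rightarrow> nat \<Rightarrow> ('a \<Rightarrow>\<^sub>L 'a)" where
  "ordered_exp A 0 = id_blinfun"
| "ordered_exp A (Suc j) = op_exp (A (Suc j)) o\<^sub>L ordered_exp A j"

definition bch_real ::
  "(nat \<Rightarrow> ('a::real_normed_vector \<Rightarrow>\<^sub>L 'a)) \<Rightarrow> (nat \<Rightarrow> real) \<Rightarrow> nat \<Rightarrow> real \<Rightarrow> ('a \<Rightarrow>\<^sub>L 'a)" where
  "bch_real B s k t = ordered_exp (\<lambda>i. (t * s i) *\<^sub>R B i) k"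

definition bch_complex ::
  "(nat \<Rightarrow> ('a::complex_normed_vector \<Rightarrow>\<^sub>L 'a)) \<Rightarrow> (nat \<Rightarrow> real) \<Rightarrow> nat \<Rightarrow> complex \<Rightarrow> ('a \<Rightarrow>\<^sub>L 'a)" where
  "bch_complex B s k t = ordered_exp (\<lambda>i. (t * of_real (s i)) *\<^sub>C B i) k"

text \<open>The expansion has no constant term; the value at index 0 is set to 0 so that the description
  is unique.\<close>

definition magnus_real ::
  "(nat \<Rightarrow> ('a::real_normed_vector \<Rightarrow>\<^sub>L 'a)) \<Rightarrow> (nat \<Rightarrow> real) \<Rightarrow> nat \<Rightarrow> nat \<Rightarrow> ('a \<Rightarrow>\<^sub>L 'a)" where
  "magnus_real B s k = (THE \<mu>. \<mu> 0 = 0 \<and>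
     (\<exists>r>0. \<forall>t. \<bar>t\<bar> < r \<longrightarrow> (\<lambda>n. t ^ Suc n *\<^sub>R \<mu> (Suc n)) sums op_log (bch_real B s k t)))"

definition magnus_complex ::
  "(nat \<Rightarrow> ('a::complex_normed_vector \<Rightarrow>\<^sub>L 'a)) \<Rightarrow> (nat \<Rightarrow> real) \<Rightarrow> nat \<Rightarrow> nat \<Rightarrow> ('a \<Rightarrow>\<^sub>L 'a)" where
  "magnus_complex B s k = (THE \<mu>. \<mu> 0 = 0 \<and>
     (\<exists>r>0. \<forall>t. cmod t < r \<longrightarrow> (\<lambda>n. t ^ Suc n *\<^sub>C \<mu> (Suc n)) sums op_log (bch_complex B s k t)))"


section \<open>Approximate common eigenvectors and eigenblocks\<close>

definition approx_eigenvalue_complex ::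
  "(nat \<Rightarrow> ('a::complex_normed_vector \<Rightarrow>\<^sub>L 'a)) \<Rightarrow> nat \<Rightarrow> complex \<Rightarrow> bool" where
  "approx_eigenvalue_complex B k z \<longleftrightarrow>
     (\<exists>x :: nat \<Rightarrow> 'a. (\<forall>m. norm (x m) = 1) \<and>
        (\<forall>i\<in>{1..k}. (\<lambda>m. B i (x m) - z *\<^sub>C x m) \<longlonglongrightarrow> 0))"

definition approx_eigenvalue_real ::
  "(nat \<Rightarrow> ('a::real_normed_vector \<Rightarrow>\<^sub>L 'a)) \<Rightarrow> nat \<Rightarrow> real \<Rightarrow> bool" where
  "approx_eigenvalue_real B k r \<longleftrightarrow>
     (\<exists>x :: nat \<Rightarrow> 'a. (\<forall>m. norm (x m) = 1) \<and>
        (\<forall>i\<in>{1..k}. (\<lambda>m. B i (x m) - r *\<^sub>R x m) \<longlonglongrightarrow> 0))"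

text \<open>The block with rows \<open>(cos \<alpha>, - sin \<alpha>)\<close> and \<open>(sin \<alpha>, cos \<alpha>)\<close>.\<close>

definition approx_eigenblock ::
  "(nat \<Rightarrow> ('a::real_inner \<Rightarrow>\<^sub>L 'a)) \<Rightarrow> nat \<Rightarrow> real \<Rightarrow> bool" where
  "approx_eigenblock B k \<alpha> \<longleftrightarrow>
     (\<exists>x y :: nat \<Rightarrow> 'a. (\<forall>m. norm (x m) = 1 \<and> norm (y m) = 1 \<and> x m \<bullet> y m = 0) \<and>
        (\<forall>i\<in>{1..k}. (\<lambda>m. B i (x m) - (cos \<alpha> *\<^sub>R x m + sin \<alpha> *\<^sub>R y m)) \<longlonglongrightarrow> 0 \<and>
                     (\<lambda>m. B i (y m) - (- sin \<alpha> *\<^sub>R x m + cos \<alpha> *\<^sub>R y m)) \<longlonglongrightarrow> 0))"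

definition differences_approx_zero ::
  "(nat \<Rightarrow> ('a::real_normed_vector \<Rightarrow>\<^sub>L 'a)) \<Rightarrow> nat \<Rightarrow> bool" where
  "differences_approx_zero B k \<longleftrightarrow>
     (\<exists>x :: nat \<Rightarrow> 'a. (\<forall>m. norm (x m) = 1) \<and>
        (\<forall>i\<in>{1..k}. \<forall>j\<in>{1..k}. i < j \<longrightarrow> (\<lambda>m. (B i - B j) (x m)) \<longlonglongrightarrow> 0))"

end

(* A trajectory of y' = T y with |T| <= 1 moves its direction with angular speed at most 1 (in the
   underlying real Hilbert space), so E(t) x, which is reached after time pi, can come close to the
   ray spanned by - x only if the trajectory is close to a half circle cos u x + sin u w traversed at
   full speed. Then t B_i x is close to w and t B_i w to - x for every i, and one of x - i w, x + i w
   is a common approximate eigenvector of the t B_i for i or - i. Hence, in the absence of such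
   eigenvectors, E(t) + l is bounded below uniformly in l >= 0, thus invertible, i.e. E(t) is
   log-able. By openness of log-ability and compactness of the closed disc the log-able radius
   exceeds 1 in case (b). The coefficients of the expansion are Cauchy integrals of log E(t), whose
   matrix coefficients are holomorphic wherever E(t) is log-able. The real case follows by
   complexification: a contraction acting approximately as a rotation on a plane makes the plane
   vectors approximately orthogonal and of equal length. *)

theory Submission
  imports Defs "HOL-Complex_Analysis.Complex_Analysis" "HOL-Real_Asymp.Real_Asymp"
begin

section \<open>Bounded operators\<close>

lemma bounded_bilinear_scaleC [bounded_bilinear]:
  "bounded_bilinear (\<lambda>c (x::'a::complex_normed_vector). c *\<^sub>C x)"
proof
  fix r :: real and a b :: complex and x y :: 'a
  have R: "r *\<^sub>R z = complex_of_real r *\<^sub>C z" for z :: 'a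
    by (simp add: scaleC_of_real)
  show "(r *\<^sub>R a) *\<^sub>C x = r *\<^sub>R (a *\<^sub>C x)"
    by (simp add: R scaleC_scaleC scaleR_conv_of_real)
  show "a *\<^sub>C (r *\<^sub>R x) = r *\<^sub>R (a *\<^sub>C x)"
    by (simp add: R scaleC_scaleC mult.commute)
  show "\<exists>K. \<forall>a (x::'a). norm (a *\<^sub>C x) \<le> norm a * norm x * K"
    by (rule exI[of _ 1]) (simp add: norm_scaleC)
qed (simp_all add: scaleC_add_left scaleC_add_right)

interpretation scaleC: bounded_bilinear "\<lambda>c (x::'a::complex_normed_vector). c *\<^sub>C x"
  by (rule bounded_bilinear_scaleC)

interpretation ocomp: bounded_bilinear "(o\<^sub>L)"
  by (rule bounded_bilinear_blinfun_compose)

lemma scaleC_one [simp]: "1 *\<^sub>C (x::'a::complex_normed_vector) = x"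
  using scaleC_of_real[of 1 x] by simp

lemma scaleC_blinfun_apply [simp]: "blinfun_apply (c *\<^sub>C A) x = c *\<^sub>C A x"
  by (simp add: scaleC_blinfun.rep_eq)

lemma blinfun_compose_assoc: "(A o\<^sub>L B) o\<^sub>L C = A o\<^sub>L (B o\<^sub>L C)"
  by (rule blinfun_eqI) simp

lemma blinfun_compose_id [simp]: "A o\<^sub>L id_blinfun = A" "id_blinfun o\<^sub>L A = A"
  by (rule blinfun_eqI; simp)+

lemma scaleC_compose_left: "(c *\<^sub>C A) o\<^sub>L B = c *\<^sub>C (A o\<^sub>L B)"
  by (rule blinfun_eqI) simp

lemma complex_linearD: "complex_linear A \<Longrightarrow> A (c *\<^sub>C x) = c *\<^sub>C A x"
  by (simp add: complex_linear_def)

lemma compose_scaleC_right: "complex_linear A \<Longrightarrow> A o\<^sub>L (c *\<^sub>C B) = c *\<^sub>C (A o\<^sub>L B)"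
  by (rule blinfun_eqI) (simp add: complex_linearD)

lemma complex_linear_id: "complex_linear id_blinfun"
  by (simp add: complex_linear_def)

lemma complex_linear_compose: "complex_linear A \<Longrightarrow> complex_linear B \<Longrightarrow> complex_linear (A o\<^sub>L B)"
  by (simp add: complex_linear_def)

lemma complex_linear_scaleC: "complex_linear A \<Longrightarrow> complex_linear (c *\<^sub>C A)"
  by (simp add: complex_linear_def scaleC_scaleC mult.commute)

lemma complex_linear_scaleR: "complex_linear A \<Longrightarrow> complex_linear (r *\<^sub>R A)"
  using complex_linear_scaleC[of A "of_real r"] by (simp add: scaleC_of_real)

lemma complex_linear_add: "complex_linear A \<Longrightarrow> complex_linear B \<Longrightarrow> complex_linear (A + B)"
  by (simp add: complex_linear_def blinfun.add_left scaleC.add_right)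

lemma complex_linear_diff: "complex_linear A \<Longrightarrow> complex_linear B \<Longrightarrow> complex_linear (A - B)"
  by (simp add: complex_linear_def blinfun.diff_left scaleC.diff_right)

lemma complex_linear_tendsto:
  assumes "(f \<longlongrightarrow> A) F" "\<And>x. complex_linear (f x)" "F \<noteq> bot"
  shows "complex_linear A"
  unfolding complex_linear_def
proof (intro allI)
  fix c x
  have "((\<lambda>y. f y (c *\<^sub>C x)) \<longlongrightarrow> A (c *\<^sub>C x)) F" "((\<lambda>y. c *\<^sub>C f y x) \<longlongrightarrow> c *\<^sub>C A x) F"
    by (intro tendsto_intros assms)+
  moreover have "(\<lambda>y. f y (c *\<^sub>C x)) = (\<lambda>y. c *\<^sub>C f y x)"
    using assms(2) by (simp add: complex_linearD)
  ultimately show "A (c *\<^sub>C x) = c *\<^sub>C A x"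
    using tendsto_unique[OF assms(3)] by metis
qed

abbreviation op_pow :: "('a::real_normed_vector \<Rightarrow>\<^sub>L 'a) \<Rightarrow> nat \<Rightarrow> ('a \<Rightarrow>\<^sub>L 'a)" where
  "op_pow A n \<equiv> ((o\<^sub>L) A ^^ n) id_blinfun"

lemma norm_op_pow: "norm (op_pow A n) \<le> norm A ^ n"
proof (induction n)
  case (Suc n)
  have "norm (A o\<^sub>L op_pow A n) \<le> norm A * norm (op_pow A n)" by (rule norm_blinfun_compose)
  also have "\<dots> \<le> norm A * norm A ^ n" by (intro mult_left_mono Suc) simp
  finally show ?case by simp
qed (simp add: norm_blinfun_id_le)

lemma op_pow_commute: "op_pow A n o\<^sub>L A = A o\<^sub>L op_pow A n"
  by (induction n) (simp_all add: blinfun_compose_assoc)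

lemma complex_linear_op_pow: "complex_linear A \<Longrightarrow> complex_linear (op_pow A n)"
  by (induction n) (simp_all add: complex_linear_id complex_linear_compose)

lemma op_pow_scaleC: "complex_linear A \<Longrightarrow> op_pow (c *\<^sub>C A) n = c ^ n *\<^sub>C op_pow A n"
  by (induction n) (simp_all add: scaleC_compose_left compose_scaleC_right scaleC_scaleC)

lemma op_inverse_eqI:
  assumes "A o\<^sub>L C = id_blinfun" "C o\<^sub>L A = id_blinfun"
  shows "op_inverse A = C"
  unfolding op_inverse_def
proof (rule the_equality)
  fix D assume D: "A o\<^sub>L D = id_blinfun \<and> D o\<^sub>L A = id_blinfun"
  have "D = (D o\<^sub>L A) o\<^sub>L C" using assms by (simp add: blinfun_compose_assoc)
  then show "D = C" using D by simp
qed (use assms in simp)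

lemma op_inverse:
  assumes "op_invertible A"
  shows "A o\<^sub>L op_inverse A = id_blinfun" "op_inverse A o\<^sub>L A = id_blinfun"
  using assms op_inverse_eqI unfolding op_invertible_def by metis+

lemma op_inverse_apply:
  assumes "op_invertible A"
  shows "A (op_inverse A x) = x" "op_inverse A (A x) = x"
  using op_inverse[OF assms] by (metis blinfun_apply_blinfun_compose blinfun_apply_id_blinfun)+

lemma op_invertible_compose:
  assumes "op_invertible A" "op_invertible B"
  shows "op_invertible (A o\<^sub>L B)"
  unfolding op_invertible_def
  by (rule exI[of _ "op_inverse B o\<^sub>L op_inverse A"], intro conjI blinfun_eqI)
    (simp_all add: op_inverse_apply assms)

lemma op_invertible_scaleR:
  assumes "op_invertible A" "r \<noteq> 0"
  shows "op_invertible (r *\<^sub>R A)"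
  unfolding op_invertible_def
  by (rule exI[of _ "(1/r) *\<^sub>R op_inverse A"], intro conjI blinfun_eqI)
    (simp_all add: op_inverse_apply assms blinfun.scaleR_left blinfun.scaleR_right)

lemma op_invertible_id: "op_invertible id_blinfun"
  unfolding op_invertible_def by (rule exI[of _ id_blinfun]) simp

lemma complex_linear_op_inverse:
  assumes "op_invertible A" "complex_linear A"
  shows "complex_linear (op_inverse A)"
  unfolding complex_linear_def
proof (intro allI)
  fix c x
  have "op_inverse A (c *\<^sub>C x) = op_inverse A (A (c *\<^sub>C op_inverse A x))"
    by (simp add: complex_linearD assms op_inverse_apply)
  then show "op_inverse A (c *\<^sub>C x) = c *\<^sub>C op_inverse A x"
    by (simp add: op_inverse_apply assms)
qed

lemma op_invertible_id_minus:
  fixes X :: "'a::banach \<Rightarrow>\<^sub>L 'a"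
  assumes "norm X < 1"
  shows "op_invertible (id_blinfun - X)"
proof -
  let ?P = "op_pow X"
  have "summable (\<lambda>n. norm (?P n))"
    by (rule summable_comparison_test'[where g = "\<lambda>n. norm X ^ n" and N = 0])
      (use assms norm_op_pow in \<open>auto simp: summable_geometric\<close>)
  then have s: "summable ?P" by (rule summable_norm_cancel)
  define S where "S = suminf ?P"
  have "?P sums S" using s by (simp add: S_def summable_sums)
  then have "(\<lambda>n. ?P (Suc n)) sums (S - id_blinfun)"
    by (subst sums_Suc_iff) simp
  moreover have "(\<lambda>n. X o\<^sub>L ?P n) sums (X o\<^sub>L S)" "(\<lambda>n. ?P n o\<^sub>L X) sums (S o\<^sub>L X)"
    using bounded_linear.sums[OF ocomp.bounded_linear_right \<open>?P sums S\<close>]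
      bounded_linear.sums[OF ocomp.bounded_linear_left \<open>?P sums S\<close>] by auto
  ultimately have "X o\<^sub>L S = S - id_blinfun" "S o\<^sub>L X = S - id_blinfun"
    by (auto simp: op_pow_commute dest: sums_unique2)
  then show ?thesis
    unfolding op_invertible_def
    by (intro exI[of _ S]) (simp add: ocomp.diff_left ocomp.diff_right)
qed

lemma op_invertible_perturb:
  fixes A X :: "'a::banach \<Rightarrow>\<^sub>L 'a"
  assumes "op_invertible A" "norm (X - A) * norm (op_inverse A) < 1"
  shows "op_invertible X"
proof -
  have "norm (op_inverse A o\<^sub>L (A - X)) \<le> norm (op_inverse A) * norm (A - X)"
    by (rule norm_blinfun_compose)
  also have "\<dots> < 1" using assms(2) by (simp add: norm_minus_commute mult.commute)
  finally have "op_invertible (A o\<^sub>L (id_blinfun - (op_inverse A o\<^sub>L (A - X))))"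
    by (intro op_invertible_compose assms op_invertible_id_minus)
  moreover have "A o\<^sub>L (id_blinfun - (op_inverse A o\<^sub>L (A - X))) = X"
    by (rule blinfun_eqI)
      (simp add: blinfun.diff_left blinfun.diff_right op_inverse_apply assms(1))
  ultimately show ?thesis by simp
qed

lemma op_inverse_diff:
  assumes "op_invertible A" "op_invertible X"
  shows "op_inverse X - op_inverse A = op_inverse X o\<^sub>L (A - X) o\<^sub>L op_inverse A"
  by (rule blinfun_eqI)
    (simp add: blinfun.diff_left blinfun.diff_right op_inverse_apply assms)

lemma open_op_invertible: "open {A :: 'a::banach \<Rightarrow>\<^sub>L 'a. op_invertible A}"
proof (rule openI)
  fix A :: "'a \<Rightarrow>\<^sub>L 'a" assume "A \<in> {A. op_invertible A}"
  then have A: "op_invertible A" by simp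
  let ?e = "1 / (norm (op_inverse A) + 1)"
  have "op_invertible X" if "dist A X < ?e" for X
  proof (rule op_invertible_perturb[OF A])
    have "norm (X - A) * norm (op_inverse A) \<le> norm (X - A) * (norm (op_inverse A) + 1)"
      by (intro mult_left_mono) auto
    also have "\<dots> < 1"
      using that by (simp add: dist_norm norm_minus_commute field_simps add_pos_nonneg)
    finally show "norm (X - A) * norm (op_inverse A) < 1" .
  qed
  moreover have "?e > 0" by (simp add: add_nonneg_pos)
  ultimately show "\<exists>e>0. ball A e \<subseteq> {A. op_invertible A}"
    by (intro exI[of _ ?e]) auto
qed

lemma continuous_on_op_inverse: "continuous_on {A :: 'a::banach \<Rightarrow>\<^sub>L 'a. op_invertible A} op_inverse"
proof (rule continuous_at_imp_continuous_on, rule ballI)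
  fix A :: "'a \<Rightarrow>\<^sub>L 'a" assume "A \<in> {A. op_invertible A}"
  then have A: "op_invertible A" by simp
  let ?N = "norm (op_inverse A)"
  have bound: "norm (op_inverse X - op_inverse A) \<le> 2 * ?N\<^sup>2 * norm (X - A)"
    if X: "op_invertible X" and small: "norm (X - A) * ?N \<le> 1/2" for X
  proof -
    have "norm (op_inverse X - op_inverse A) \<le> norm (op_inverse X o\<^sub>L (A - X)) * ?N"
      unfolding op_inverse_diff[OF A X] by (rule norm_blinfun_compose)
    also have "\<dots> \<le> norm (op_inverse X) * norm (A - X) * ?N"
      by (intro mult_right_mono norm_blinfun_compose) simp
    finally have 1: "norm (op_inverse X - op_inverse A) \<le> norm (op_inverse X) * (norm (X - A) * ?N)"
      by (simp add: norm_minus_commute mult.assoc)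
    also have "\<dots> \<le> norm (op_inverse X) * (1/2)"
      by (intro mult_left_mono small) simp
    finally have "norm (op_inverse X) \<le> 2 * ?N"
      using norm_triangle_ineq2[of "op_inverse X" "op_inverse A"] by simp
    then have "norm (op_inverse X) * (norm (X - A) * ?N) \<le> 2 * ?N * (norm (X - A) * ?N)"
      by (intro mult_right_mono) auto
    with 1 show ?thesis by (simp add: power2_eq_square mult_ac)
  qed
  have "\<forall>\<^sub>F X in at A. op_invertible X"
    using open_op_invertible A by (auto simp: eventually_at_topological)
  moreover have "((\<lambda>X. norm (X - A) * ?N) \<longlongrightarrow> norm (A - A) * ?N) (at A)"
    by (intro tendsto_intros)
  then have "\<forall>\<^sub>F X in at A. norm (X - A) * ?N < 1/2"
    by (rule order_tendstoD) simp
  ultimately have "\<forall>\<^sub>F X in at A. norm (op_inverse X - op_inverse A) \<le> 2 * ?N\<^sup>2 * norm (X - A)"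
    by eventually_elim (use bound in auto)
  moreover have "((\<lambda>X. 2 * ?N\<^sup>2 * norm (X - A)) \<longlongrightarrow> 2 * ?N\<^sup>2 * norm (A - A)) (at A)"
    by (intro tendsto_intros)
  then have "((\<lambda>X. 2 * ?N\<^sup>2 * norm (X - A)) \<longlongrightarrow> 0) (at A)" by simp
  ultimately have "((\<lambda>X. op_inverse X - op_inverse A) \<longlongrightarrow> 0) (at A)"
    by (rule Lim_null_comparison)
  then show "isCont op_inverse A"
    by (simp add: isCont_def LIM_zero_iff)
qed

lemma op_invertible_half_line:
  fixes E :: "'a::banach \<Rightarrow>\<^sub>L 'a"
  assumes "op_invertible E" "c > 0"
    and below: "\<And>l x. l \<ge> 0 \<Longrightarrow> c * norm x \<le> norm (E x + l *\<^sub>R x)"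
    and "l \<ge> 0"
  shows "op_invertible (E + l *\<^sub>R id_blinfun)"
proof -
  have step: "op_invertible (E + l' *\<^sub>R id_blinfun)"
    if inv: "op_invertible (E + l *\<^sub>R id_blinfun)" and l: "0 \<le> l" "\<bar>l' - l\<bar> < c" for l l'
  proof (rule op_invertible_perturb[OF inv])
    let ?N = "op_inverse (E + l *\<^sub>R id_blinfun)"
    have "norm ?N \<le> 1 / c"
    proof (rule norm_blinfun_bound)
      fix x
      have "c * norm (?N x) \<le> norm ((E + l *\<^sub>R id_blinfun) (?N x))"
        using below[OF l(1), of "?N x"] by (simp add: blinfun.add_left blinfun.scaleR_left)
      then show "norm (?N x) \<le> 1 / c * norm x"
        using \<open>c > 0\<close> by (simp add: op_inverse_apply inv field_simps)
    qed (use \<open>c > 0\<close> in simp)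
    moreover have "norm (E + l' *\<^sub>R id_blinfun - (E + l *\<^sub>R id_blinfun)) \<le> \<bar>l' - l\<bar>"
    proof -
      have "E + l' *\<^sub>R id_blinfun - (E + l *\<^sub>R id_blinfun) = (l' - l) *\<^sub>R id_blinfun"
        by (simp add: scaleR_diff_left)
      then show ?thesis
        using mult_left_mono[OF norm_blinfun_id_le, of "\<bar>l' - l\<bar>"] by simp
    qed
    ultimately have "norm (E + l' *\<^sub>R id_blinfun - (E + l *\<^sub>R id_blinfun)) * norm ?N \<le> \<bar>l' - l\<bar> * (1/c)"
      by (intro mult_mono) auto
    also have "\<dots> < 1" using l \<open>c > 0\<close> by simp
    finally show "norm (E + l' *\<^sub>R id_blinfun - (E + l *\<^sub>R id_blinfun)) * norm ?N < 1" .
  qed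
  have "op_invertible (E + l *\<^sub>R id_blinfun)" if "0 \<le> l" "l \<le> real n * (c/2)" for n l
    using that
  proof (induction n arbitrary: l)
    case 0 then show ?case using assms(1) by simp
  next
    case (Suc n)
    let ?l = "max 0 (l - c/2)"
    have "op_invertible (E + ?l *\<^sub>R id_blinfun)"
      using Suc.prems \<open>c > 0\<close> by (intro Suc.IH) (auto simp: algebra_simps max_def)
    then show ?case
      by (rule step) (use Suc.prems \<open>c > 0\<close> in \<open>auto simp: max_def\<close>)
  qed
  moreover obtain n where "l / (c/2) \<le> real n" using real_arch_simple by blast
  ultimately show ?thesis
    using assms(2,4) by (auto simp: field_simps)
qed

section \<open>The exponential\<close>

lemma norm_exp_term_le: "norm ((1 / fact n) *\<^sub>R op_pow A n) \<le> norm A ^ n /\<^sub>R fact n"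
  using norm_op_pow[of n A] by (simp add: divide_simps)

lemma op_exp_sums: "(\<lambda>n. (1 / fact n) *\<^sub>R op_pow A n) sums op_exp (A :: 'a::banach \<Rightarrow>\<^sub>L 'a)"
proof -
  have "summable (\<lambda>n. norm A ^ n /\<^sub>R fact n)" by (rule summable_exp_generic)
  then have "summable (\<lambda>n. (1 / fact n) *\<^sub>R op_pow A n)"
    by (rule summable_comparison_test'[where N = 0]) (rule norm_exp_term_le)
  then show ?thesis unfolding op_exp_def by (rule summable_sums)
qed

lemma op_exp_zero [simp]: "op_exp (0 :: 'a::banach \<Rightarrow>\<^sub>L 'a) = id_blinfun"
proof -
  have "(\<lambda>n. (1 / fact n) *\<^sub>R op_pow (0 :: 'a \<Rightarrow>\<^sub>L 'a) n) = (\<lambda>n. if n = 0 then id_blinfun else 0)"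
  proof
    fix n show "(1 / fact n) *\<^sub>R op_pow (0 :: 'a \<Rightarrow>\<^sub>L 'a) n = (if n = 0 then id_blinfun else 0)"
      by (cases n) simp_all
  qed
  moreover have "(\<lambda>n. if n = 0 then id_blinfun else 0 :: 'a \<Rightarrow>\<^sub>L 'a) sums id_blinfun"
    using sums_single[of 0 "\<lambda>_. id_blinfun :: 'a \<Rightarrow>\<^sub>L 'a"] by simp
  ultimately show ?thesis
    using sums_unique2[OF op_exp_sums[of "0 :: 'a \<Rightarrow>\<^sub>L 'a"]] by simp
qed

lemma norm_op_exp_tail:
  fixes A :: "'a::banach \<Rightarrow>\<^sub>L 'a"
  shows "norm (op_exp A - (\<Sum>n<k. (1 / fact n) *\<^sub>R op_pow A n))
    \<le> exp (norm A) - (\<Sum>n<k. norm A ^ n /\<^sub>R fact n)"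
proof -
  have "(\<lambda>n. (1 / fact (n + k)) *\<^sub>R op_pow A (n + k)) sums
      (op_exp A - (\<Sum>n<k. (1 / fact n) *\<^sub>R op_pow A n))"
    using op_exp_sums[of A] by (subst sums_iff_shift) simp
  moreover have g: "(\<lambda>n. norm A ^ (n + k) /\<^sub>R fact (n + k)) sums
      (exp (norm A) - (\<Sum>n<k. norm A ^ n /\<^sub>R fact n))"
    using exp_converges[of "norm A"] by (subst sums_iff_shift) simp
  ultimately show ?thesis
    using norm_suminf_le[OF norm_exp_term_le[where A = A and n = "_ + k"] sums_summable[OF g]]
    by (simp add: sums_iff)
qed

lemma norm_op_exp_minus_id: "norm (op_exp A - id_blinfun) \<le> exp (norm (A :: 'a::banach \<Rightarrow>\<^sub>L 'a)) - 1"
  using norm_op_exp_tail[of A 1] by simp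

lemma norm_op_exp_minus_linear:
  "norm (op_exp A - id_blinfun - A) \<le> exp (norm (A :: 'a::banach \<Rightarrow>\<^sub>L 'a)) - 1 - norm A"
  using norm_op_exp_tail[of A 2] by (simp add: numeral_2_eq_2 algebra_simps)

lemma op_exp_commute: "op_exp A o\<^sub>L A = A o\<^sub>L op_exp (A :: 'a::banach \<Rightarrow>\<^sub>L 'a)"
proof (rule sums_unique2)
  show "(\<lambda>n. (1 / fact n) *\<^sub>R op_pow A n o\<^sub>L A) sums (op_exp A o\<^sub>L A)"
    by (rule bounded_linear.sums[OF ocomp.bounded_linear_left op_exp_sums])
  show "(\<lambda>n. (1 / fact n) *\<^sub>R op_pow A n o\<^sub>L A) sums (A o\<^sub>L op_exp A)"
    using bounded_linear.sums[OF ocomp.bounded_linear_right op_exp_sums, of A A]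
    by (simp add: ocomp.scaleR_left ocomp.scaleR_right op_pow_commute)
qed

lemma complex_linear_zero: "complex_linear 0"
  by (simp add: complex_linear_def scaleC.zero_right)

lemma complex_linear_sum: "(\<And>i. i \<in> I \<Longrightarrow> complex_linear (f i)) \<Longrightarrow> complex_linear (\<Sum>i\<in>I. f i)"
  by (induction I rule: infinite_finite_induct)
    (simp_all add: complex_linear_add complex_linear_zero)

lemma complex_linear_op_exp:
  fixes A :: "'a::{banach, complex_normed_vector} \<Rightarrow>\<^sub>L 'a"
  assumes "complex_linear A"
  shows "complex_linear (op_exp A)"
  by (rule complex_linear_tendsto[OF op_exp_sums[of A, unfolded sums_def]])
    (auto intro!: complex_linear_sum complex_linear_scaleR complex_linear_op_pow assms)

lemma has_derivative_op_exp:
  fixes T :: "'a::{banach, complex_normed_vector} \<Rightarrow>\<^sub>L 'a"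
  assumes T: "complex_linear T"
  shows "((\<lambda>t. op_exp (t *\<^sub>C T)) has_derivative (\<lambda>h. h *\<^sub>C (T o\<^sub>L op_exp (t *\<^sub>C T)))) (at t)"
proof -
  define R where "R = cmod t + 1"
  define f where "f n x = (x ^ n / fact n) *\<^sub>C op_pow T n" for n and x :: complex
  define f' where "f' n x h = (h * (of_nat n * x ^ (n - 1)) / fact n) *\<^sub>C op_pow T n" for n and x h :: complex
  have f_eq: "f n x = (1 / fact n) *\<^sub>R op_pow (x *\<^sub>C T) n" for n x
    unfolding f_def op_pow_scaleC[OF T] scaleC_of_real[symmetric]
    by (simp add: scaleC_scaleC)
  have sums: "(\<lambda>n. f n x) sums op_exp (x *\<^sub>C T)" for x
    unfolding f_eq by (rule op_exp_sums)
  have f'_Suc: "f' (Suc n) x h = h *\<^sub>C (T o\<^sub>L f n x)" for n x h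
    unfolding f'_def f_def compose_scaleC_right[OF T] scaleC_scaleC
    by (simp add: divide_simps del: of_nat_Suc)
  have sum_f': "(\<Sum>i<Suc n. f' i x h) = h *\<^sub>C (T o\<^sub>L (\<Sum>i<n. f i x))" for n x h
    unfolding sum.lessThan_Suc_shift f'_Suc
    by (simp add: f'_def scaleC.sum_right ocomp.sum_right scaleC.zero_left)
  have "uniform_limit (ball 0 R) (\<lambda>n x. \<Sum>i<n. f i x) (\<lambda>x. suminf (\<lambda>i. f i x)) sequentially"
  proof (rule Weierstrass_m_test)
    show "summable (\<lambda>n. (R * norm T) ^ n /\<^sub>R fact n)" by (rule summable_exp_generic)
    fix n and x :: complex assume "x \<in> ball 0 R"
    then have "norm (x *\<^sub>C T) ^ n \<le> (R * norm T) ^ n"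
      by (intro power_mono) (auto simp: norm_scaleC intro!: mult_right_mono)
    then have "norm (x *\<^sub>C T) ^ n /\<^sub>R fact n \<le> (R * norm T) ^ n /\<^sub>R fact n"
      by (simp add: divide_simps)
    then show "norm (f n x) \<le> (R * norm T) ^ n /\<^sub>R fact n"
      unfolding f_eq by (rule order_trans[OF norm_exp_term_le])
  qed
  then have unif: "uniform_limit (ball 0 R) (\<lambda>n x. \<Sum>i<n. f i x) (\<lambda>x. op_exp (x *\<^sub>C T)) sequentially"
    using sums_unique[OF sums] by simp
  have "\<exists>g. \<forall>x\<in>ball 0 R. (\<lambda>n. f n x) sums (g x) \<and>
      (g has_derivative (\<lambda>h. h *\<^sub>C (T o\<^sub>L op_exp (x *\<^sub>C T)))) (at x within ball 0 R)"
  proof (rule has_derivative_series[where f' = f' and x = 0 and l = "op_exp (0 *\<^sub>C T)"])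
    show "(f n has_derivative f' n x) (at x within ball 0 R)" for n x
    proof -
      have "((\<lambda>x. x ^ n / fact n) has_derivative (\<lambda>h. h * (of_nat n * x ^ (n - 1)) / fact n)) (at x within ball 0 R)"
        by (auto intro!: derivative_eq_intros simp: field_simps)
      then show ?thesis
        unfolding f_def f'_def by (rule bounded_linear.has_derivative[OF scaleC.bounded_linear_left])
    qed
    show "\<forall>\<^sub>F n in sequentially. \<forall>x\<in>ball 0 R. \<forall>h.
       norm (sum (\<lambda>i. f' i x h) {..<n} - h *\<^sub>C (T o\<^sub>L op_exp (x *\<^sub>C T))) \<le> e * norm h"
      if "e > 0" for e
    proof -
      from that have "e / (norm T + 1) > 0" by (simp add: add_nonneg_pos)
      with unif have "\<forall>\<^sub>F n in sequentially. \<forall>x\<in>ball 0 R.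
          dist (\<Sum>i<n. f i x) (op_exp (x *\<^sub>C T)) < e / (norm T + 1)"
        by (rule uniform_limitD)
      then have "\<forall>\<^sub>F n in sequentially. \<forall>x\<in>ball 0 R. \<forall>h.
         norm (sum (\<lambda>i. f' i x h) {..<Suc n} - h *\<^sub>C (T o\<^sub>L op_exp (x *\<^sub>C T))) \<le> e * norm h"
      proof eventually_elim
        case (elim n)
        show ?case
        proof (intro ballI allI)
          fix x h :: complex assume "x \<in> ball 0 R"
          with elim have d: "norm ((\<Sum>i<n. f i x) - op_exp (x *\<^sub>C T)) \<le> e / (norm T + 1)"
            by (auto simp: dist_norm less_imp_le)
          have "norm (T o\<^sub>L ((\<Sum>i<n. f i x) - op_exp (x *\<^sub>C T)))
              \<le> norm T * norm ((\<Sum>i<n. f i x) - op_exp (x *\<^sub>C T))"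
            by (rule norm_blinfun_compose)
          also have "\<dots> \<le> (norm T + 1) * (e / (norm T + 1))"
            by (intro mult_mono d) auto
          also have "\<dots> = e" by (simp add: add_nonneg_eq_0_iff)
          finally have "norm (T o\<^sub>L ((\<Sum>i<n. f i x) - op_exp (x *\<^sub>C T))) * norm h \<le> e * norm h"
            by (rule mult_right_mono) simp
          then have "norm (h *\<^sub>C (T o\<^sub>L ((\<Sum>i<n. f i x) - op_exp (x *\<^sub>C T)))) \<le> e * norm h"
            unfolding norm_scaleC by (simp only: mult.commute[of "norm h"])
          then show "norm (sum (\<lambda>i. f' i x h) {..<Suc n} - h *\<^sub>C (T o\<^sub>L op_exp (x *\<^sub>C T))) \<le> e * norm h"
            unfolding sum_f' by (simp add: ocomp.diff_right scaleC.diff_right)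
        qed
      qed
      then show ?thesis
        by (rule eventually_sequentially_Suc[THEN iffD1])
    qed
    show "(\<lambda>n. f n 0) sums op_exp (0 *\<^sub>C T)" by (rule sums)
  qed (auto simp: R_def add_nonneg_pos)
  then obtain g where g: "\<And>x. x \<in> ball 0 R \<Longrightarrow> (\<lambda>n. f n x) sums (g x)"
    "\<And>x. x \<in> ball 0 R \<Longrightarrow> (g has_derivative (\<lambda>h. h *\<^sub>C (T o\<^sub>L op_exp (x *\<^sub>C T)))) (at x within ball 0 R)"
    by blast
  have t: "t \<in> ball 0 R" by (simp add: R_def)
  have "((\<lambda>t. op_exp (t *\<^sub>C T)) has_derivative (\<lambda>h. h *\<^sub>C (T o\<^sub>L op_exp (t *\<^sub>C T)))) (at t within ball 0 R)"
    by (rule has_derivative_transform[OF t _ g(2)[OF t]]) (metis g(1) sums sums_unique2)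
  then show ?thesis unfolding at_within_open[OF t open_ball] .
qed

lemma op_exp_add:
  fixes T :: "'a::{banach, complex_normed_vector} \<Rightarrow>\<^sub>L 'a"
  assumes T: "complex_linear T"
  shows "op_exp ((a + b) *\<^sub>C T) = op_exp (a *\<^sub>C T) o\<^sub>L op_exp (b *\<^sub>C T)"
proof -
  define F where "F t = op_exp (t *\<^sub>C T)" for t
  define g where "g t = F t o\<^sub>L F (a + b - t)" for t
  have dF: "(F has_derivative (\<lambda>h. h *\<^sub>C (T o\<^sub>L F t))) (at t)" for t
    unfolding F_def by (rule has_derivative_op_exp[OF T])
  have lin: "complex_linear (F t)" for t
    unfolding F_def by (intro complex_linear_op_exp complex_linear_scaleC T)
  have comm: "F t o\<^sub>L T = T o\<^sub>L F t" for t
  proof (cases "t = 0")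
    case False
    have "t *\<^sub>C (F t o\<^sub>L T) = t *\<^sub>C (T o\<^sub>L F t)"
      using op_exp_commute[of "t *\<^sub>C T"] compose_scaleC_right[OF lin, of t t T]
      by (simp add: F_def scaleC_compose_left)
    then have "inverse t *\<^sub>C (t *\<^sub>C (F t o\<^sub>L T)) = inverse t *\<^sub>C (t *\<^sub>C (T o\<^sub>L F t))"
      by simp
    then show ?thesis using False by (simp add: scaleC_scaleC)
  qed (simp add: F_def scaleC.zero_left)
  have "(g has_derivative (\<lambda>h. 0)) (at t within UNIV)" for t
  proof -
    have c: "((\<lambda>t. F (a + b - t)) has_derivative (\<lambda>h. (- h) *\<^sub>C (T o\<^sub>L F (a + b - t)))) (at t)"
      by (rule has_derivative_compose[OF _ dF]) (auto intro!: derivative_eq_intros)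
    show ?thesis
      unfolding g_def
      by (rule has_derivative_eq_rhs[OF ocomp.FDERIV[OF dF c]])
        (simp add: fun_eq_iff compose_scaleC_right[OF lin] scaleC_compose_left comm
          blinfun_compose_assoc[symmetric] scaleC.minus_left ocomp.minus_right)
  qed
  then obtain c where "\<forall>x\<in>UNIV. g x = c"
    using has_derivative_zero_constant[of UNIV g] by auto
  then have "g a = g 0" by simp
  then show ?thesis by (simp add: g_def F_def scaleC.zero_left)
qed

lemma op_exp_add_real:
  fixes T :: "'a::{banach, complex_normed_vector} \<Rightarrow>\<^sub>L 'a"
  assumes T: "complex_linear T"
  shows "op_exp ((a + b) *\<^sub>R T) = op_exp (a *\<^sub>R T) o\<^sub>L op_exp (b *\<^sub>R T)"
  using op_exp_add[OF T, of "of_real a" "of_real b"]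
  by (metis of_real_add scaleC_of_real)

lemma op_invertible_op_exp:
  fixes T :: "'a::{banach, complex_normed_vector} \<Rightarrow>\<^sub>L 'a"
  assumes T: "complex_linear T"
  shows "op_invertible (op_exp T)"
  unfolding op_invertible_def
  by (rule exI[of _ "op_exp (- T)"])
    (use op_exp_add_real[OF T, of 1 "-1"] op_exp_add_real[OF T, of "-1" 1] in simp)

lemma op_invertible_ordered_exp:
  fixes A :: "nat \<Rightarrow> 'a::{banach, complex_normed_vector} \<Rightarrow>\<^sub>L 'a"
  assumes "\<And>i. i \<in> {1..k} \<Longrightarrow> complex_linear (A i)"
  shows "op_invertible (ordered_exp A k)"
  using assms
  by (induction k) (auto intro!: op_invertible_compose op_invertible_op_exp op_invertible_id)

lemma complex_linear_ordered_exp: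
  fixes A :: "nat \<Rightarrow> 'a::{banach, complex_normed_vector} \<Rightarrow>\<^sub>L 'a"
  assumes "\<And>i. i \<in> {1..k} \<Longrightarrow> complex_linear (A i)"
  shows "complex_linear (ordered_exp A k)"
  using assms
  by (induction k) (auto intro!: complex_linear_compose complex_linear_op_exp complex_linear_id)

lemma complex_linear_bch_complex:
  fixes B :: "nat \<Rightarrow> 'a::{banach, complex_normed_vector} \<Rightarrow>\<^sub>L 'a"
  assumes "\<And>i. i \<in> {1..k} \<Longrightarrow> complex_linear (B i)"
  shows "complex_linear (bch_complex B s k t)"
  unfolding bch_complex_def
  by (intro complex_linear_ordered_exp complex_linear_scaleC assms)

lemma bch_complex_derivative:
  fixes B :: "nat \<Rightarrow> 'a::{banach, complex_normed_vector} \<Rightarrow>\<^sub>L 'a"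
  assumes "\<And>i. i \<in> {1..k} \<Longrightarrow> complex_linear (B i)"
  obtains D where "continuous_on UNIV D"
    "\<And>t. (bch_complex B s k has_derivative (\<lambda>h. h *\<^sub>C D t)) (at t)"
proof -
  have "\<exists>D. continuous_on UNIV D \<and> (\<forall>t. (bch_complex B s k has_derivative (\<lambda>h. h *\<^sub>C D t)) (at t))"
    using assms
  proof (induction k)
    case 0
    show ?case
      by (rule exI[of _ "\<lambda>_. 0"]) (simp add: bch_complex_def[abs_def] scaleC.zero_right)
  next
    case (Suc k)
    then obtain D where D: "continuous_on UNIV D"
      "\<And>t. (bch_complex B s k has_derivative (\<lambda>h. h *\<^sub>C D t)) (at t)" by auto
    define T where "T = of_real (s (Suc k)) *\<^sub>C B (Suc k)"
    have T: "complex_linear T"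
      unfolding T_def by (intro complex_linear_scaleC Suc.prems) simp
    let ?F = "\<lambda>t. op_exp (t *\<^sub>C T)"
    have E: "bch_complex B s (Suc k) = (\<lambda>t. ?F t o\<^sub>L bch_complex B s k t)"
      by (simp add: bch_complex_def[abs_def] T_def scaleC_scaleC)
    let ?D = "\<lambda>t. (?F t o\<^sub>L D t) + (T o\<^sub>L ?F t o\<^sub>L bch_complex B s k t)"
    have lin: "complex_linear (?F t)" for t
      by (intro complex_linear_op_exp complex_linear_scaleC T)
    have "(bch_complex B s (Suc k) has_derivative (\<lambda>h. h *\<^sub>C ?D t)) (at t)" for t
      unfolding E
      by (rule has_derivative_eq_rhs[OF ocomp.FDERIV[OF has_derivative_op_exp[OF T] D(2)]])
        (simp add: fun_eq_iff compose_scaleC_right[OF lin] scaleC_compose_left scaleC_add_right)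
    moreover have "continuous_on UNIV ?F" "continuous_on UNIV (bch_complex B s k)"
      by (rule has_derivative_continuous_on, rule has_derivative_at_withinI,
        rule has_derivative_op_exp[OF T] D(2))+
    then have "continuous_on UNIV ?D"
      by (intro continuous_intros D)
    ultimately show ?case by blast
  qed
  then show ?thesis using that by blast
qed

section \<open>Complex inner products\<close>

lemma cinner_add_left: "cinner (x + y) z = cinner x z + cinner y (z::'a::complex_inner)"
  by (metis cinner_add_right cinner_commute complex_cnj_add)

lemma cinner_scaleC_left: "cinner (c *\<^sub>C x) y = cnj c * cinner x (y::'a::complex_inner)"
  by (metis cinner_commute cinner_scaleC_right complex_cnj_cnj complex_cnj_mult)

lemma norm_add_squared:
  "(norm (x + y :: 'a::complex_inner))\<^sup>2 = (norm x)\<^sup>2 + 2 * Re (cinner x y) + (norm y)\<^sup>2"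
proof -
  have "cinner (x + y) (x + y) = cinner x x + (cinner x y + cnj (cinner x y)) + cinner y y"
    using cinner_commute[of y x] by (simp add: cinner_add_left cinner_add_right)
  then have "Re (cinner (x + y) (x + y)) = Re (cinner x x) + 2 * Re (cinner x y) + Re (cinner y y)"
    by simp
  then show ?thesis by (simp only: cinner_self Re_complex_of_real)
qed

lemma Re_cinner_le: "Re (cinner x y) \<le> norm x * norm (y::'a::complex_inner)"
proof -
  have "(norm (x + y))\<^sup>2 \<le> (norm x + norm y)\<^sup>2"
    by (intro power_mono norm_triangle_ineq) simp
  then show ?thesis unfolding norm_add_squared by (simp add: power2_sum)
qed

lemma cmod_cinner_le: "cmod (cinner x y) \<le> norm x * norm (y::'a::complex_inner)"
proof (cases "cinner x y = 0")
  case False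
  define u where "u = cnj (cinner x y) / cmod (cinner x y)"
  have u: "cmod u = 1" using False by (simp add: u_def norm_divide)
  have "cinner x (u *\<^sub>C y) = cmod (cinner x y)"
    using False by (simp add: u_def cinner_scaleC_right complex_norm_square[symmetric] power2_eq_square
      mult.commute[of "cnj _"])
  then have "cmod (cinner x y) = Re (cinner x (u *\<^sub>C y))" by simp
  also have "\<dots> \<le> norm x * norm (u *\<^sub>C y)" by (rule Re_cinner_le)
  finally show ?thesis by (simp add: norm_scaleC u)
qed simp

lemma bounded_bilinear_cinner [bounded_bilinear]:
  "bounded_bilinear (cinner :: 'a::complex_inner \<Rightarrow> 'a \<Rightarrow> complex)"
proof
  fix r :: real and x y :: 'a
  have R: "r *\<^sub>R z = complex_of_real r *\<^sub>C z" for z :: 'a by (simp add: scaleC_of_real)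
  show "cinner (r *\<^sub>R x) y = r *\<^sub>R cinner x y" "cinner x (r *\<^sub>R y) = r *\<^sub>R cinner x y"
    by (simp_all add: R cinner_scaleC_left cinner_scaleC_right scaleR_conv_of_real)
  show "\<exists>K. \<forall>(x::'a) y. norm (cinner x y) \<le> norm x * norm y * K"
    by (rule exI[of _ 1]) (simp add: cmod_cinner_le)
qed (simp_all add: cinner_add_left cinner_add_right)

interpretation cinner: bounded_bilinear "cinner :: 'a::complex_inner \<Rightarrow> 'a \<Rightarrow> complex"
  by (rule bounded_bilinear_cinner)

lemma cinner_ext:
  assumes "\<And>y. cinner y u = cinner y (v::'a::complex_inner)"
  shows "u = v"
proof -
  have "cinner (u - v) (u - v) = 0" using assms[of "u - v"] by (simp add: cinner.diff_right)
  then show ?thesis by (simp add: cinner_self)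
qed

section \<open>The logarithm\<close>

definition segment_invertible :: "('a::real_normed_vector \<Rightarrow>\<^sub>L 'a) \<Rightarrow> bool" where
  "segment_invertible A \<longleftrightarrow> (\<forall>l\<in>{0..1}. op_invertible (l *\<^sub>R id_blinfun + (1 - l) *\<^sub>R A))"

lemma logable_iff_half_line: "logable A \<longleftrightarrow> (\<forall>m\<ge>0. op_invertible (A + m *\<^sub>R id_blinfun))"
proof -
  have eq: "A - complex_of_real (- m) *\<^sub>C id_blinfun = A + m *\<^sub>R id_blinfun" for m
    unfolding scaleC_of_real by simp
  have "z \<in> \<real>\<^sub>\<le>\<^sub>0 \<longleftrightarrow> (\<exists>m\<ge>0. z = complex_of_real (- m))" for z
  proof
    assume "z \<in> \<real>\<^sub>\<le>\<^sub>0"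
    then obtain r where "z = complex_of_real r" "r \<le> 0" by (auto simp: nonpos_Reals_def)
    then show "\<exists>m\<ge>0. z = complex_of_real (- m)" by (intro exI[of _ "- r"]) simp
  qed auto
  then have "(\<forall>z. z \<in> \<real>\<^sub>\<le>\<^sub>0 \<longrightarrow> P z) \<longleftrightarrow> (\<forall>m\<ge>0. P (complex_of_real (- m)))" for P
    by auto
  moreover have "logable A \<longleftrightarrow> (\<forall>z. z \<in> \<real>\<^sub>\<le>\<^sub>0 \<longrightarrow> op_invertible (A - z *\<^sub>C id_blinfun))"
    unfolding logable_def spectrum_def disjoint_iff mem_Collect_eq by auto
  ultimately show ?thesis by (simp only: eq)
qed

lemma logable_iff: "logable A \<longleftrightarrow> segment_invertible A"
  unfolding logable_iff_half_line segment_invertible_def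
proof (intro iffI allI ballI impI)
  fix l :: real assume *: "\<forall>m\<ge>0. op_invertible (A + m *\<^sub>R id_blinfun)" and l: "l \<in> {0..1}"
  show "op_invertible (l *\<^sub>R id_blinfun + (1 - l) *\<^sub>R A)"
  proof (cases "l = 1")
    case False
    then have "op_invertible ((1 - l) *\<^sub>R (A + (l / (1 - l)) *\<^sub>R id_blinfun))"
      using * l by (intro op_invertible_scaleR) auto
    then show ?thesis using False by (simp add: scaleR_add_right add.commute)
  qed (simp add: op_invertible_id)
next
  fix m :: real assume *: "\<forall>l\<in>{0..1}. op_invertible (l *\<^sub>R id_blinfun + (1 - l) *\<^sub>R A)" and m: "m \<ge> 0"
  let ?l = "m / (1 + m)"
  have "op_invertible ((1 + m) *\<^sub>R (?l *\<^sub>R id_blinfun + (1 - ?l) *\<^sub>R A))"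
    using * m by (intro op_invertible_scaleR) auto
  moreover have "(1 + m) * (1 - ?l) = 1" "(1 + m) * ?l = m"
    using m by (auto simp: field_simps)
  ultimately show "op_invertible (A + m *\<^sub>R id_blinfun)"
    by (simp only: scaleR_add_right scaleR_scaleR scaleR_one add.commute)
qed

lemma open_segment_invertible: "open {A :: 'a::banach \<Rightarrow>\<^sub>L 'a. segment_invertible A}"
proof (rule Topological_Spaces.openI)
  fix A :: "'a \<Rightarrow>\<^sub>L 'a" assume "A \<in> {A. segment_invertible A}"
  let ?f = "\<lambda>(X :: 'a \<Rightarrow>\<^sub>L 'a, l::real). l *\<^sub>R id_blinfun + (1 - l) *\<^sub>R X"
  let ?W = "?f -` {A. op_invertible A}"
  have "\<exists>X. A \<in> X \<and> open X \<and> X \<times> {0..1} \<subseteq> ?W"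
  proof (rule Elementary_Topology.tube_lemma)
    show "open ?W"
      by (intro open_vimage open_op_invertible)
        (auto simp: case_prod_beta intro!: continuous_intros)
    show "{A} \<times> {0..1} \<subseteq> ?W"
      using \<open>A \<in> _\<close> by (auto simp: segment_invertible_def)
  qed simp
  then obtain X where X: "A \<in> X" "open X" "X \<times> {0..1} \<subseteq> ?W" by blast
  have "segment_invertible Y" if "Y \<in> X" for Y
    unfolding segment_invertible_def
  proof
    fix l :: real assume "l \<in> {0..1}"
    with that X(3) have "(Y, l) \<in> ?W" by blast
    then show "op_invertible (l *\<^sub>R id_blinfun + (1 - l) *\<^sub>R Y)" by simp
  qed
  then show "\<exists>T. open T \<and> A \<in> T \<and> T \<subseteq> {A. segment_invertible A}"
    using X by (intro exI[of _ X]) blast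
qed

lemma segment_invertibleD:
  "segment_invertible A \<Longrightarrow> 0 \<le> l \<Longrightarrow> l \<le> 1 \<Longrightarrow> op_invertible (l *\<^sub>R id_blinfun + (1 - l) *\<^sub>R A)"
  by (auto simp: segment_invertible_def)

lemma continuous_on_segment_inverse:
  fixes E :: "'b::topological_space \<Rightarrow> 'a::banach \<Rightarrow>\<^sub>L 'a"
  assumes "continuous_on S E" "\<And>t. t \<in> S \<Longrightarrow> segment_invertible (E t)"
  shows "continuous_on (S \<times> cbox 0 (1::real))
    (\<lambda>x. op_inverse (snd x *\<^sub>R id_blinfun + (1 - snd x) *\<^sub>R E (fst x)))"
proof (rule continuous_on_compose2[OF continuous_on_op_inverse])
  show "continuous_on (S \<times> cbox 0 (1::real)) (\<lambda>x. snd x *\<^sub>R id_blinfun + (1 - snd x) *\<^sub>R E (fst x))"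
    by (intro continuous_intros continuous_on_compose2[OF assms(1)]) auto
qed (use assms(2) in \<open>auto intro!: segment_invertibleD\<close>)

lemma continuous_on_op_log_integrand:
  fixes E :: "'b::topological_space \<Rightarrow> 'a::banach \<Rightarrow>\<^sub>L 'a"
  assumes "continuous_on S E" "\<And>t. t \<in> S \<Longrightarrow> segment_invertible (E t)"
  shows "continuous_on (S \<times> cbox 0 (1::real)) (\<lambda>(t, l). (E t - id_blinfun) o\<^sub>L
    op_inverse (l *\<^sub>R id_blinfun + (1 - l) *\<^sub>R E t))"
  unfolding case_prod_beta
  by (intro continuous_intros continuous_on_segment_inverse continuous_on_compose2[OF assms(1)] assms) auto

lemma continuous_on_op_log:
  "continuous_on {A :: 'a::banach \<Rightarrow>\<^sub>L 'a. segment_invertible A} op_log"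
  unfolding op_log_def[abs_def] cbox_interval[symmetric]
  by (intro integral_continuous_on_param continuous_on_op_log_integrand) auto

lemma op_log_integrable:
  fixes A :: "'a::banach \<Rightarrow>\<^sub>L 'a"
  assumes "segment_invertible A"
  shows "(\<lambda>l. (A - id_blinfun) o\<^sub>L op_inverse (l *\<^sub>R id_blinfun + (1 - l) *\<^sub>R A)) integrable_on {0..1::real}"
proof (rule integrable_continuous_real)
  have "continuous_on ({A} \<times> cbox 0 1) (\<lambda>(t, l). (t - id_blinfun) o\<^sub>L
    op_inverse (l *\<^sub>R id_blinfun + (1 - l) *\<^sub>R t))"
    by (rule continuous_on_op_log_integrand) (use assms in auto)
  then have "continuous_on {0..1} (\<lambda>l. case (A, l) of (t, l) \<Rightarrow> (t - id_blinfun) o\<^sub>L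
    op_inverse (l *\<^sub>R id_blinfun + (1 - l) *\<^sub>R t))"
    by (rule continuous_on_compose2) (auto intro!: continuous_intros)
  then show "continuous_on {0..1} (\<lambda>l. (A - id_blinfun) o\<^sub>L op_inverse (l *\<^sub>R id_blinfun + (1 - l) *\<^sub>R A))"
    by simp
qed

lemma op_log_id [simp]: "op_log id_blinfun = 0"
  by (simp add: op_log_def)

lemma has_derivative_op_inverse:
  fixes A :: "'a::banach \<Rightarrow>\<^sub>L 'a"
  assumes A: "op_invertible A"
  shows "(op_inverse has_derivative (\<lambda>H. - (op_inverse A o\<^sub>L H o\<^sub>L op_inverse A))) (at A)"
proof (rule has_derivativeI)
  let ?N = "op_inverse A"
  show "bounded_linear (\<lambda>H. - (?N o\<^sub>L H o\<^sub>L ?N))"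
    by (intro bounded_linear_minus bounded_linear_compose[OF ocomp.bounded_linear_left]
        ocomp.bounded_linear_right)
  have cont: "(op_inverse \<longlongrightarrow> ?N) (at A)"
    using continuous_on_op_inverse A open_op_invertible
    by (metis continuous_on_eq_continuous_at isCont_def mem_Collect_eq)
  have "\<forall>\<^sub>F X in at A. op_invertible X"
    using open_op_invertible A by (auto simp: eventually_at_topological)
  then have "\<forall>\<^sub>F X in at A. norm ((op_inverse X - ?N - - (?N o\<^sub>L (X - A) o\<^sub>L ?N)) /\<^sub>R norm (X - A))
      \<le> norm (op_inverse X - ?N) * norm ?N"
  proof eventually_elim
    case (elim X)
    have "op_inverse X - ?N - - (?N o\<^sub>L (X - A) o\<^sub>L ?N) = - ((op_inverse X - ?N) o\<^sub>L (X - A) o\<^sub>L ?N)"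
      unfolding op_inverse_diff[OF A elim]
      by (rule blinfun_eqI)
        (simp add: blinfun.diff_left blinfun.diff_right blinfun.add_left blinfun.minus_left
          op_inverse_apply A elim)
    also have "norm \<dots> \<le> norm (op_inverse X - ?N) * norm (X - A) * norm ?N"
      by (simp, intro order_trans[OF norm_blinfun_compose] mult_right_mono norm_blinfun_compose norm_ge_zero)
    finally have le: "norm (op_inverse X - ?N - - (?N o\<^sub>L (X - A) o\<^sub>L ?N)) \<le>
      norm (op_inverse X - ?N) * norm ?N * norm (X - A)" (is "norm ?Z \<le> ?b * _")
      by (simp only: mult_ac)
    have "norm (?Z /\<^sub>R norm (X - A)) = norm ?Z / norm (X - A)"
      by (simp only: norm_scaleR abs_inverse abs_norm_cancel divide_inverse mult.commute)
    also have "\<dots> \<le> ?b"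
      using le by (cases "norm (X - A) = 0") (simp_all add: divide_le_eq)
    finally show ?case .
  qed
  moreover have "((\<lambda>X. norm (op_inverse X - ?N) * norm ?N) \<longlongrightarrow> norm (?N - ?N) * norm ?N) (at A)"
    by (intro tendsto_intros cont)
  then have "((\<lambda>X. norm (op_inverse X - ?N) * norm ?N) \<longlongrightarrow> 0) (at A)" by simp
  ultimately show "((\<lambda>X. (op_inverse X - ?N - - (?N o\<^sub>L (X - A) o\<^sub>L ?N)) /\<^sub>R norm (X - A)) \<longlongrightarrow> 0) (at A)"
    by (rule Lim_null_comparison)
qed

lemma holomorphic_op_log:
  fixes E :: "complex \<Rightarrow> 'h::chilbert_space \<Rightarrow>\<^sub>L 'h"
  assumes dE: "\<And>t. (E has_derivative (\<lambda>h. h *\<^sub>C D t)) (at t)"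
    and contD: "continuous_on UNIV D" and lin: "\<And>t. complex_linear (E t)"
    and inv: "\<And>t. t \<in> U \<Longrightarrow> segment_invertible (E t)" and "convex U"
  shows "(\<lambda>t. cinner y (op_log (E t) x)) holomorphic_on U"
proof -
  define M where "M t l = l *\<^sub>R id_blinfun + (1 - l) *\<^sub>R E t" for t and l :: real
  define N where "N t l = op_inverse (M t l)" for t and l :: real
  define G where "G t l = ((E t - id_blinfun) o\<^sub>L (- (N t l o\<^sub>L ((1 - l) *\<^sub>R D t) o\<^sub>L N t l))) + (D t o\<^sub>L N t l)"
    for t and l :: real
  have contE: "continuous_on U E"
    by (rule has_derivative_continuous_on, rule has_derivative_at_withinI, rule dE)
  have bl: "bounded_linear (\<lambda>A :: 'h \<Rightarrow>\<^sub>L 'h. cinner y (A x))"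
    by (rule bounded_linear_compose[OF cinner.bounded_linear_right blinfun.bounded_linear_left])
  have invM: "op_invertible (M t l)" if "t \<in> U" "l \<in> cbox 0 1" for t l
    using segment_invertibleD[OF inv] that by (auto simp: M_def)
  have linN: "complex_linear (N t l)" if "t \<in> U" "l \<in> cbox 0 1" for t l
    unfolding N_def by (rule complex_linear_op_inverse[OF invM[OF that]])
      (simp add: M_def complex_linear_add complex_linear_scaleR complex_linear_id lin)
  have "(\<lambda>t. integral (cbox 0 1) (\<lambda>l. cinner y (((E t - id_blinfun) o\<^sub>L N t l) x))) holomorphic_on U"
  proof (rule leibniz_rule_holomorphic[OF _ _ _ \<open>convex U\<close>])
    fix t l assume tl: "t \<in> U" "l \<in> cbox (0::real) 1"
    have "((\<lambda>t. M t l) has_derivative (\<lambda>h. (1 - l) *\<^sub>R (h *\<^sub>C D t))) (at t)"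
      unfolding M_def by (auto intro!: derivative_eq_intros dE)
    then have dN: "((\<lambda>t. N t l) has_derivative (\<lambda>h. - (N t l o\<^sub>L ((1 - l) *\<^sub>R (h *\<^sub>C D t)) o\<^sub>L N t l))) (at t)"
      unfolding N_def
      by (rule has_derivative_compose[where g = op_inverse and f = "\<lambda>t. M t l",
            OF _ has_derivative_op_inverse[OF invM[OF tl]]])
    have dE': "((\<lambda>t. E t - id_blinfun) has_derivative (\<lambda>h. h *\<^sub>C D t)) (at t)"
      by (auto intro!: derivative_eq_intros dE)
    have linE: "complex_linear (E t - id_blinfun)"
      by (intro complex_linear_diff lin complex_linear_id)
    have *: "(1 - l) *\<^sub>R (h *\<^sub>C D t) = h *\<^sub>C ((1 - l) *\<^sub>R D t)" for h
      by (simp add: scaleC.scaleR_right)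
    have "((\<lambda>t. (E t - id_blinfun) o\<^sub>L N t l) has_derivative (\<lambda>h. h *\<^sub>C G t l)) (at t)"
      by (rule has_derivative_eq_rhs[OF ocomp.FDERIV[OF dE' dN]])
        (simp only: fun_eq_iff * compose_scaleC_right[OF linN[OF tl]] compose_scaleC_right[OF linE]
          scaleC_compose_left scaleC_add_right G_def ocomp.minus_right scaleC.minus_right simp_thms)
    from bounded_linear.has_derivative[OF bl this]
    have "((\<lambda>t. cinner y (((E t - id_blinfun) o\<^sub>L N t l) x)) has_field_derivative cinner y (G t l x)) (at t)"
      unfolding has_field_derivative_def
      by (simp add: cinner_scaleC_right mult.commute[of _ "cinner y (G t l x)"])
    then show "((\<lambda>t. cinner y (((E t - id_blinfun) o\<^sub>L N t l) x)) has_field_derivative cinner y (G t l x))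
        (at t within U)"
      by (rule has_field_derivative_at_within)
  next
    fix t assume "t \<in> U"
    then have "(\<lambda>l. (E t - id_blinfun) o\<^sub>L N t l) integrable_on cbox 0 1"
      using op_log_integrable[OF inv] by (simp add: N_def M_def)
    from integrable_linear[OF this bl]
    show "(\<lambda>l. cinner y (((E t - id_blinfun) o\<^sub>L N t l) x)) integrable_on cbox 0 1"
      by (simp add: o_def)
  next
    have cN: "continuous_on (U \<times> cbox 0 1) (\<lambda>z. N (fst z) (snd z))"
      unfolding N_def M_def by (rule continuous_on_segment_inverse[OF contE inv])
    have cE: "continuous_on (U \<times> cbox (0::real) 1) (\<lambda>z. E (fst z))"
      by (rule continuous_on_compose2[OF contE]) (auto intro: continuous_intros)
    have cD: "continuous_on (U \<times> cbox (0::real) 1) (\<lambda>z. D (fst z))"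
      by (rule continuous_on_compose2[OF contD]) (auto intro: continuous_intros)
    show "continuous_on (U \<times> cbox 0 1) (\<lambda>(t, l). cinner y (G t l x))"
      unfolding case_prod_beta G_def
      by (intro continuous_intros cN cE cD)
  qed
  then show ?thesis
  proof (rule holomorphic_transform)
    fix t assume t: "t \<in> U"
    have "(\<lambda>l. (E t - id_blinfun) o\<^sub>L N t l) integrable_on cbox 0 1"
      using op_log_integrable[OF inv[OF t]] by (simp add: N_def M_def)
    from integral_linear[OF this bl]
    show "integral (cbox 0 1) (\<lambda>l. cinner y (((E t - id_blinfun) o\<^sub>L N t l) x)) = cinner y (op_log (E t) x)"
      by (simp add: o_def op_log_def N_def M_def)
  qed
qed

section \<open>Taylor expansion of operator functions\<close>

lemma power_series_unique:
  fixes a b :: "nat \<Rightarrow> 'a::banach"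
  assumes "r > 0"
    and a: "\<And>t::real. \<bar>t\<bar> < r \<Longrightarrow> (\<lambda>n. t ^ n *\<^sub>R a n) sums f t"
    and b: "\<And>t::real. \<bar>t\<bar> < r \<Longrightarrow> (\<lambda>n. t ^ n *\<^sub>R b n) sums f t"
  shows "a = b"
proof -
  define c where "c n = a n - b n" for n
  have c: "(\<lambda>n. t ^ n *\<^sub>R c n) sums 0" if "\<bar>t\<bar> < r" for t
    using sums_diff[OF a b, OF that that] by (simp add: c_def scaleR_diff_right)
  have "c m = 0" for m
  proof (induction m rule: less_induct)
    case (less m)
    define d where "d n = c (n + m)" for n
    have d: "(\<lambda>n. t ^ n *\<^sub>R d n) sums 0" if "\<bar>t\<bar> < r" "t \<noteq> 0" for t
    proof -
      have "(\<lambda>n. t ^ (n + m) *\<^sub>R c (n + m)) sums 0"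
        using sums_split_initial_segment[OF c[OF that(1)], of m] less.IH by simp
      then have "(\<lambda>n. (1 / t ^ m) *\<^sub>R (t ^ (n + m) *\<^sub>R c (n + m))) sums ((1 / t ^ m) *\<^sub>R 0)"
        by (intro sums_scaleR_right)
      then show ?thesis using that(2) by (simp add: d_def power_add)
    qed
    have "(\<lambda>n. (r / 2) ^ n *\<^sub>R d n) \<longlonglongrightarrow> 0"
      by (rule summable_LIMSEQ_zero, rule sums_summable, rule d) (use \<open>r > 0\<close> in auto)
    then have "Bseq (\<lambda>n. (r / 2) ^ n *\<^sub>R d n)"
      by (rule convergent_imp_Bseq[OF convergentI])
    then obtain K where K: "K > 0" "\<And>n. norm ((r / 2) ^ n *\<^sub>R d n) \<le> K"
      by (auto simp: Bseq_def)
    have bound: "norm (d 0) \<le> q * (2 * K)" if q: "0 < q" "q \<le> 1/2" for q :: real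
    proof -
      let ?t = "q * (r / 2)"
      have t: "\<bar>?t\<bar> < r" "?t \<noteq> 0" using q \<open>r > 0\<close> by (auto simp: abs_mult)
      have le: "norm (?t ^ n *\<^sub>R d n) \<le> q ^ n * K" for n
      proof -
        have "?t ^ n *\<^sub>R d n = q ^ n *\<^sub>R ((r / 2) ^ n *\<^sub>R d n)"
          unfolding scaleR_scaleR power_mult_distrib[symmetric] by simp
        also have "norm \<dots> = q ^ n * norm ((r / 2) ^ n *\<^sub>R d n)"
          unfolding norm_scaleR[of "q ^ n"] using q by simp
        also have "\<dots> \<le> q ^ n * K"
          by (rule mult_left_mono[OF K(2)]) (use q in simp)
        finally show ?thesis .
      qed
      have g: "(\<lambda>n. q ^ Suc n * K) sums (q / (1 - q) * K)"
        using sums_mult2[OF sums_mult[OF geometric_sums[of q], of q], of K] q by (simp add: mult.assoc)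
      have s: "(\<lambda>n. ?t ^ Suc n *\<^sub>R d (Suc n)) sums (- d 0)"
        using d[OF t] by (subst sums_Suc_iff) simp
      have "norm (suminf (\<lambda>n. ?t ^ Suc n *\<^sub>R d (Suc n))) \<le> suminf (\<lambda>n. q ^ Suc n * K)"
        by (rule norm_suminf_le[OF le sums_summable[OF g]])
      then have "norm (d 0) \<le> q / (1 - q) * K"
        using s g by (simp add: sums_iff)
      also have "q / (1 - q) * K \<le> q * 2 * K"
        using q K(1) by (intro mult_right_mono) (auto simp: field_simps)
      finally show ?thesis by simp
    qed
    have "((\<lambda>q. q * (2 * K)) \<longlongrightarrow> 0 * (2 * K)) (at_right 0)"
      by (intro tendsto_intros)
    moreover have "\<forall>\<^sub>F q in at_right 0. norm (d 0) \<le> q * (2 * K)"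
      using bound by (auto simp: eventually_at_right_field intro!: exI[of _ "1/2"])
    ultimately have "norm (d 0) \<le> 0 * (2 * K)"
      by (intro tendsto_lowerbound) auto
    then show ?case by (simp add: d_def)
  qed
  then show ?thesis by (auto simp: c_def)
qed

lemma operator_taylor:
  fixes f :: "complex \<Rightarrow> 'h::chilbert_space \<Rightarrow>\<^sub>L 'h"
  assumes cont: "continuous_on (ball 0 R) f" and "R > 0"
    and hol: "\<And>x y. (\<lambda>t. cinner y (f t x)) holomorphic_on ball 0 R"
  obtains \<mu> where "\<And>t. cmod t < R \<Longrightarrow> summable (\<lambda>n. norm (t ^ n *\<^sub>C \<mu> n))"
    "\<And>t. cmod t < R \<Longrightarrow> (\<lambda>n. t ^ n *\<^sub>C \<mu> n) sums f t"
proof -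
  define e where "e \<theta> = exp (2 * of_real pi * \<i> * of_real \<theta>)" for \<theta> :: real
  define a where "a x y n = (deriv ^^ n) (\<lambda>t. cinner y (f t x)) 0 / fact n" for x y n
  define I where "I r n \<theta> = inverse (of_real r * e \<theta>) ^ n *\<^sub>C f (of_real r * e \<theta>)" for r n \<theta>
  define \<nu> where "\<nu> r n = integral {0..1} (I r n)" for r n
  have e: "cmod (e \<theta>) = 1" "e \<theta> \<noteq> 0" for \<theta> by (simp_all add: e_def norm_exp_eq_Re)
  have conte: "continuous_on S e" for S unfolding e_def by (intro continuous_intros)
  have contf: "continuous_on {0..1} (\<lambda>\<theta>. f (of_real r * e \<theta>))" if "0 < r" "r < R" for r
    by (rule continuous_on_compose2[OF cont])
      (use that in \<open>auto intro!: continuous_intros conte simp: norm_mult e\<close>)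
  have contI: "continuous_on {0..1} (I r n)" if "0 < r" "r < R" for r n
    unfolding I_def
    by (intro continuous_intros contf conte that) (use that in \<open>auto simp: e\<close>)
  have coeff: "cinner y (\<nu> r n x) = a x y n" if r: "0 < r" "r < R" for r n x y
  proof -
    let ?g = "\<lambda>t. cinner y (f t x)"
    have bl: "bounded_linear (\<lambda>A :: 'h \<Rightarrow>\<^sub>L 'h. cinner y (A x))"
      by (rule bounded_linear_compose[OF cinner.bounded_linear_right blinfun.bounded_linear_left])
    have "((\<lambda>A. cinner y (blinfun_apply A x)) \<circ> I r n has_integral cinner y (\<nu> r n x)) {0..1}"
      unfolding \<nu>_def
      by (intro has_integral_linear[OF _ bl] integrable_integral integrable_continuous_real contI r)
    then have 1: "((\<lambda>\<theta>. inverse (of_real r * e \<theta>) ^ n * ?g (of_real r * e \<theta>)) has_integral cinner y (\<nu> r n x)) {0..1}"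
      by (simp add: o_def I_def cinner_scaleC_right)
    have "((\<lambda>u. ?g u / (u - 0) ^ Suc n) has_contour_integral
        ((2 * pi * \<i>) / fact n * (deriv ^^ n) ?g 0)) (circlepath 0 r)"
    proof (rule Cauchy_has_contour_integral_higher_derivative_circlepath)
      have sub: "cball 0 r \<subseteq> ball 0 R" using r by auto
      show "continuous_on (cball 0 r) ?g"
        by (rule continuous_on_subset[OF holomorphic_on_imp_continuous_on[OF hol] sub])
      show "?g holomorphic_on ball 0 r"
        by (rule holomorphic_on_subset[OF hol]) (use sub in auto)
    qed (use r in auto)
    then have "((\<lambda>\<theta>. ?g (of_real r * e \<theta>) / (of_real r * e \<theta>) ^ Suc n * (2 * pi * \<i> * r * e \<theta>))
        has_integral (2 * pi * \<i>) / fact n * (deriv ^^ n) ?g 0) {0..1}"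
      unfolding has_contour_integral_def
    proof (rule has_integral_eq[rotated])
      fix \<theta> :: real assume "\<theta> \<in> {0..1}"
      then have "vector_derivative (circlepath 0 r) (at \<theta> within {0..1}) = 2 * pi * \<i> * r * e \<theta>"
        by (simp add: vector_derivative_circlepath01 e_def)
      moreover have "circlepath 0 r \<theta> = of_real r * e \<theta>"
        by (simp add: circlepath e_def)
      ultimately show "?g (circlepath 0 r \<theta>) / (circlepath 0 r \<theta> - 0) ^ Suc n *
            vector_derivative (circlepath 0 r) (at \<theta> within {0..1}) =
          ?g (of_real r * e \<theta>) / (of_real r * e \<theta>) ^ Suc n * (2 * pi * \<i> * r * e \<theta>)"
        by (simp only: diff_zero)
    qed
    from has_integral_mult_right[OF this, of "1 / (2 * pi * \<i>)"]
    have "((\<lambda>\<theta>. 1 / (2 * pi * \<i>) * (?g (of_real r * e \<theta>) / (of_real r * e \<theta>) ^ Suc n * (2 * pi * \<i> * r * e \<theta>)))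
        has_integral a x y n) {0..1}"
      by (simp add: a_def)
    then have "((\<lambda>\<theta>. inverse (of_real r * e \<theta>) ^ n * ?g (of_real r * e \<theta>)) has_integral a x y n) {0..1}"
      by (rule has_integral_eq[rotated]) (use r in \<open>simp add: e field_simps\<close>)
    with 1 show ?thesis by (rule has_integral_unique)
  qed
  have indep: "\<nu> r n = \<nu> r' n" if "0 < r" "r < R" "0 < r'" "r' < R" for r r' n
    by (intro blinfun_eqI cinner_ext) (simp add: coeff that)
  have bound: "\<exists>M. \<forall>n. norm (\<nu> r n) \<le> M * inverse r ^ n" if r: "0 < r" "r < R" for r
  proof -
    have "bounded ((\<lambda>\<theta>. f (of_real r * e \<theta>)) ` {0..1})"
      by (intro compact_imp_bounded compact_continuous_image contf r) simp
    then obtain M where M: "\<And>\<theta>. \<theta> \<in> {0..1} \<Longrightarrow> norm (f (of_real r * e \<theta>)) \<le> M"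
      unfolding bounded_iff by blast
    have "norm (\<nu> r n) \<le> (M * inverse r ^ n) * (1 - 0)" for n
      unfolding \<nu>_def
    proof (rule integral_bound[OF _ contI[OF r]])
      fix \<theta> :: real assume "\<theta> \<in> {0..1}"
      with M[OF this] r show "norm (I r n \<theta>) \<le> M * inverse r ^ n"
        by (simp add: I_def norm_scaleC norm_power norm_inverse norm_mult e mult.commute mult_left_mono)
    qed simp
    then show ?thesis by auto
  qed
  define \<mu> where "\<mu> = \<nu> (R / 2)"
  show ?thesis
  proof (rule that[of \<mu>])
    fix t assume t: "cmod t < R"
    define r where "r = (cmod t + R) / 2"
    have "cmod t < r" and r: "0 < r" "r < R"
      using t by (auto simp: r_def intro: le_less_trans[OF norm_ge_zero] add_nonneg_pos)
    have \<mu>: "\<mu> n = \<nu> r n" for n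
      unfolding \<mu>_def using \<open>R > 0\<close> r by (intro indep) auto
    obtain M where M: "\<And>n. norm (\<mu> n) \<le> M * inverse r ^ n" using bound[OF r] \<mu> by auto
    show summable: "summable (\<lambda>n. norm (t ^ n *\<^sub>C \<mu> n))"
    proof (rule summable_comparison_test')
      show "summable (\<lambda>n. M * (cmod t * inverse r) ^ n)"
        using \<open>cmod t < r\<close> r by (intro summable_mult summable_geometric) (simp add: field_simps)
      fix n
      show "norm (norm (t ^ n *\<^sub>C \<mu> n)) \<le> M * (cmod t * inverse r) ^ n"
        using mult_left_mono[OF M[of n], of "cmod t ^ n"]
        by (simp add: norm_scaleC norm_power power_mult_distrib mult_ac)
    qed
    define S where "S = (\<Sum>n. t ^ n *\<^sub>C \<mu> n)"
    have S: "(\<lambda>n. t ^ n *\<^sub>C \<mu> n) sums S"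
      unfolding S_def by (rule summable_sums[OF summable_norm_cancel[OF summable]])
    have "S x = f t x" for x
    proof (rule cinner_ext)
      fix y
      have bl: "bounded_linear (\<lambda>A :: 'h \<Rightarrow>\<^sub>L 'h. cinner y (A x))"
        by (rule bounded_linear_compose[OF cinner.bounded_linear_right blinfun.bounded_linear_left])
      have "(\<lambda>n. t ^ n * a x y n) sums cinner y (S x)"
        using bounded_linear.sums[OF bl S] by (simp add: cinner_scaleC_right \<mu> coeff r)
      moreover have "(\<lambda>n. (deriv ^^ n) (\<lambda>t. cinner y (f t x)) 0 / fact n * (t - 0) ^ n) sums cinner y (f t x)"
        by (rule holomorphic_power_series[OF hol]) (use t in simp)
      then have "(\<lambda>n. t ^ n * a x y n) sums cinner y (f t x)" by (simp add: a_def mult.commute)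
      ultimately show "cinner y (S x) = cinner y (f t x)" by (rule sums_unique2)
    qed
    then have "S = f t" by (rule blinfun_eqI)
    with S show "(\<lambda>n. t ^ n *\<^sub>C \<mu> n) sums f t" by simp
  qed
qed

section \<open>Angles\<close>

definition rinner :: "'a::complex_inner \<Rightarrow> 'a \<Rightarrow> real" where
  "rinner x y = Re (cinner x y)"

lemma bounded_bilinear_rinner [bounded_bilinear]: "bounded_bilinear (rinner :: 'a::complex_inner \<Rightarrow> _)"
proof
  show "\<exists>K. \<forall>(x::'a) y. norm (rinner x y) \<le> norm x * norm y * K"
    by (rule exI[of _ 1])
      (auto simp: rinner_def intro: order_trans[OF abs_Re_le_cmod cmod_cinner_le])
qed (simp_all add: rinner_def cinner.add_left cinner.add_right cinner.scaleR_left cinner.scaleR_right)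

interpretation rinner: bounded_bilinear "rinner :: 'a::complex_inner \<Rightarrow> 'a \<Rightarrow> real"
  by (rule bounded_bilinear_rinner)

lemma rinner_commute: "rinner x y = rinner y (x::'a::complex_inner)"
  unfolding rinner_def by (subst cinner_commute) simp

lemma rinner_self: "rinner x x = (norm (x::'a::complex_inner))\<^sup>2"
  by (simp add: rinner_def cinner_self)

lemma abs_rinner_le: "\<bar>rinner x y\<bar> \<le> norm x * norm (y::'a::complex_inner)"
  unfolding rinner_def by (rule order_trans[OF abs_Re_le_cmod cmod_cinner_le])

lemma norm_diff_squared:
  "(norm (x - y :: 'a::complex_inner))\<^sup>2 = (norm x)\<^sup>2 - 2 * rinner x y + (norm y)\<^sup>2"
  using norm_add_squared[of x "- y"] by (simp add: rinner_def cinner.minus_right)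

lemma spherical_triangle:
  fixes a b c :: "'a::complex_inner"
  assumes "norm a = 1" "norm b = 1" "norm c = 1"
    and ab: "cos \<alpha> \<le> rinner a b" and bc: "cos \<beta> \<le> rinner b c"
    and "0 \<le> \<alpha>" "0 \<le> \<beta>" "\<alpha> + \<beta> \<le> pi"
  shows "cos (\<alpha> + \<beta>) \<le> rinner a c"
proof -
  define p q where "p = rinner a b" and "q = rinner b c"
  have p: "\<bar>p\<bar> \<le> 1" and q: "\<bar>q\<bar> \<le> 1"
    using abs_rinner_le[of a b] abs_rinner_le[of b c] assms by (auto simp: p_def q_def)
  have "(norm (a - p *\<^sub>R b))\<^sup>2 = 1 - p\<^sup>2" "(norm (c - q *\<^sub>R b))\<^sup>2 = 1 - q\<^sup>2"
    unfolding norm_diff_squared rinner.scaleR_right rinner_commute[of c b] p_def[symmetric] q_def[symmetric]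
    by (simp_all add: assms power2_eq_square)
  then have perp: "norm (a - p *\<^sub>R b) = sqrt (1 - p\<^sup>2)" "norm (c - q *\<^sub>R b) = sqrt (1 - q\<^sup>2)"
    by (metis real_sqrt_abs abs_norm_cancel)+
  have "rinner (a - p *\<^sub>R b) (c - q *\<^sub>R b) = rinner a c - p * q"
    by (simp add: rinner.diff_left rinner.diff_right rinner.scaleR_left rinner.scaleR_right
      rinner_self assms p_def q_def)
  then have "rinner a c \<ge> p * q - sqrt (1 - p\<^sup>2) * sqrt (1 - q\<^sup>2)"
    using abs_rinner_le[of "a - p *\<^sub>R b" "c - q *\<^sub>R b"] unfolding perp by linarith
  also have "p * q - sqrt (1 - p\<^sup>2) * sqrt (1 - q\<^sup>2) = cos (arccos p + arccos q)"
    using p q by (simp add: cos_add cos_arccos_abs sin_arccos_abs)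
  finally have 1: "cos (arccos p + arccos q) \<le> rinner a c" .
  have "arccos p \<le> \<alpha>" "arccos q \<le> \<beta>"
    using arccos_le_arccos[of "cos \<alpha>" p] arccos_le_arccos[of "cos \<beta>" q] p q ab bc assms
    by (auto simp: p_def q_def arccos_cos)
  moreover have "0 \<le> arccos p" "0 \<le> arccos q"
    using p q by (auto intro!: arccos_lbound)
  ultimately have "cos (\<alpha> + \<beta>) \<le> cos (arccos p + arccos q)"
    using assms(8) by (intro cos_monotone_0_pi_le) auto
  with 1 show ?thesis by simp
qed

lemma angle_small_step:
  fixes v w :: "'a::complex_inner"
  assumes "norm (w - v) \<le> \<delta> * norm v" "0 \<le> \<delta>" "\<delta> < 1" "v \<noteq> 0"
  shows "cos (arcsin \<delta>) \<le> rinner (sgn v) (sgn w)"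
proof -
  have "w \<noteq> 0"
  proof
    assume "w = 0"
    with assms have "norm v \<le> \<delta> * norm v" by simp
    with assms show False by (simp add: mult_le_cancel_right1)
  qed
  define g where "g = sqrt (1 - \<delta>\<^sup>2)"
  have g2: "g\<^sup>2 = 1 - \<delta>\<^sup>2" using assms by (simp add: g_def abs_square_le_1)
  have "(norm (w - v))\<^sup>2 \<le> (\<delta> * norm v)\<^sup>2"
    by (intro power_mono assms) simp
  then have "(norm w)\<^sup>2 + g\<^sup>2 * (norm v)\<^sup>2 \<le> 2 * rinner v w"
    unfolding norm_diff_squared g2 rinner_commute[of w v] by (simp add: power_mult_distrib algebra_simps)
  moreover have "2 * (norm w * (g * norm v)) \<le> (norm w)\<^sup>2 + (g * norm v)\<^sup>2"
    using sum_squares_bound[of "norm w" "g * norm v"] by (simp add: mult.assoc)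
  ultimately have "g * (norm v * norm w) \<le> rinner v w"
    by (simp add: power_mult_distrib algebra_simps)
  then have "g \<le> rinner (sgn v) (sgn w)"
    using \<open>v \<noteq> 0\<close> \<open>w \<noteq> 0\<close>
    by (simp add: sgn_div_norm rinner.scaleR_left rinner.scaleR_right field_simps)
  then show ?thesis
    using assms by (simp add: cos_arcsin g_def)
qed

lemma rinner_sgn_ge: "- 1 \<le> rinner (sgn v) (sgn w)"
proof -
  have "norm (sgn v) * norm (sgn w) \<le> 1" by (simp add: norm_sgn)
  then show ?thesis using abs_rinner_le[of "sgn v" "sgn w"] by linarith
qed

lemma op_exp_apply_nonzero:
  fixes T :: "'a::{banach, complex_normed_vector} \<Rightarrow>\<^sub>L 'a"
  assumes "complex_linear T" "v \<noteq> 0"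
  shows "op_exp T v \<noteq> 0"
  using op_inverse_apply(2)[OF op_invertible_op_exp[OF assms(1)], of v] assms(2) by auto

lemma tendsto_arcsin_steps:
  assumes "h > 0"
  shows "(\<lambda>n. real n * arcsin (exp (h / real n) - 1)) \<longlonglongrightarrow> h"
proof -
  have "((\<lambda>x. arcsin (exp x - 1)) has_real_derivative 1) (at 0)"
    by (auto intro!: derivative_eq_intros)
  then have lim: "((\<lambda>x. arcsin (exp x - 1) / x) \<longlongrightarrow> 1) (at (0::real))"
    by (simp add: DERIV_def)
  have "filterlim (\<lambda>n. h / real n) (at 0) sequentially"
    unfolding filterlim_at
  proof
    show "\<forall>\<^sub>F n in sequentially. h / real n \<in> UNIV \<and> h / real n \<noteq> 0"
      using eventually_gt_at_top[of 0] by eventually_elim (use assms in auto)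
    show "(\<lambda>n. h / real n) \<longlonglongrightarrow> 0"
      by (rule lim_const_over_n)
  qed
  from filterlim_compose[OF lim this]
  have "(\<lambda>n. h * (arcsin (exp (h / real n) - 1) / (h / real n))) \<longlonglongrightarrow> h * 1"
    by (intro tendsto_intros)
  then show ?thesis
    using assms by (simp add: field_simps)
qed

lemma op_exp_angle:
  fixes T :: "'a::chilbert_space \<Rightarrow>\<^sub>L 'a"
  assumes T: "complex_linear T" "norm T \<le> 1" and h: "0 \<le> h" "h \<le> pi" and v: "v \<noteq> 0"
  shows "cos h \<le> rinner (sgn v) (sgn (op_exp (h *\<^sub>R T) v))"
proof -
  consider "h = 0" | "h = pi" | "0 < h" "h < pi" using h by linarith
  then show ?thesis
  proof cases
    case 1
    then show ?thesis using v by (simp add: rinner_self norm_sgn)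
  next
    case 2
    then show ?thesis using rinner_sgn_ge by simp
  next
    case 3
    define \<theta> where "\<theta> n = arcsin (exp (h / real n) - 1)" for n
    have lim: "(\<lambda>n. real n * \<theta> n) \<longlonglongrightarrow> h"
      unfolding \<theta>_def by (rule tendsto_arcsin_steps) fact
    have "(\<lambda>n. exp (h / real n) - 1) \<longlonglongrightarrow> exp 0 - 1"
      by (intro tendsto_intros lim_const_over_n)
    then have "\<forall>\<^sub>F n in sequentially. exp (h / real n) - 1 < 1"
      by (rule order_tendstoD) simp
    moreover have "\<forall>\<^sub>F n in sequentially. real n * \<theta> n < pi"
      by (rule order_tendstoD[OF lim]) fact
    ultimately have "\<forall>\<^sub>F n in sequentially. cos (real n * \<theta> n) \<le> rinner (sgn v) (sgn (op_exp (h *\<^sub>R T) v))"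
      using eventually_gt_at_top[of 0]
    proof eventually_elim
      case (elim n)
      have \<delta>: "0 \<le> exp (h / real n) - 1" using h by simp
      have \<theta>: "0 \<le> \<theta> n" unfolding \<theta>_def using \<delta> elim by (intro arcsin_nonneg) auto
      let ?u = "\<lambda>j. op_exp ((real j * (h / real n)) *\<^sub>R T) v"
      have "cos (real j * \<theta> n) \<le> rinner (sgn v) (sgn (?u j))" if "j \<le> n" for j
        using that
      proof (induction j)
        case 0
        then show ?case using v by (simp add: rinner_self norm_sgn)
      next
        case (Suc j)
        have nz: "?u i \<noteq> 0" for i
          by (intro op_exp_apply_nonzero complex_linear_scaleR T v)
        have step: "?u (Suc j) = op_exp ((h / real n) *\<^sub>R T) (?u j)"
        proof -
          have "real (Suc j) * (h / real n) = h / real n + real j * (h / real n)"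
            by (simp add: algebra_simps add_divide_distrib)
          then show ?thesis by (simp only: op_exp_add_real[OF T(1)] blinfun_apply_blinfun_compose)
        qed
        have "norm (?u (Suc j) - ?u j) = norm ((op_exp ((h / real n) *\<^sub>R T) - id_blinfun) (?u j))"
          unfolding step by (simp add: blinfun.diff_left)
        also have "\<dots> \<le> norm (op_exp ((h / real n) *\<^sub>R T) - id_blinfun) * norm (?u j)"
          by (rule norm_blinfun)
        also have "norm (op_exp ((h / real n) *\<^sub>R T) - id_blinfun) \<le> exp (norm ((h / real n) *\<^sub>R T)) - 1"
          by (rule norm_op_exp_minus_id)
        also have "\<dots> \<le> exp (h / real n) - 1"
        proof -
          have "norm ((h / real n) *\<^sub>R T) \<le> h / real n"
            using mult_left_mono[OF T(2), of "h / real n"] h by simp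
          then show ?thesis by simp
        qed
        finally have "norm (?u (Suc j) - ?u j) \<le> (exp (h / real n) - 1) * norm (?u j)"
          by (simp add: mult_right_mono)
        then have "cos (\<theta> n) \<le> rinner (sgn (?u j)) (sgn (?u (Suc j)))"
          unfolding \<theta>_def using \<delta> elim nz by (intro angle_small_step) auto
        moreover have "real j * \<theta> n + \<theta> n \<le> pi"
        proof -
          have "real (Suc j) * \<theta> n \<le> real n * \<theta> n"
            using Suc.prems \<theta> by (intro mult_right_mono) auto
          then show ?thesis using elim by (simp add: algebra_simps)
        qed
        moreover have "norm (sgn v) = 1" "norm (sgn (?u j)) = 1" "norm (sgn (?u (Suc j))) = 1"
          using nz v by (simp_all only: norm_sgn if_False)
        ultimately have "cos (real j * \<theta> n + \<theta> n) \<le> rinner (sgn v) (sgn (?u (Suc j)))"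
          using Suc \<theta> by (intro spherical_triangle[where b = "sgn (?u j)"]) auto
        then show ?case by (simp add: algebra_simps)
      qed
      from this[of n] show ?case using elim by simp
    qed
    moreover have "(\<lambda>n. cos (real n * \<theta> n)) \<longlonglongrightarrow> cos h"
      by (intro tendsto_intros lim)
    ultimately show ?thesis
      by (intro tendsto_upperbound[where F = sequentially]) auto
  qed
qed

section \<open>Trajectories of unit angular speed\<close>

lemma trajectory:
  fixes T :: "nat \<Rightarrow> 'a::chilbert_space \<Rightarrow>\<^sub>L 'a" and s :: "nat \<Rightarrow> real"
  defines "\<sigma> \<equiv> \<lambda>j. \<Sum>i=1..j. s i"
  assumes T: "\<And>i. i \<in> {1..k} \<Longrightarrow> complex_linear (T i) \<and> norm (T i) \<le> 1 \<and> 0 \<le> s i"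
    and "\<sigma> k \<le> pi" and x: "x \<noteq> 0"
  shows "\<exists>y. y 0 = x \<and> y (\<sigma> k) = ordered_exp (\<lambda>i. s i *\<^sub>R T i) k x \<and>
    (\<forall>u. 0 \<le> u \<and> u \<le> \<sigma> k \<longrightarrow> y u \<noteq> 0) \<and>
    (\<forall>u v. 0 \<le> u \<and> u \<le> v \<and> v \<le> \<sigma> k \<longrightarrow> cos (v - u) \<le> rinner (sgn (y u)) (sgn (y v))) \<and>
    (\<forall>i\<in>{1..k}. \<forall>u h. \<sigma> (i - 1) \<le> u \<and> 0 \<le> h \<and> u + h \<le> \<sigma> i \<longrightarrow> y (u + h) = op_exp (h *\<^sub>R T i) (y u))"
  using T \<open>\<sigma> k \<le> pi\<close>
proof (induction k)
  case 0
  show ?case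
    by (rule exI[of _ "\<lambda>_. x"]) (use x in \<open>auto simp: \<sigma>_def rinner_self norm_sgn\<close>)
next
  case (Suc k)
  let ?T = "T (Suc k)" and ?s = "s (Suc k)"
  have \<sigma>_Suc: "\<sigma> (Suc k) = \<sigma> k + ?s" by (simp add: \<sigma>_def)
  have T': "complex_linear ?T" "norm ?T \<le> 1" "0 \<le> ?s" using Suc.prems(1)[of "Suc k"] by auto
  have mono: "\<sigma> i \<le> \<sigma> j" if "i \<le> j" "j \<le> k" for i j
    unfolding \<sigma>_def using that Suc.prems(1) by (intro sum_mono2) auto
  have \<sigma>0: "0 \<le> \<sigma> k" using mono[of 0 k] by (simp add: \<sigma>_def)
  obtain y where y0: "y 0 = x" and yk: "y (\<sigma> k) = ordered_exp (\<lambda>i. s i *\<^sub>R T i) k x"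
    and nz: "\<And>u. 0 \<le> u \<Longrightarrow> u \<le> \<sigma> k \<Longrightarrow> y u \<noteq> 0"
    and ang: "\<And>u v. 0 \<le> u \<Longrightarrow> u \<le> v \<Longrightarrow> v \<le> \<sigma> k \<Longrightarrow> cos (v - u) \<le> rinner (sgn (y u)) (sgn (y v))"
    and seg: "\<And>i u h. i \<in> {1..k} \<Longrightarrow> \<sigma> (i - 1) \<le> u \<Longrightarrow> 0 \<le> h \<Longrightarrow> u + h \<le> \<sigma> i \<Longrightarrow>
      y (u + h) = op_exp (h *\<^sub>R T i) (y u)"
    using Suc.IH Suc.prems \<sigma>_Suc T' by fastforce
  define z where "z u = (if u \<le> \<sigma> k then y u else op_exp ((u - \<sigma> k) *\<^sub>R ?T) (y (\<sigma> k)))" for u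
  have z1: "z u = y u" if "u \<le> \<sigma> k" for u using that by (simp add: z_def)
  have z2: "z u = op_exp ((u - \<sigma> k) *\<^sub>R ?T) (y (\<sigma> k))" if "\<sigma> k \<le> u" for u
    using that by (cases "u = \<sigma> k") (auto simp: z_def)
  have z3: "z (u + h) = op_exp (h *\<^sub>R ?T) (z u)" if "\<sigma> k \<le> u" "0 \<le> h" for u h
  proof -
    have "u + h - \<sigma> k = h + (u - \<sigma> k)" by simp
    then show ?thesis
      using that by (simp only: z2 op_exp_add_real[OF T'(1)] blinfun_apply_blinfun_compose add_increasing2)
  qed
  have nz': "z u \<noteq> 0" if "0 \<le> u" for u
  proof (cases "u \<le> \<sigma> k")
    case False
    then have "z u = op_exp ((u - \<sigma> k) *\<^sub>R ?T) (y (\<sigma> k))" by (intro z2) simp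
    then show ?thesis
      using op_exp_apply_nonzero[OF complex_linear_scaleR[OF T'(1)] nz[OF \<sigma>0 order_refl]] by simp
  qed (use that nz z1 in auto)
  have ang2: "cos (v - u) \<le> rinner (sgn (z u)) (sgn (z v))" if "\<sigma> k \<le> u" "u \<le> v" "v \<le> \<sigma> (Suc k)" for u v
    using op_exp_angle[OF T'(1,2), of "v - u" "z u"] z3[of u "v - u"] that nz'[of u] Suc.prems(2) \<sigma>0
    by auto
  have ang': "cos (v - u) \<le> rinner (sgn (z u)) (sgn (z v))" if "0 \<le> u" "u \<le> v" "v \<le> \<sigma> (Suc k)" for u v
  proof -
    consider "v \<le> \<sigma> k" | "\<sigma> k \<le> u" | "u \<le> \<sigma> k" "\<sigma> k \<le> v" by linarith
    then show ?thesis
    proof cases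
      case 1 then show ?thesis using ang[of u v] that by (simp add: z1)
    next
      case 2 then show ?thesis using ang2 that by simp
    next
      case 3
      have "cos ((\<sigma> k - u) + (v - \<sigma> k)) \<le> rinner (sgn (z u)) (sgn (z v))"
      proof (rule spherical_triangle)
        show "cos (\<sigma> k - u) \<le> rinner (sgn (z u)) (sgn (z (\<sigma> k)))"
          using ang[of u "\<sigma> k"] 3 that by (simp add: z1)
        show "cos (v - \<sigma> k) \<le> rinner (sgn (z (\<sigma> k))) (sgn (z v))"
          using ang2 3 that by simp
      qed (use 3 that nz' \<sigma>0 Suc.prems(2) in \<open>auto simp: norm_sgn\<close>)
      then show ?thesis by simp
    qed
  qed
  have seg': "z (u + h) = op_exp (h *\<^sub>R T i) (z u)"
    if "i \<in> {1..Suc k}" "\<sigma> (i - 1) \<le> u" "0 \<le> h" "u + h \<le> \<sigma> i" for i u h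
  proof (cases "i = Suc k")
    case False
    then have i: "i \<in> {1..k}" using that by auto
    then have "u + h \<le> \<sigma> k" using mono[of i k] that by auto
    then show ?thesis using seg[OF i that(2-4)] z1 that by simp
  qed (use that z3 in auto)
  show ?case
  proof (intro exI[of _ z] conjI allI impI ballI)
    show "z 0 = x" using z1[OF \<sigma>0] y0 by simp
    show "z (\<sigma> (Suc k)) = ordered_exp (\<lambda>i. s i *\<^sub>R T i) (Suc k) x"
      using z2[of "\<sigma> (Suc k)"] T'(3) by (simp add: \<sigma>_Suc yk)
  qed (use nz' ang' seg' in auto)
qed

text \<open>The angle estimates from both end points leave no room for deviating from the half circle
  through \<open>d 0\<close> and \<open>d (pi / 2)\<close>.\<close>

lemma near_half_circle:
  fixes d :: "real \<Rightarrow> 'a::complex_inner"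
  assumes unit: "\<And>u. 0 \<le> u \<Longrightarrow> u \<le> pi \<Longrightarrow> norm (d u) = 1"
    and ang: "\<And>u v. 0 \<le> u \<Longrightarrow> u \<le> v \<Longrightarrow> v \<le> pi \<Longrightarrow> cos (v - u) \<le> rinner (d u) (d v)"
    and u: "0 \<le> u" "u \<le> pi"
  shows "\<bar>rinner (d 0) (d u) - cos u\<bar> \<le> norm (d pi + d 0)"
    and "(norm (d u - (cos u *\<^sub>R d 0 + sin u *\<^sub>R d (pi / 2))))\<^sup>2 \<le> 4 * norm (d pi + d 0)"
proof -
  define \<epsilon> where "\<epsilon> = norm (d pi + d 0)"
  have 1: "\<bar>rinner (d 0) (d u) - cos u\<bar> \<le> \<epsilon>" if "0 \<le> u" "u \<le> pi" for u
  proof -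
    have "- cos u \<le> rinner (d u) (d pi)"
      using ang[of u pi] that by simp
    also have "rinner (d u) (d pi) = rinner (d u) (d pi + d 0) - rinner (d 0) (d u)"
      by (simp add: rinner.add_right rinner_commute)
    also have "rinner (d u) (d pi + d 0) \<le> \<epsilon>"
      using abs_rinner_le[of "d u" "d pi + d 0"] unit[of u] that by (simp add: \<epsilon>_def)
    finally have "rinner (d 0) (d u) \<le> cos u + \<epsilon>" by simp
    moreover have "cos u \<le> rinner (d 0) (d u)"
      using ang[of 0 u] that by simp
    moreover have "0 \<le> \<epsilon>" by (simp add: \<epsilon>_def)
    ultimately show ?thesis by linarith
  qed
  then show "\<bar>rinner (d 0) (d u) - cos u\<bar> \<le> norm (d pi + d 0)"
    using u by (simp add: \<epsilon>_def)
  let ?w = "d (pi / 2)" and ?D = "cos u *\<^sub>R d 0 + sin u *\<^sub>R d (pi / 2)"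
  define \<omega> where "\<omega> = rinner (d 0) ?w"
  have \<omega>: "\<bar>\<omega>\<bar> \<le> \<epsilon>" using 1[of "pi / 2"] by (simp add: \<omega>_def)
  have sin: "0 \<le> sin u" using u by (simp add: sin_ge_zero)
  have w: "sin u \<le> rinner (d u) ?w"
  proof (cases "u \<le> pi / 2")
    case True
    then have "cos (pi / 2 - u) \<le> rinner (d u) ?w" using u by (intro ang) auto
    then show ?thesis by (simp add: cos_diff)
  next
    case False
    then have "cos (u - pi / 2) \<le> rinner ?w (d u)" using u by (intro ang) auto
    then show ?thesis by (simp add: cos_diff rinner_commute)
  qed
  have un: "norm (d 0) = 1" "norm ?w = 1" "norm (d u) = 1" using unit u by auto
  have "(norm ?D)\<^sup>2 = (cos u)\<^sup>2 + (sin u)\<^sup>2 + 2 * (sin u * cos u * \<omega>)"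
    unfolding norm_add_squared rinner_def[symmetric] rinner.scaleR_left rinner.scaleR_right
    by (simp add: un \<omega>_def)
  also have "2 * (sin u * cos u * \<omega>) \<le> 2 * \<epsilon>"
  proof -
    have "\<bar>sin u * cos u * \<omega>\<bar> \<le> 1 * 1 * \<epsilon>"
      unfolding abs_mult by (intro mult_mono \<omega>) auto
    then show ?thesis by linarith
  qed
  finally have D2: "(norm ?D)\<^sup>2 \<le> 1 + 2 * \<epsilon>" by simp
  have "(cos u)\<^sup>2 - \<epsilon> \<le> cos u * rinner (d u) (d 0)"
  proof -
    have "\<bar>cos u * (rinner (d u) (d 0) - cos u)\<bar> \<le> 1 * \<epsilon>"
      unfolding abs_mult by (intro mult_mono) (use 1[OF u] in \<open>auto simp: rinner_commute\<close>)
    then show ?thesis by (simp add: power2_eq_square algebra_simps)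
  qed
  moreover have "(sin u)\<^sup>2 \<le> sin u * rinner (d u) ?w"
    using mult_left_mono[OF w sin] by (simp add: power2_eq_square)
  moreover have "rinner (d u) ?D = cos u * rinner (d u) (d 0) + sin u * rinner (d u) ?w"
    by (simp add: rinner.add_right rinner.scaleR_right)
  ultimately have "1 - \<epsilon> \<le> rinner (d u) ?D"
    using sin_cos_squared_add[of u] by linarith
  then have "(norm (d u - ?D))\<^sup>2 \<le> 4 * \<epsilon>"
    unfolding norm_diff_squared using D2 by (simp add: un)
  then show "(norm (d u - ?D))\<^sup>2 \<le> 4 * norm (d pi + d 0)" by (simp add: \<epsilon>_def)
qed

lemma norm_op_exp_le: "norm (op_exp A) \<le> exp (norm (A :: 'a::banach \<Rightarrow>\<^sub>L 'a))"
  using norm_op_exp_tail[of A 0] by simp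

text \<open>A flow step whose angular displacement equals its duration up to a small error changes the
  length only to higher order: the operator has no norm left over for the radial direction.\<close>

lemma generator_bound:
  fixes T :: "'a::chilbert_space \<Rightarrow>\<^sub>L 'a"
  assumes T: "complex_linear T" "norm T \<le> 1" and h: "0 < h"
    and unit: "norm v = 1" "norm v' = 1" and step: "op_exp (h *\<^sub>R T) v = r *\<^sub>R v'" and "r \<ge> 0"
  shows "norm (h *\<^sub>R T v - (v' - v)) \<le>
    (exp h - 1 - h) + sqrt ((exp h - 1)\<^sup>2 - exp (- h) * (norm (v' - v))\<^sup>2)"
proof -
  have hT: "norm (h *\<^sub>R T) \<le> h" using mult_left_mono[OF T(2), of h] h by simp
  have "exp (- h) \<le> r"
  proof -
    have "op_exp ((-h) *\<^sub>R T) (op_exp (h *\<^sub>R T) v) = op_exp ((-h + h) *\<^sub>R T) v"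
      unfolding op_exp_add_real[OF T(1)] by simp
    then have "v = op_exp ((-h) *\<^sub>R T) (r *\<^sub>R v')" by (simp add: step)
    then have "1 \<le> norm (op_exp ((-h) *\<^sub>R T)) * norm (r *\<^sub>R v')"
      using norm_blinfun[of "op_exp ((-h) *\<^sub>R T)" "r *\<^sub>R v'"] unit by simp
    also have "\<dots> = norm (op_exp ((-h) *\<^sub>R T)) * r" using unit \<open>r \<ge> 0\<close> by simp
    also have "\<dots> \<le> exp (norm ((-h) *\<^sub>R T)) * r"
      by (intro mult_right_mono norm_op_exp_le \<open>r \<ge> 0\<close>)
    also have "\<dots> \<le> exp h * r"
      using hT h \<open>r \<ge> 0\<close> by (intro mult_right_mono) auto
    finally show ?thesis by (simp add: exp_minus field_simps)
  qed
  have "norm (r *\<^sub>R v' - v) \<le> exp h - 1"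
  proof -
    have "norm (r *\<^sub>R v' - v) = norm ((op_exp (h *\<^sub>R T) - id_blinfun) v)"
      by (simp add: blinfun.diff_left step)
    also have "\<dots> \<le> norm (op_exp (h *\<^sub>R T) - id_blinfun)"
      using norm_blinfun[of "op_exp (h *\<^sub>R T) - id_blinfun" v] unit by simp
    also have "\<dots> \<le> exp (norm (h *\<^sub>R T)) - 1" by (rule norm_op_exp_minus_id)
    also have "\<dots> \<le> exp h - 1" using hT by simp
    finally show ?thesis .
  qed
  then have "(norm (r *\<^sub>R v' - v))\<^sup>2 \<le> (exp h - 1)\<^sup>2" by (intro power_mono) auto
  moreover have "(norm (r *\<^sub>R v' - v))\<^sup>2 = (r - 1)\<^sup>2 + r * (norm (v' - v))\<^sup>2"
    unfolding norm_diff_squared rinner.scaleR_left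
    by (simp add: unit power2_eq_square algebra_simps)
  moreover have "exp (- h) * (norm (v' - v))\<^sup>2 \<le> r * (norm (v' - v))\<^sup>2"
    using \<open>exp (- h) \<le> r\<close> by (intro mult_right_mono) auto
  ultimately have "(r - 1)\<^sup>2 \<le> (exp h - 1)\<^sup>2 - exp (- h) * (norm (v' - v))\<^sup>2" by linarith
  then have r1: "\<bar>r - 1\<bar> \<le> sqrt ((exp h - 1)\<^sup>2 - exp (- h) * (norm (v' - v))\<^sup>2)"
    by (metis real_sqrt_abs real_sqrt_le_iff)
  have "norm ((op_exp (h *\<^sub>R T) - id_blinfun - h *\<^sub>R T) v) \<le> exp (norm (h *\<^sub>R T)) - 1 - norm (h *\<^sub>R T)"
    using norm_blinfun[of "op_exp (h *\<^sub>R T) - id_blinfun - h *\<^sub>R T" v] unit norm_op_exp_minus_linear[of "h *\<^sub>R T"]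
    by simp
  also have "\<dots> \<le> exp h - 1 - h"
  proof -
    have "exp h - 1 - h - (exp a - 1 - a) \<ge> 0" if "0 \<le> a" "a \<le> h" for a :: real
    proof -
      have "exp a * 1 + exp a * (h - a) \<le> exp a * exp (h - a)"
        using mult_left_mono[OF exp_ge_add_one_self[of "h - a"], of "exp a"] by (simp add: algebra_simps)
      moreover have "1 * (h - a) \<le> exp a * (h - a)" using that by (intro mult_right_mono) auto
      ultimately show ?thesis by (simp add: exp_add[symmetric])
    qed
    from this[OF norm_ge_zero hT] show ?thesis by simp
  qed
  finally have lin: "norm (r *\<^sub>R v' - v - h *\<^sub>R T v) \<le> exp h - 1 - h"
    by (simp add: blinfun.diff_left blinfun.scaleR_left step)
  have "h *\<^sub>R T v - (v' - v) = (r - 1) *\<^sub>R v' - (r *\<^sub>R v' - v - h *\<^sub>R T v)"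
    by (simp add: algebra_simps)
  also have "norm \<dots> \<le> \<bar>r - 1\<bar> + norm (r *\<^sub>R v' - v - h *\<^sub>R T v)"
    using norm_triangle_ineq4[of "(r - 1) *\<^sub>R v'" "r *\<^sub>R v' - v - h *\<^sub>R T v"] unit by simp
  finally show ?thesis using r1 lin by linarith
qed

lemma half_circle_rate:
  "((\<lambda>h::real. (exp h - 1 - h + sqrt ((exp h - 1)\<^sup>2 - exp (- h) * (2 - 2 * cos h)) +
     2 * (1 - cos h) + 2 * \<bar>sin h - h\<bar>) / h) \<longlongrightarrow> 0) (at_right 0)"
  by real_asymp

lemma half_circle_generator:
  fixes d :: "nat \<Rightarrow> real \<Rightarrow> 'a::chilbert_space" and T :: "'a \<Rightarrow>\<^sub>L 'a"
  assumes unit: "\<And>m u. 0 \<le> u \<Longrightarrow> u \<le> pi \<Longrightarrow> norm (d m u) = 1"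
    and ang: "\<And>m u v. 0 \<le> u \<Longrightarrow> u \<le> v \<Longrightarrow> v \<le> pi \<Longrightarrow> cos (v - u) \<le> rinner (d m u) (d m v)"
    and anti: "(\<lambda>m. d m pi + d m 0) \<longlonglongrightarrow> 0"
    and T: "complex_linear T" "norm T \<le> 1"
    and u: "0 \<le> u" "u < b" "b \<le> pi"
    and flow: "\<And>m h. 0 < h \<Longrightarrow> u + h \<le> b \<Longrightarrow> \<exists>r\<ge>0. op_exp (h *\<^sub>R T) (d m u) = r *\<^sub>R d m (u + h)"
  shows "(\<lambda>m. T (cos u *\<^sub>R d m 0 + sin u *\<^sub>R d m (pi / 2))
    - (- sin u *\<^sub>R d m 0 + cos u *\<^sub>R d m (pi / 2))) \<longlonglongrightarrow> 0"
proof -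
  define D where "D m v = cos v *\<^sub>R d m 0 + sin v *\<^sub>R d m (pi / 2)" for m v
  define D' where "D' m v = - sin v *\<^sub>R d m 0 + cos v *\<^sub>R d m (pi / 2)" for m v
  define \<omega> where "\<omega> m = rinner (d m 0) (d m (pi / 2))" for m
  define e where "e m v = d m v - D m v" for m v
  have un: "norm (d m 0) = 1" "norm (d m (pi / 2)) = 1" for m using unit by auto
  have \<omega>: "\<omega> \<longlonglongrightarrow> 0"
  proof (rule Lim_null_comparison)
    show "\<forall>\<^sub>F m in sequentially. norm (\<omega> m) \<le> norm (d m pi + d m 0)"
      using near_half_circle(1)[of "d _" "pi / 2"] unit ang by (auto simp: \<omega>_def intro!: always_eventually)
    show "(\<lambda>m. norm (d m pi + d m 0)) \<longlonglongrightarrow> 0" using anti by (rule tendsto_norm_zero)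
  qed
  have e: "(\<lambda>m. e m v) \<longlonglongrightarrow> 0" if "0 \<le> v" "v \<le> pi" for v
  proof (rule Lim_null_comparison)
    have "norm (e m v) \<le> sqrt (4 * norm (d m pi + d m 0))" for m
      unfolding e_def D_def
      using near_half_circle(2)[of "d m" v] unit ang that by (intro real_le_rsqrt) auto
    then show "\<forall>\<^sub>F m in sequentially. norm (e m v) \<le> sqrt (4 * norm (d m pi + d m 0))"
      by (intro always_eventually) auto
    have "(\<lambda>m. sqrt (4 * norm (d m pi + d m 0))) \<longlonglongrightarrow> sqrt (4 * norm (0::'a))"
      by (intro tendsto_intros anti)
    then show "(\<lambda>m. sqrt (4 * norm (d m pi + d m 0))) \<longlonglongrightarrow> 0" by simp
  qed
  have normD: "norm (D m v) \<le> 2" "norm (D' m v) \<le> 2" for m v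
  proof -
    have "norm (a *\<^sub>R d m 0 + c *\<^sub>R d m (pi / 2)) \<le> 2" if "\<bar>a\<bar> \<le> 1" "\<bar>c\<bar> \<le> 1" for a c
      using norm_triangle_ineq[of "a *\<^sub>R d m 0" "c *\<^sub>R d m (pi / 2)"] that by (simp add: un)
    then show "norm (D m v) \<le> 2" "norm (D' m v) \<le> 2"
      using abs_cos_le_one[of v] abs_sin_le_one[of v] by (auto simp: D_def D'_def simp del: scaleR_minus_left)
  qed
  have D_add: "D m (u + h) - D m u - h *\<^sub>R D' m u = (cos h - 1) *\<^sub>R D m u + (sin h - h) *\<^sub>R D' m u" for m h
    unfolding D_def D'_def cos_add sin_add by (simp add: algebra_simps)
  define F where "F m h = (exp h - 1 - h + sqrt ((exp h - 1)\<^sup>2 - exp (- h) * (norm (d m (u + h) - d m u))\<^sup>2)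
    + 2 * (1 - cos h) + 2 * \<bar>sin h - h\<bar> + (h * norm (e m u) + norm (e m (u + h)) + norm (e m u))) / h" for m h
  have bound: "norm (T (D m u) - D' m u) \<le> F m h" if h: "0 < h" "u + h \<le> b" for m h
  proof -
    obtain r where r: "r \<ge> 0" "op_exp (h *\<^sub>R T) (d m u) = r *\<^sub>R d m (u + h)"
      using flow[OF h] by blast
    let ?g = "h *\<^sub>R T (d m u) - (d m (u + h) - d m u)"
    have g: "norm ?g \<le> exp h - 1 - h + sqrt ((exp h - 1)\<^sup>2 - exp (- h) * (norm (d m (u + h) - d m u))\<^sup>2)"
      using h u by (intro generator_bound[OF T h(1) unit unit r(2) r(1)]) auto
    have "h *\<^sub>R (T (D m u) - D' m u) = ?g + (e m (u + h) - e m u - h *\<^sub>R T (e m u))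
        + ((cos h - 1) *\<^sub>R D m u + (sin h - h) *\<^sub>R D' m u)"
      unfolding D_add[symmetric] e_def by (simp add: blinfun.diff_right algebra_simps)
    also have "norm \<dots> \<le> norm ?g + norm (e m (u + h) - e m u - h *\<^sub>R T (e m u))
        + norm ((cos h - 1) *\<^sub>R D m u + (sin h - h) *\<^sub>R D' m u)"
      by (intro order_trans[OF norm_triangle_ineq] add_right_mono norm_triangle_ineq)
    also have "norm (e m (u + h) - e m u - h *\<^sub>R T (e m u))
        \<le> norm (e m (u + h)) + norm (e m u) + h * norm (e m u)"
    proof -
      have "norm (T (e m u)) \<le> norm (e m u)"
        using order_trans[OF norm_blinfun mult_right_mono[OF T(2) norm_ge_zero]] by simp
      then have "norm (h *\<^sub>R T (e m u)) \<le> h * norm (e m u)"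
        using h by simp
      then show ?thesis
        using norm_triangle_ineq4[of "e m (u + h) - e m u" "h *\<^sub>R T (e m u)"]
          norm_triangle_ineq4[of "e m (u + h)" "e m u"] by linarith
    qed
    also have "norm ((cos h - 1) *\<^sub>R D m u + (sin h - h) *\<^sub>R D' m u) \<le> 2 * (1 - cos h) + 2 * \<bar>sin h - h\<bar>"
    proof -
      have "\<bar>cos h - 1\<bar> * norm (D m u) \<le> (1 - cos h) * 2" "\<bar>sin h - h\<bar> * norm (D' m u) \<le> \<bar>sin h - h\<bar> * 2"
        by (intro mult_mono normD; simp)+
      then show ?thesis
        using norm_triangle_ineq[of "(cos h - 1) *\<^sub>R D m u" "(sin h - h) *\<^sub>R D' m u"] by simp
    qed
    finally have "h * norm (T (D m u) - D' m u) \<le> F m h * h"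
      using g h by (simp add: F_def)
    then show ?thesis using h by (simp add: mult.commute)
  qed
  let ?G = "\<lambda>h. (exp h - 1 - h + sqrt ((exp h - 1)\<^sup>2 - exp (- h) * (2 - 2 * cos h)) +
     2 * (1 - cos h) + 2 * \<bar>sin h - h\<bar>) / h"
  have lim: "(\<lambda>m. F m h) \<longlonglongrightarrow> ?G h" if h: "0 < h" "u + h \<le> b" for h
  proof -
    define p q where "p = cos (u + h) - cos u" and "q = sin (u + h) - sin u"
    have pq: "p\<^sup>2 + q\<^sup>2 = 2 - 2 * cos h"
    proof -
      have "p\<^sup>2 + q\<^sup>2 = ((cos (u + h))\<^sup>2 + (sin (u + h))\<^sup>2) + ((cos u)\<^sup>2 + (sin u)\<^sup>2)
          - 2 * (cos (u + h) * cos u + sin (u + h) * sin u)"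
        unfolding p_def q_def by (simp add: power2_diff algebra_simps)
      also have "cos (u + h) * cos u + sin (u + h) * sin u = cos ((u + h) - u)"
        by (rule cos_diff[symmetric])
      finally show ?thesis by simp
    qed
    have "(norm (D m (u + h) - D m u))\<^sup>2 = p\<^sup>2 + q\<^sup>2 + 2 * p * q * \<omega> m" for m
    proof -
      have "D m (u + h) - D m u = p *\<^sub>R d m 0 + q *\<^sub>R d m (pi / 2)"
        by (simp add: D_def p_def q_def algebra_simps)
      then show ?thesis
        unfolding norm_add_squared rinner_def[symmetric] rinner.scaleR_left rinner.scaleR_right
        by (simp add: norm_add_squared rinner_def[symmetric] rinner.scaleR_left rinner.scaleR_right un \<omega>_def)
    qed
    then have nD: "norm (D m (u + h) - D m u) = sqrt (p\<^sup>2 + q\<^sup>2 + 2 * p * q * \<omega> m)" for m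
      by (metis abs_norm_cancel real_sqrt_abs)
    have "(\<lambda>m. norm (D m (u + h) - D m u)) \<longlonglongrightarrow> sqrt (p\<^sup>2 + q\<^sup>2 + 2 * p * q * 0)"
      unfolding nD by (intro tendsto_intros \<omega>)
    moreover have "(\<lambda>m. norm (d m (u + h) - d m u) - norm (D m (u + h) - D m u)) \<longlonglongrightarrow> 0"
    proof (rule Lim_null_comparison)
      show "\<forall>\<^sub>F m in sequentially. norm (norm (d m (u + h) - d m u) - norm (D m (u + h) - D m u))
          \<le> norm (e m (u + h) - e m u)"
      proof (intro always_eventually allI)
        fix m
        have "e m (u + h) - e m u = (d m (u + h) - d m u) - (D m (u + h) - D m u)"
          by (simp add: e_def)
        then show "norm (norm (d m (u + h) - d m u) - norm (D m (u + h) - D m u)) \<le> norm (e m (u + h) - e m u)"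
          by (simp only: real_norm_def norm_triangle_ineq3)
      qed
      have "(\<lambda>m. norm (e m (u + h) - e m u)) \<longlonglongrightarrow> norm (0 - 0 :: 'a)"
        using h u by (intro tendsto_intros e) auto
      then show "(\<lambda>m. norm (e m (u + h) - e m u)) \<longlonglongrightarrow> 0" by simp
    qed
    ultimately have "(\<lambda>m. norm (d m (u + h) - d m u)) \<longlonglongrightarrow> sqrt (2 - 2 * cos h)"
      using tendsto_add by (fastforce simp: pq)
    then have "(\<lambda>m. (norm (d m (u + h) - d m u))\<^sup>2) \<longlonglongrightarrow> (sqrt (2 - 2 * cos h))\<^sup>2"
      by (intro tendsto_intros)
    then have \<Delta>: "(\<lambda>m. (norm (d m (u + h) - d m u))\<^sup>2) \<longlonglongrightarrow> 2 - 2 * cos h" by simp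
    have "(\<lambda>m. F m h) \<longlonglongrightarrow> (exp h - 1 - h + sqrt ((exp h - 1)\<^sup>2 - exp (- h) * (2 - 2 * cos h))
        + 2 * (1 - cos h) + 2 * \<bar>sin h - h\<bar> + (h * norm (0::'a) + norm (0::'a) + norm (0::'a))) / h"
      unfolding F_def using h u by (intro tendsto_intros \<Delta> e) auto
    then show ?thesis by simp
  qed
  show ?thesis
    unfolding D_def[symmetric] D'_def[symmetric]
  proof (rule tendstoI)
    fix \<epsilon> :: real assume "\<epsilon> > 0"
    with half_circle_rate have "\<forall>\<^sub>F h in at_right 0. ?G h < \<epsilon>" by (rule order_tendstoD)
    moreover have "\<forall>\<^sub>F h in at_right 0. 0 < h \<and> u + h \<le> b"
      using u by (auto simp: eventually_at_right_field intro!: exI[of _ "b - u"])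
    ultimately have "\<forall>\<^sub>F h in at_right 0. ?G h < \<epsilon> \<and> 0 < h \<and> u + h \<le> b"
      by eventually_elim auto
    then obtain h where h: "?G h < \<epsilon>" "0 < h" "u + h \<le> b"
      using eventually_happens'[of "at_right (0::real)"] by (metis (no_types, lifting) trivial_limit_at_right_real)
    have "\<forall>\<^sub>F m in sequentially. F m h < \<epsilon>"
      by (rule order_tendstoD(2)[OF lim[OF h(2,3)] h(1)])
    then show "\<forall>\<^sub>F m in sequentially. dist (T (D m u) - D' m u) 0 < \<epsilon>"
      by eventually_elim (use bound[OF h(2,3)] in \<open>auto intro: le_less_trans\<close>)
  qed
qed

text \<open>The equation of \<open>half_circle_generator\<close> at two times within the \<open>i\<close>-th segment determines
  \<open>T i (x m)\<close> and \<open>T i (w m)\<close>.\<close>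

lemma antipodal_generators:
  fixes T :: "nat \<Rightarrow> 'a::chilbert_space \<Rightarrow>\<^sub>L 'a" and s :: "nat \<Rightarrow> real"
  assumes s: "\<And>i. i \<in> {1..k} \<Longrightarrow> 0 < s i" "(\<Sum>i=1..k. s i) = pi"
    and T: "\<And>i. i \<in> {1..k} \<Longrightarrow> complex_linear (T i)" "\<And>i. i \<in> {1..k} \<Longrightarrow> norm (T i) \<le> 1"
    and x: "\<And>m. norm (x m) = 1" and l: "\<And>m. 0 \<le> l m"
    and lim: "(\<lambda>m. ordered_exp (\<lambda>i. s i *\<^sub>R T i) k (x m) + l m *\<^sub>R x m) \<longlonglongrightarrow> 0"
  obtains w where "\<And>i. i \<in> {1..k} \<Longrightarrow> (\<lambda>m. T i (x m) - w m) \<longlonglongrightarrow> 0"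
    "\<And>i. i \<in> {1..k} \<Longrightarrow> (\<lambda>m. T i (w m) + x m) \<longlonglongrightarrow> 0"
proof -
  define \<sigma> where "\<sigma> j = (\<Sum>i=1..j. s i)" for j
  define E where "E = ordered_exp (\<lambda>i. s i *\<^sub>R T i) k"
  have \<sigma>k: "\<sigma> k = pi" using s by (simp add: \<sigma>_def)
  have mono: "\<sigma> i \<le> \<sigma> j" if "i \<le> j" "j \<le> k" for i j
    unfolding \<sigma>_def using that s(1) by (intro sum_mono2) (auto intro: less_imp_le)
  have \<sigma>_nonneg: "0 \<le> \<sigma> (i - 1)" if "i \<in> {1..k}" for i
    using mono[of 0 "i - 1"] that by (auto simp: \<sigma>_def)
  have \<sigma>_step: "\<sigma> i = \<sigma> (i - 1) + s i" if "i \<in> {1..k}" for i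
    using that by (cases i) (simp_all add: \<sigma>_def)
  have xnz: "x m \<noteq> 0" for m using x[of m] by auto
  have "\<exists>y. y 0 = x m \<and> y pi = E (x m) \<and> (\<forall>u. 0 \<le> u \<and> u \<le> pi \<longrightarrow> y u \<noteq> 0) \<and>
    (\<forall>u v. 0 \<le> u \<and> u \<le> v \<and> v \<le> pi \<longrightarrow> cos (v - u) \<le> rinner (sgn (y u)) (sgn (y v))) \<and>
    (\<forall>i\<in>{1..k}. \<forall>u h. \<sigma> (i - 1) \<le> u \<and> 0 \<le> h \<and> u + h \<le> \<sigma> i \<longrightarrow> y (u + h) = op_exp (h *\<^sub>R T i) (y u))" for m
    using trajectory[of k T s "x m"] s T xnz unfolding \<sigma>_def E_def by (auto simp: less_imp_le)
  then obtain y where y0: "\<And>m. y m 0 = x m" and ypi: "\<And>m. y m pi = E (x m)"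
    and nz: "\<And>m u. 0 \<le> u \<Longrightarrow> u \<le> pi \<Longrightarrow> y m u \<noteq> 0"
    and ang: "\<And>m u v. 0 \<le> u \<Longrightarrow> u \<le> v \<Longrightarrow> v \<le> pi \<Longrightarrow> cos (v - u) \<le> rinner (sgn (y m u)) (sgn (y m v))"
    and seg: "\<And>m i u h. i \<in> {1..k} \<Longrightarrow> \<sigma> (i - 1) \<le> u \<Longrightarrow> 0 \<le> h \<Longrightarrow> u + h \<le> \<sigma> i \<Longrightarrow>
      y m (u + h) = op_exp (h *\<^sub>R T i) (y m u)"
    by metis
  define d where "d m u = sgn (y m u)" for m u
  have d0: "d m 0 = x m" for m by (simp add: d_def y0 sgn_div_norm x)
  define w where "w m = d m (pi / 2)" for m
  have unit: "norm (d m u) = 1" if "0 \<le> u" "u \<le> pi" for m u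
    using nz that by (simp add: d_def norm_sgn)
  have angd: "cos (v - u) \<le> rinner (d m u) (d m v)" if "0 \<le> u" "u \<le> v" "v \<le> pi" for m u v
    using ang that by (simp add: d_def)
  have invE: "op_invertible E"
    unfolding E_def by (intro op_invertible_ordered_exp complex_linear_scaleR T)
  have anti: "(\<lambda>m. d m pi + d m 0) \<longlonglongrightarrow> 0"
  proof (rule Lim_null_comparison)
    let ?N = "norm (op_inverse E)"
    have "norm (d m pi + d m 0) \<le> 2 * ?N * norm (E (x m) + l m *\<^sub>R x m)" for m
    proof -
      let ?n = "norm (E (x m))" and ?e = "E (x m) + l m *\<^sub>R x m"
      have n: "1 \<le> ?N * ?n"
        using norm_blinfun[of "op_inverse E" "E (x m)"] x[of m] by (simp add: op_inverse_apply invE)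
      then have npos: "?n > 0" by (metis mult_zero_right norm_ge_zero not_one_le_zero order_le_less)
      have "d m pi = (1 / ?n) *\<^sub>R E (x m)"
        by (simp add: d_def ypi sgn_div_norm divide_inverse)
      then have "?n *\<^sub>R (d m pi + d m 0) = ?e + (?n - l m) *\<^sub>R x m"
        using npos by (simp add: d0 algebra_simps)
      then have "norm (?n *\<^sub>R (d m pi + d m 0)) \<le> norm ?e + \<bar>?n - l m\<bar>"
        using norm_triangle_ineq[of ?e "(?n - l m) *\<^sub>R x m"] by (simp add: x)
      moreover have "\<bar>?n - l m\<bar> \<le> norm ?e"
        using norm_triangle_ineq3[of "E (x m)" "- (l m *\<^sub>R x m)"] l[of m] by (simp add: x)
      ultimately have "?n * norm (d m pi + d m 0) \<le> 2 * norm ?e" by simp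
      then have "?N * (?n * norm (d m pi + d m 0)) \<le> ?N * (2 * norm ?e)"
        by (intro mult_left_mono) auto
      moreover have "1 * norm (d m pi + d m 0) \<le> (?N * ?n) * norm (d m pi + d m 0)"
        by (intro mult_right_mono n) simp
      ultimately show ?thesis by (simp add: mult_ac)
    qed
    then show "\<forall>\<^sub>F m in sequentially. norm (d m pi + d m 0) \<le> 2 * ?N * norm (E (x m) + l m *\<^sub>R x m)"
      by (intro always_eventually) auto
    have "(\<lambda>m. 2 * ?N * norm (E (x m) + l m *\<^sub>R x m)) \<longlonglongrightarrow> 2 * ?N * norm (0::'a)"
      by (intro tendsto_intros lim[folded E_def])
    then show "(\<lambda>m. 2 * ?N * norm (E (x m) + l m *\<^sub>R x m)) \<longlonglongrightarrow> 0" by simp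
  qed
  have gen: "(\<lambda>m. T i (cos u *\<^sub>R x m + sin u *\<^sub>R w m) - (- sin u *\<^sub>R x m + cos u *\<^sub>R w m)) \<longlonglongrightarrow> 0"
    if i: "i \<in> {1..k}" and u: "\<sigma> (i - 1) \<le> u" "u < \<sigma> i" for i u
    unfolding w_def d0[symmetric]
  proof (rule half_circle_generator[OF unit angd anti T(1)[OF i] T(2)[OF i], where b = "\<sigma> i"])
    show u0: "0 \<le> u" using \<sigma>_nonneg[OF i] u by simp
    show bpi: "\<sigma> i \<le> pi" using mono[of i k] i \<sigma>k by auto
    fix m :: nat and h :: real assume h: "0 < h" "u + h \<le> \<sigma> i"
    let ?a = "norm (y m u)" and ?b = "norm (y m (u + h))"
    have "?a \<noteq> 0" "?b \<noteq> 0" using nz u0 bpi h u by auto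
    then have "op_exp (h *\<^sub>R T i) (d m u) = (?b / ?a) *\<^sub>R d m (u + h)"
      using seg[OF i u(1), of h m] h by (simp add: d_def sgn_div_norm blinfun.scaleR_right divide_inverse)
    then show "\<exists>r\<ge>0. op_exp (h *\<^sub>R T i) (d m u) = r *\<^sub>R d m (u + h)"
      by (intro exI[of _ "?b / ?a"]) auto
  qed (use u in auto)
  have pq: "(\<lambda>m. T i (x m) - w m) \<longlonglongrightarrow> 0 \<and> (\<lambda>m. T i (w m) + x m) \<longlonglongrightarrow> 0" if i: "i \<in> {1..k}" for i
  proof -
    define u1 u2 where "u1 = \<sigma> (i - 1)" and "u2 = \<sigma> (i - 1) + s i / 2"
    define A where "A u m = T i (cos u *\<^sub>R x m + sin u *\<^sub>R w m) - (- sin u *\<^sub>R x m + cos u *\<^sub>R w m)" for u m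
    have si: "0 < s i" using s i by auto
    have A: "A u1 \<longlonglongrightarrow> 0" "A u2 \<longlonglongrightarrow> 0"
      unfolding A_def u1_def u2_def using i si \<sigma>_step[OF i] by (intro gen[OF i]; simp)+
    have "\<sigma> i \<le> pi" "0 \<le> \<sigma> (i - 1)" using mono[of i k] i \<sigma>k \<sigma>_nonneg[OF i] by auto
    then have "sin (u2 - u1) > 0"
      using si \<sigma>_step[OF i] by (intro sin_gt_zero) (auto simp: u1_def u2_def)
    define c where "c = 1 / sin (u2 - u1)"
    have c: "c * (sin u2 * cos u1 - cos u2 * sin u1) = 1"
      using \<open>sin (u2 - u1) > 0\<close> by (simp add: c_def sin_diff)
    have A_eq: "A u m = cos u *\<^sub>R (T i (x m) - w m) + sin u *\<^sub>R (T i (w m) + x m)" for u m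
      by (simp add: A_def blinfun.add_right blinfun.scaleR_right algebra_simps)
    have "c *\<^sub>R (sin u2 *\<^sub>R A u1 m - sin u1 *\<^sub>R A u2 m)
        = (c * (sin u2 * cos u1 - cos u2 * sin u1)) *\<^sub>R (T i (x m) - w m)" for m
      unfolding A_eq by (simp add: algebra_simps)
    moreover have "c *\<^sub>R (cos u1 *\<^sub>R A u2 m - cos u2 *\<^sub>R A u1 m)
        = (c * (sin u2 * cos u1 - cos u2 * sin u1)) *\<^sub>R (T i (w m) + x m)" for m
      unfolding A_eq by (simp add: algebra_simps)
    moreover have "(\<lambda>m. c *\<^sub>R (sin u2 *\<^sub>R A u1 m - sin u1 *\<^sub>R A u2 m)) \<longlonglongrightarrow> c *\<^sub>R (sin u2 *\<^sub>R 0 - sin u1 *\<^sub>R 0)"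
      "(\<lambda>m. c *\<^sub>R (cos u1 *\<^sub>R A u2 m - cos u2 *\<^sub>R A u1 m)) \<longlonglongrightarrow> c *\<^sub>R (cos u1 *\<^sub>R 0 - cos u2 *\<^sub>R 0)"
      by (intro tendsto_intros A)+
    ultimately show ?thesis by (simp add: c)
  qed
  show ?thesis
    by (rule that[of w]) (use pq in auto)
qed

section \<open>Logability of the product\<close>

lemma approx_eigenvalue_complexI:
  fixes B :: "nat \<Rightarrow> 'a::complex_normed_vector \<Rightarrow>\<^sub>L 'a"
  assumes "\<And>\<epsilon>. \<epsilon> > 0 \<Longrightarrow> \<exists>v. v \<noteq> 0 \<and> (\<forall>i\<in>{1..k}. norm (B i v - z *\<^sub>C v) \<le> \<epsilon> * norm v)"
  shows "approx_eigenvalue_complex B k z"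
proof -
  have "\<exists>v. v \<noteq> 0 \<and> (\<forall>i\<in>{1..k}. norm (B i v - z *\<^sub>C v) \<le> (1 / real (Suc m)) * norm v)" for m
    by (rule assms) simp
  then obtain v where v: "\<And>m. v m \<noteq> 0"
    "\<And>m i. i \<in> {1..k} \<Longrightarrow> norm (B i (v m) - z *\<^sub>C v m) \<le> (1 / real (Suc m)) * norm (v m)"
    by metis
  have "(\<lambda>m. B i (sgn (v m)) - z *\<^sub>C sgn (v m)) \<longlonglongrightarrow> 0" if i: "i \<in> {1..k}" for i
  proof (rule Lim_null_comparison)
    have "norm (B i (sgn (v m)) - z *\<^sub>C sgn (v m)) \<le> 1 / real (Suc m)" for m
    proof -
      have "B i (sgn (v m)) - z *\<^sub>C sgn (v m) = (1 / norm (v m)) *\<^sub>R (B i (v m) - z *\<^sub>C v m)"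
        by (simp add: sgn_div_norm blinfun.scaleR_right scaleC.scaleR_right scaleR_diff_right divide_inverse)
      then show ?thesis
        using v(2)[OF i, of m] v(1)[of m] by (simp add: divide_le_eq)
    qed
    then show "\<forall>\<^sub>F m in sequentially. norm (B i (sgn (v m)) - z *\<^sub>C sgn (v m)) \<le> 1 / real (Suc m)"
      by (intro always_eventually) auto
    show "(\<lambda>m. 1 / real (Suc m)) \<longlonglongrightarrow> 0"
      using LIMSEQ_inverse_real_of_nat by (simp add: inverse_eq_divide)
  qed
  then show ?thesis
    unfolding approx_eigenvalue_complex_def
    by (intro exI[of _ "\<lambda>m. sgn (v m)"]) (simp add: norm_sgn v(1))
qed

text \<open>\<open>x - \<i> w\<close> and \<open>x + \<i> w\<close> are approximate eigenvectors for \<open>\<i> / t\<close> and \<open>- \<i> / t\<close>, and they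
  cannot both be short since they add up to \<open>2 x\<close>.\<close>

lemma rotation_eigenvalues:
  fixes B :: "nat \<Rightarrow> 'a::complex_normed_vector \<Rightarrow>\<^sub>L 'a"
  assumes B: "\<And>i. i \<in> {1..k} \<Longrightarrow> complex_linear (B i)" and t: "cmod t = 1"
    and x: "\<And>m. norm (x m) = 1"
    and p: "\<And>i. i \<in> {1..k} \<Longrightarrow> (\<lambda>m. t *\<^sub>C B i (x m) - w m) \<longlonglongrightarrow> 0"
    and q: "\<And>i. i \<in> {1..k} \<Longrightarrow> (\<lambda>m. t *\<^sub>C B i (w m) + x m) \<longlonglongrightarrow> 0"
  shows "approx_eigenvalue_complex B k (\<i> / t) \<or> approx_eigenvalue_complex B k (- \<i> / t)"
proof -
  let ?P = "\<lambda>z \<epsilon>. \<exists>v. v \<noteq> 0 \<and> (\<forall>i\<in>{1..k}. norm (B i v - z *\<^sub>C v) \<le> \<epsilon> * norm v)"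
  have t0: "t \<noteq> 0" using t by auto
  have step: "?P (\<i> / t) \<epsilon> \<or> ?P (- \<i> / t) \<epsilon>" if "\<epsilon> > 0" for \<epsilon>
  proof -
    have "\<forall>\<^sub>F m in sequentially. norm (t *\<^sub>C B i (x m) - w m) < \<epsilon> / 2 \<and> norm (t *\<^sub>C B i (w m) + x m) < \<epsilon> / 2"
      if "i \<in> {1..k}" for i
      using tendstoD[OF p[OF that], of "\<epsilon> / 2"] tendstoD[OF q[OF that], of "\<epsilon> / 2"] \<open>\<epsilon> > 0\<close>
      by (auto simp: dist_norm intro: eventually_conj)
    then have "\<forall>\<^sub>F m in sequentially. \<forall>i\<in>{1..k}.
        norm (t *\<^sub>C B i (x m) - w m) < \<epsilon> / 2 \<and> norm (t *\<^sub>C B i (w m) + x m) < \<epsilon> / 2"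
      by (intro eventually_ball_finite) auto
    then obtain m where m: "\<And>i. i \<in> {1..k} \<Longrightarrow> norm (t *\<^sub>C B i (x m) - w m) < \<epsilon> / 2"
      "\<And>i. i \<in> {1..k} \<Longrightarrow> norm (t *\<^sub>C B i (w m) + x m) < \<epsilon> / 2"
      using eventually_happens'[OF sequentially_bot] by fast
    define v where "v a = x m - a *\<^sub>C w m" for a
    have small: "norm (B i (v a) - (a / t) *\<^sub>C v a) \<le> \<epsilon>" if i: "i \<in> {1..k}" and a: "a = \<i> \<or> a = - \<i>" for i a
    proof -
      have aa: "a * a = -1" "cmod a = 1" using a by auto
      have "t *\<^sub>C (B i (v a) - (a / t) *\<^sub>C v a) = (t *\<^sub>C B i (x m) - w m) - a *\<^sub>C (t *\<^sub>C B i (w m) + x m)"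
      proof -
        have "t *\<^sub>C ((a / t) *\<^sub>C v a) = a *\<^sub>C v a" using t0 by (simp add: scaleC_scaleC)
        also have "\<dots> = a *\<^sub>C x m + w m"
          unfolding v_def scaleC.diff_right scaleC_scaleC aa by (simp add: scaleC.minus_left)
        finally show ?thesis
          unfolding scaleC.diff_right by (simp add: v_def blinfun.diff_right complex_linearD[OF B[OF i]]
            scaleC.diff_right scaleC_add_right scaleC_scaleC mult.commute)
      qed
      then have "norm (B i (v a) - (a / t) *\<^sub>C v a)
          = norm ((t *\<^sub>C B i (x m) - w m) - a *\<^sub>C (t *\<^sub>C B i (w m) + x m))"
        using t by (metis mult_1 norm_scaleC)
      also have "\<dots> \<le> norm (t *\<^sub>C B i (x m) - w m) + norm (t *\<^sub>C B i (w m) + x m)"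
        using norm_triangle_ineq4[of "t *\<^sub>C B i (x m) - w m" "a *\<^sub>C (t *\<^sub>C B i (w m) + x m)"] aa
        by (simp add: norm_scaleC)
      also have "\<dots> \<le> \<epsilon>" using m[OF i] by simp
      finally show ?thesis .
    qed
    have "v \<i> + v (- \<i>) = 2 *\<^sub>R x m"
      by (simp add: v_def scaleC.minus_left scaleR_2)
    then have "2 \<le> norm (v \<i>) + norm (v (- \<i>))"
      using norm_triangle_ineq[of "v \<i>" "v (- \<i>)"] x[of m] by simp
    then consider "1 \<le> norm (v \<i>)" | "1 \<le> norm (v (- \<i>))" by linarith
    then show ?thesis
    proof cases
      case 1
      have "norm (B i (v \<i>) - (\<i> / t) *\<^sub>C v \<i>) \<le> \<epsilon> * norm (v \<i>)" if "i \<in> {1..k}" for i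
        using small[OF that, of \<i>] mult_left_mono[OF 1 less_imp_le[OF \<open>\<epsilon> > 0\<close>]] by simp
      moreover have "v \<i> \<noteq> 0" using 1 by auto
      ultimately show ?thesis by blast
    next
      case 2
      have "norm (B i (v (- \<i>)) - (- \<i> / t) *\<^sub>C v (- \<i>)) \<le> \<epsilon> * norm (v (- \<i>))" if "i \<in> {1..k}" for i
        using small[OF that, of "- \<i>"] mult_left_mono[OF 2 less_imp_le[OF \<open>\<epsilon> > 0\<close>]] by simp
      moreover have "v (- \<i>) \<noteq> 0" using 2 by auto
      ultimately show ?thesis by blast
    qed
  qed
  define P where "P z \<epsilon> = ?P z \<epsilon>" for z \<epsilon>
  have PI: "approx_eigenvalue_complex B k z" if "\<And>\<epsilon>. \<epsilon> > 0 \<Longrightarrow> P z \<epsilon>" for z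
    by (rule approx_eigenvalue_complexI) (rule that[unfolded P_def])
  have mono: "P z \<epsilon>'" if P: "P z \<epsilon>" and "\<epsilon> \<le> \<epsilon>'" for z \<epsilon> \<epsilon>'
  proof -
    from P obtain v where v: "v \<noteq> 0" "\<forall>i\<in>{1..k}. norm (B i v - z *\<^sub>C v) \<le> \<epsilon> * norm v" unfolding P_def by blast
    have "norm (B i v - z *\<^sub>C v) \<le> \<epsilon>' * norm v" if "i \<in> {1..k}" for i
      using v(2) that mult_right_mono[OF \<open>\<epsilon> \<le> \<epsilon>'\<close>, of "norm v"] by force
    with v(1) show ?thesis unfolding P_def by (intro exI[of _ v]) simp
  qed
  show ?thesis
  proof (rule ccontr)
    assume "\<not> ?thesis"
    then have n: "\<not> approx_eigenvalue_complex B k (\<i> / t)" "\<not> approx_eigenvalue_complex B k (- \<i> / t)"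
      by simp_all
    obtain \<epsilon> where \<epsilon>: "\<epsilon> > 0" "\<not> P (\<i> / t) \<epsilon>" using PI n(1) by blast
    obtain \<epsilon>' where \<epsilon>': "\<epsilon>' > 0" "\<not> P (- \<i> / t) \<epsilon>'" using PI n(2) by blast
    have "P (\<i> / t) (min \<epsilon> \<epsilon>') \<or> P (- \<i> / t) (min \<epsilon> \<epsilon>')"
      unfolding P_def by (rule step) (use \<epsilon> \<epsilon>' in simp)
    then show False
      using mono[of "\<i> / t" "min \<epsilon> \<epsilon>'" \<epsilon>] mono[of "- \<i> / t" "min \<epsilon> \<epsilon>'" \<epsilon>'] \<epsilon>(2) \<epsilon>'(2) by auto
  qed
qed

lemma bch_complex_eq: "bch_complex B s k t = ordered_exp (\<lambda>i. s i *\<^sub>R (t *\<^sub>C B i)) k"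
  unfolding bch_complex_def by (simp add: scaleC_of_real[symmetric] scaleC_scaleC mult.commute)

lemma logable_bch_complex:
  fixes B :: "nat \<Rightarrow> 'a::chilbert_space \<Rightarrow>\<^sub>L 'a" and s :: "nat \<Rightarrow> real"
  assumes s: "\<And>i. i \<in> {1..k} \<Longrightarrow> 0 < s i" "(\<Sum>i=1..k. s i) = pi"
    and B: "\<And>i. i \<in> {1..k} \<Longrightarrow> complex_linear (B i)" "\<And>i. i \<in> {1..k} \<Longrightarrow> norm (B i) \<le> 1"
    and t: "cmod t \<le> 1"
    and not_eigen: "cmod t = 1 \<Longrightarrow> \<not> approx_eigenvalue_complex B k (\<i> / t) \<and> \<not> approx_eigenvalue_complex B k (- \<i> / t)"
  shows "logable (bch_complex B s k t)"
proof -
  define T where "T i = t *\<^sub>C B i" for i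
  define E where "E = ordered_exp (\<lambda>i. s i *\<^sub>R T i) k"
  have T: "complex_linear (T i)" "norm (T i) \<le> cmod t" if "i \<in> {1..k}" for i
    using complex_linear_scaleC B that mult_left_mono[OF B(2)[OF that], of "cmod t"]
    by (auto simp: T_def norm_scaleC)
  have "k \<ge> 1" using s(2) by (cases k) auto
  have "\<exists>c>0. \<forall>l\<ge>0. \<forall>x. c * norm x \<le> norm (E x + l *\<^sub>R x)"
  proof (rule ccontr)
    assume "\<not> ?thesis"
    then have "\<exists>l x. 0 \<le> l \<and> norm (E x + l *\<^sub>R x) < (1 / real (Suc m)) * norm x" for m
      by (metis (no_types) not_le zero_less_divide_1_iff of_nat_0_less_iff zero_less_Suc)
    then obtain l x where l: "\<And>m. 0 \<le> l m"
      and lx: "\<And>m. norm (E (x m) + l m *\<^sub>R x m) < (1 / real (Suc m)) * norm (x m)" by metis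
    have xnz: "x m \<noteq> 0" for m using lx[of m] by auto
    define x' where "x' m = sgn (x m)" for m
    have x': "norm (x' m) = 1" for m by (simp add: x'_def norm_sgn xnz)
    have lim: "(\<lambda>m. E (x' m) + l m *\<^sub>R x' m) \<longlonglongrightarrow> 0"
    proof (rule Lim_null_comparison)
      have "norm (E (x' m) + l m *\<^sub>R x' m) \<le> 1 / real (Suc m)" for m
      proof -
        have "E (x' m) + l m *\<^sub>R x' m = (1 / norm (x m)) *\<^sub>R (E (x m) + l m *\<^sub>R x m)"
          by (simp add: x'_def sgn_div_norm blinfun.scaleR_right scaleR_add_right divide_inverse)
        then show ?thesis
          using lx[of m] xnz[of m] by (simp add: divide_le_eq)
      qed
      then show "\<forall>\<^sub>F m in sequentially. norm (E (x' m) + l m *\<^sub>R x' m) \<le> 1 / real (Suc m)"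
        by (intro always_eventually) auto
      show "(\<lambda>m. 1 / real (Suc m)) \<longlonglongrightarrow> 0"
        using LIMSEQ_inverse_real_of_nat by (simp add: inverse_eq_divide)
    qed
    obtain w where w: "\<And>i. i \<in> {1..k} \<Longrightarrow> (\<lambda>m. T i (x' m) - w m) \<longlonglongrightarrow> 0"
      "\<And>i. i \<in> {1..k} \<Longrightarrow> (\<lambda>m. T i (w m) + x' m) \<longlonglongrightarrow> 0"
      using antipodal_generators[OF s T(1) order_trans[OF T(2) t] x' l lim[unfolded E_def]] by blast
    show False
    proof (cases "cmod t = 1")
      case True
      show False
        using rotation_eigenvalues[where B = B and x = x' and w = w, OF B(1) True x'] w not_eigen[OF True] by (auto simp: T_def)
    next
      case False
      have one: "1 \<in> {1..k}" using \<open>k \<ge> 1\<close> by auto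
      let ?r = "cmod t"
      have "1 \<le> norm (T 1 (w m) + x' m) + ?r * (norm (T 1 (x' m) - w m) + ?r)" for m
      proof -
        have "norm (w m) \<le> norm (T 1 (x' m)) + norm (T 1 (x' m) - w m)"
          using norm_triangle_ineq4[of "T 1 (x' m)" "T 1 (x' m) - w m"] by simp
        also have "norm (T 1 (x' m)) \<le> ?r"
          using order_trans[OF norm_blinfun mult_right_mono[OF T(2)[OF one]], of "x' m"] x'[of m] by simp
        finally have nw: "norm (w m) \<le> norm (T 1 (x' m) - w m) + ?r" by simp
        have "norm (x' m) \<le> norm (T 1 (w m) + x' m) + norm (T 1 (w m))"
          using norm_triangle_ineq4[of "T 1 (w m) + x' m" "T 1 (w m)"] by simp
        also have "norm (T 1 (w m)) \<le> ?r * norm (w m)"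
          using order_trans[OF norm_blinfun mult_right_mono[OF T(2)[OF one]]] by simp
        also have "\<dots> \<le> ?r * (norm (T 1 (x' m) - w m) + ?r)"
          by (intro mult_left_mono nw) simp
        finally show ?thesis by (simp add: x')
      qed
      moreover have "(\<lambda>m. norm (T 1 (w m) + x' m) + ?r * (norm (T 1 (x' m) - w m) + ?r))
          \<longlonglongrightarrow> norm (0::'a) + ?r * (norm (0::'a) + ?r)"
        by (intro tendsto_intros w one)
      ultimately have "1 \<le> norm (0::'a) + ?r * (norm (0::'a) + ?r)"
        by (intro LIMSEQ_le_const) auto
      then have "1 \<le> ?r * ?r" by simp
      moreover have "?r * ?r < 1 * 1" using False t by (intro mult_strict_mono) auto
      ultimately show False by simp
    qed
  qed
  then obtain c where c: "c > 0" "\<And>l x. 0 \<le> l \<Longrightarrow> c * norm x \<le> norm (E x + l *\<^sub>R x)" by blast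
  have "op_invertible E"
    unfolding E_def by (intro op_invertible_ordered_exp complex_linear_scaleR T)
  then have "logable E"
    unfolding logable_iff_half_line using op_invertible_half_line[OF _ c] by blast
  then show ?thesis by (simp add: bch_complex_eq E_def T_def)
qed

section \<open>The Magnus expansion\<close>

lemma sums_Suc_zero:
  fixes f :: "nat \<Rightarrow> 'a::real_normed_vector"
  assumes "f 0 = 0"
  shows "(\<lambda>n. f (Suc n)) sums l \<longleftrightarrow> f sums l"
  using sums_Suc_iff[of f l] assms by simp

lemma magnus_complexI:
  assumes "\<mu> 0 = 0" "r > 0"
    and \<mu>: "\<And>t. cmod t < r \<Longrightarrow> (\<lambda>n. t ^ Suc n *\<^sub>C \<mu> (Suc n)) sums op_log (bch_complex B s k t)"
  shows "magnus_complex B s k = (\<mu> :: nat \<Rightarrow> 'a::{banach, complex_normed_vector} \<Rightarrow>\<^sub>L 'a)"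
  unfolding magnus_complex_def
proof (rule the_equality)
  fix \<nu> :: "nat \<Rightarrow> 'a \<Rightarrow>\<^sub>L 'a"
  assume "\<nu> 0 = 0 \<and> (\<exists>r>0. \<forall>t. cmod t < r \<longrightarrow> (\<lambda>n. t ^ Suc n *\<^sub>C \<nu> (Suc n)) sums op_log (bch_complex B s k t))"
  then obtain r' where \<nu>0: "\<nu> 0 = 0" and "r' > 0"
    and \<nu>: "\<And>t. cmod t < r' \<Longrightarrow> (\<lambda>n. t ^ Suc n *\<^sub>C \<nu> (Suc n)) sums op_log (bch_complex B s k t)"
    by blast
  have real: "(\<lambda>n. t ^ n *\<^sub>R \<xi> n) sums l"
    if "(\<lambda>n. complex_of_real t ^ Suc n *\<^sub>C \<xi> (Suc n)) sums l" "\<xi> 0 = 0"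
    for \<xi> :: "nat \<Rightarrow> 'a \<Rightarrow>\<^sub>L 'a" and t l
  proof -
    have "(\<lambda>n. t ^ Suc n *\<^sub>R \<xi> (Suc n)) sums l"
      using that(1) unfolding of_real_power[symmetric] scaleC_of_real .
    then show ?thesis
      using sums_Suc_zero[of "\<lambda>n. t ^ n *\<^sub>R \<xi> n" l] that(2) by simp
  qed
  show "\<nu> = \<mu>"
  proof (rule power_series_unique[of "min r r'"])
    fix t :: real assume "\<bar>t\<bar> < min r r'"
    then show "(\<lambda>n. t ^ n *\<^sub>R \<nu> n) sums op_log (bch_complex B s k (of_real t))"
      "(\<lambda>n. t ^ n *\<^sub>R \<mu> n) sums op_log (bch_complex B s k (of_real t))"
      by (intro real \<mu> \<nu> \<nu>0 assms(1); simp)+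
  qed (use \<open>r > 0\<close> \<open>r' > 0\<close> in auto)
qed (use assms in auto)

lemma magnus_realI:
  assumes "\<mu> 0 = 0" "r > 0"
    and \<mu>: "\<And>t. \<bar>t\<bar> < r \<Longrightarrow> (\<lambda>n. t ^ Suc n *\<^sub>R \<mu> (Suc n)) sums op_log (bch_real B s k t)"
  shows "magnus_real B s k = (\<mu> :: nat \<Rightarrow> 'a::banach \<Rightarrow>\<^sub>L 'a)"
  unfolding magnus_real_def
proof (rule the_equality)
  fix \<nu> :: "nat \<Rightarrow> 'a \<Rightarrow>\<^sub>L 'a"
  assume "\<nu> 0 = 0 \<and> (\<exists>r>0. \<forall>t. \<bar>t\<bar> < r \<longrightarrow> (\<lambda>n. t ^ Suc n *\<^sub>R \<nu> (Suc n)) sums op_log (bch_real B s k t))"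
  then obtain r' where \<nu>0: "\<nu> 0 = 0" and "r' > 0"
    and \<nu>: "\<And>t. \<bar>t\<bar> < r' \<Longrightarrow> (\<lambda>n. t ^ Suc n *\<^sub>R \<nu> (Suc n)) sums op_log (bch_real B s k t)"
    by blast
  show "\<nu> = \<mu>"
  proof (rule power_series_unique[of "min r r'"])
    fix t :: real assume t: "\<bar>t\<bar> < min r r'"
    show "(\<lambda>n. t ^ n *\<^sub>R \<nu> n) sums op_log (bch_real B s k t)"
      using sums_Suc_zero[of "\<lambda>n. t ^ n *\<^sub>R \<nu> n"] \<nu>[of t] t \<nu>0 by simp
    show "(\<lambda>n. t ^ n *\<^sub>R \<mu> n) sums op_log (bch_real B s k t)"
      using sums_Suc_zero[of "\<lambda>n. t ^ n *\<^sub>R \<mu> n"] \<mu>[of t] t assms(1) by simp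
  qed (use \<open>r > 0\<close> \<open>r' > 0\<close> in auto)
qed (use assms in auto)

lemma bch_complex_zero: "bch_complex B s k 0 = (id_blinfun :: 'a::{banach, complex_normed_vector} \<Rightarrow>\<^sub>L 'a)"
proof -
  have "ordered_exp (\<lambda>_. 0) k = (id_blinfun :: 'a \<Rightarrow>\<^sub>L 'a)" by (induction k) simp_all
  then show ?thesis by (simp add: bch_complex_def scaleC.zero_left)
qed

lemma continuous_on_bch_complex:
  fixes B :: "nat \<Rightarrow> 'a::{banach, complex_normed_vector} \<Rightarrow>\<^sub>L 'a"
  assumes "\<And>i. i \<in> {1..k} \<Longrightarrow> complex_linear (B i)"
  shows "continuous_on S (bch_complex B s k)"
proof -
  obtain D where "\<And>t. (bch_complex B s k has_derivative (\<lambda>h. h *\<^sub>C D t)) (at t)"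
    using bch_complex_derivative[where B = B and k = k and s = s, OF assms] by blast
  then show ?thesis
    by (intro has_derivative_continuous_on) (rule has_derivative_at_withinI)
qed

lemma magnus_complex_expansion:
  fixes B :: "nat \<Rightarrow> 'a::chilbert_space \<Rightarrow>\<^sub>L 'a"
  assumes B: "\<And>i. i \<in> {1..k} \<Longrightarrow> complex_linear (B i)" and "R > 0"
    and log: "\<And>t. cmod t < R \<Longrightarrow> logable (bch_complex B s k t)"
  shows "magnus_complex B s k 0 = 0"
    and "cmod t < R \<Longrightarrow> summable (\<lambda>n. norm (t ^ Suc n *\<^sub>C magnus_complex B s k (Suc n)))"
    and "cmod t < R \<Longrightarrow> (\<lambda>n. t ^ Suc n *\<^sub>C magnus_complex B s k (Suc n)) sums op_log (bch_complex B s k t)"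
proof -
  let ?E = "bch_complex B s k"
  have inv: "segment_invertible (?E t)" if "t \<in> ball 0 R" for t
    using log that by (simp add: logable_iff)
  obtain D where D: "continuous_on UNIV D" "\<And>t. (?E has_derivative (\<lambda>h. h *\<^sub>C D t)) (at t)"
    using bch_complex_derivative[where B = B and k = k and s = s, OF B] by blast
  have hol: "(\<lambda>t. cinner y (op_log (?E t) x)) holomorphic_on ball 0 R" for x y
    by (rule holomorphic_op_log[OF D(2,1) complex_linear_bch_complex[OF B] inv convex_ball])
  have cont: "continuous_on (ball 0 R) (\<lambda>t. op_log (?E t))"
    by (rule continuous_on_compose2[OF continuous_on_op_log continuous_on_bch_complex[OF B]])
      (use inv in auto)
  obtain \<mu> where \<mu>: "\<And>t. cmod t < R \<Longrightarrow> summable (\<lambda>n. norm (t ^ n *\<^sub>C \<mu> n))"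
    "\<And>t. cmod t < R \<Longrightarrow> (\<lambda>n. t ^ n *\<^sub>C \<mu> n) sums op_log (?E t)"
    using operator_taylor[OF cont \<open>R > 0\<close> hol] by blast
  have \<mu>0: "\<mu> 0 = 0"
  proof -
    have "(\<lambda>n. 0 ^ n *\<^sub>C \<mu> n) = (\<lambda>n. if n = 0 then \<mu> 0 else 0)"
      by (auto simp: fun_eq_iff scaleC.zero_left power_0_left)
    moreover have "(\<lambda>n. if n = 0 then \<mu> 0 else 0) sums \<mu> 0"
      using sums_single[of 0 "\<lambda>_. \<mu> 0"] by simp
    ultimately show ?thesis
      using sums_unique2[OF \<mu>(2)[of 0]] \<open>R > 0\<close> by (simp add: bch_complex_zero)
  qed
  have sums: "(\<lambda>n. t ^ Suc n *\<^sub>C \<mu> (Suc n)) sums op_log (?E t)" if "cmod t < R" for t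
    using sums_Suc_zero[of "\<lambda>n. t ^ n *\<^sub>C \<mu> n"] \<mu>(2)[OF that] \<mu>0 by (simp add: scaleC.zero_right)
  have eq: "magnus_complex B s k = \<mu>"
    by (rule magnus_complexI[OF \<mu>0 \<open>R > 0\<close> sums])
  show "magnus_complex B s k 0 = 0" by (simp add: eq \<mu>0)
  show "summable (\<lambda>n. norm (t ^ Suc n *\<^sub>C magnus_complex B s k (Suc n)))" if "cmod t < R"
    unfolding eq using \<mu>(1)[OF that] by (rule summable_Suc_iff[THEN iffD2])
  show "(\<lambda>n. t ^ Suc n *\<^sub>C magnus_complex B s k (Suc n)) sums op_log (?E t)" if "cmod t < R"
    unfolding eq by (rule sums[OF that])
qed

lemma magnus_abel_complex:
  fixes B :: "nat \<Rightarrow> 'a::chilbert_space \<Rightarrow>\<^sub>L 'a"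
  assumes B: "\<And>i. i \<in> {1..k} \<Longrightarrow> complex_linear (B i)"
    and log: "\<And>t. cmod t < 1 \<Longrightarrow> logable (bch_complex B s k t)" and log1: "logable (bch_complex B s k 1)"
  shows "((\<lambda>t::real. \<Sum>n. t ^ Suc n *\<^sub>R magnus_complex B s k (Suc n))
    \<longlongrightarrow> op_log (bch_complex B s k 1)) (at_left 1)"
proof -
  let ?E = "bch_complex B s k"
  have "isCont op_log (?E 1)"
    using continuous_on_op_log open_segment_invertible log1
    by (metis continuous_on_eq_continuous_at logable_iff mem_Collect_eq)
  moreover have "((\<lambda>t::real. ?E (of_real t)) \<longlongrightarrow> ?E (of_real 1)) (at_left 1)"
  proof -
    have "continuous_on UNIV (\<lambda>t::real. ?E (of_real t))"
      by (rule continuous_on_compose2[OF continuous_on_bch_complex[OF B, where S = UNIV]])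
        (auto intro!: continuous_intros)
    then have "isCont (\<lambda>t::real. ?E (of_real t)) 1" by (simp add: continuous_on_eq_continuous_at)
    then show ?thesis
      unfolding isCont_def by (rule filterlim_mono) (auto simp: at_le)
  qed
  ultimately have "((\<lambda>t::real. op_log (?E (of_real t))) \<longlongrightarrow> op_log (?E 1)) (at_left 1)"
    using isCont_tendsto_compose by fastforce
  moreover have "\<forall>\<^sub>F t in at_left (1::real). op_log (?E (of_real t)) = (\<Sum>n. t ^ Suc n *\<^sub>R magnus_complex B s k (Suc n))"
  proof -
    have "op_log (?E (of_real t)) = (\<Sum>n. t ^ Suc n *\<^sub>R magnus_complex B s k (Suc n))" if "0 < t" "t < 1" for t :: real
      using sums_unique[OF magnus_complex_expansion(3)[OF B zero_less_one log, of "of_real t"]] that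
      unfolding of_real_power[symmetric] scaleC_of_real by simp
    then show ?thesis
      by (auto simp: eventually_at_left_field intro!: exI[of _ 0])
  qed
  ultimately show ?thesis by (rule Lim_transform_eventually)
qed

lemma logable_beyond_disc:
  fixes B :: "nat \<Rightarrow> 'a::chilbert_space \<Rightarrow>\<^sub>L 'a"
  assumes B: "\<And>i. i \<in> {1..k} \<Longrightarrow> complex_linear (B i)"
    and log: "\<And>t. cmod t \<le> 1 \<Longrightarrow> logable (bch_complex B s k t)"
  obtains R where "R > 1" "\<And>t. cmod t < R \<Longrightarrow> logable (bch_complex B s k t)"
proof -
  let ?U = "bch_complex B s k -` {A. segment_invertible A}"
  have "open ?U"
    by (intro open_vimage open_segment_invertible continuous_on_bch_complex B)
  moreover have "cball 0 1 \<subseteq> ?U" using log by (auto simp: logable_iff)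
  ultimately obtain \<epsilon> where \<epsilon>: "\<epsilon> > 0" "(\<Union>x\<in>cball 0 1. ball x \<epsilon>) \<subseteq> ?U"
    using compact_subset_open_imp_ball_epsilon_subset[OF compact_cball] by metis
  show ?thesis
  proof (rule that[of "1 + \<epsilon>"])
    fix t :: complex assume t: "cmod t < 1 + \<epsilon>"
    show "logable (bch_complex B s k t)"
    proof (cases "cmod t \<le> 1")
      case False
      then have "t \<noteq> 0" by auto
      have "t - sgn t = of_real (cmod t - 1) * sgn t"
        using \<open>t \<noteq> 0\<close> by (simp add: sgn_div_norm scaleR_conv_of_real field_simps)
      then have "dist (sgn t) t = cmod t - 1"
        using False \<open>t \<noteq> 0\<close> by (simp add: dist_norm norm_minus_commute norm_mult norm_sgn del: of_real_diff)
      then have "t \<in> ball (sgn t) \<epsilon>" "sgn t \<in> cball 0 1" using t by (auto simp: norm_sgn)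
      then have "t \<in> ?U" using \<epsilon>(2) by blast
      then show ?thesis by (simp add: logable_iff)
    qed (use log in auto)
  qed (use \<epsilon> in auto)
qed

lemma logable_radius_gt:
  assumes "R > 1" "\<And>t. cmod t < R \<Longrightarrow> logable (E t)"
  shows "logable_radius E > 1"
proof -
  have "ereal R \<le> logable_radius E"
    unfolding logable_radius_def using assms by (intro Sup_upper) auto
  moreover have "1 < ereal R" using assms(1) by simp
  ultimately show ?thesis by (rule less_le_trans[rotated])
qed

lemma approx_eigenvalue_complex_differences:
  assumes "approx_eigenvalue_complex B k z"
  shows "differences_approx_zero B k"
proof -
  obtain x where x: "\<And>m. norm (x m) = 1"
    "\<And>i. i \<in> {1..k} \<Longrightarrow> (\<lambda>m. B i (x m) - z *\<^sub>C x m) \<longlonglongrightarrow> 0"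
    using assms unfolding approx_eigenvalue_complex_def by blast
  have "(\<lambda>m. (B i - B j) (x m)) \<longlonglongrightarrow> 0" if "i \<in> {1..k}" "j \<in> {1..k}" for i j
    using tendsto_diff[OF x(2)[OF that(1)] x(2)[OF that(2)]] by (simp add: blinfun.diff_left)
  with x(1) show ?thesis unfolding differences_approx_zero_def by blast
qed

lemma magnus_complex_abel_at_one:
  fixes B :: "nat \<Rightarrow> 'a::chilbert_space \<Rightarrow>\<^sub>L 'a" and s :: "nat \<Rightarrow> real"
  assumes s: "\<And>i. i \<in> {1..k} \<Longrightarrow> 0 < s i" "(\<Sum>i=1..k. s i) = pi"
    and B: "\<And>i. i \<in> {1..k} \<Longrightarrow> complex_linear (B i)" "\<And>i. i \<in> {1..k} \<Longrightarrow> norm (B i) \<le> 1"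
    and not: "\<not> approx_eigenvalue_complex B k \<i>" "\<not> approx_eigenvalue_complex B k (- \<i>)"
  shows "logable (bch_complex B s k 1)"
    and "((\<lambda>t::real. \<Sum>n. t ^ Suc n *\<^sub>R magnus_complex B s k (Suc n))
      \<longlongrightarrow> op_log (bch_complex B s k 1)) (at_left 1)"
proof -
  show 1: "logable (bch_complex B s k 1)"
    by (rule logable_bch_complex[OF s B]) (use not in auto)
  show "((\<lambda>t::real. \<Sum>n. t ^ Suc n *\<^sub>R magnus_complex B s k (Suc n))
      \<longlongrightarrow> op_log (bch_complex B s k 1)) (at_left 1)"
  proof (rule magnus_abel_complex[where B = B, OF B(1) _ 1])
    show "logable (bch_complex B s k t)" if "cmod t < 1" for t
      by (rule logable_bch_complex[OF s B]) (use that in auto)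
  qed
qed

lemma magnus_complex_summable:
  fixes B :: "nat \<Rightarrow> 'a::chilbert_space \<Rightarrow>\<^sub>L 'a" and s :: "nat \<Rightarrow> real"
  assumes s: "\<And>i. i \<in> {1..k} \<Longrightarrow> 0 < s i" "(\<Sum>i=1..k. s i) = pi"
    and B: "\<And>i. i \<in> {1..k} \<Longrightarrow> complex_linear (B i)" "\<And>i. i \<in> {1..k} \<Longrightarrow> norm (B i) \<le> 1"
    and t: "0 \<le> t" "t < (1::real)"
  shows "summable (\<lambda>n. t ^ Suc n *\<^sub>R magnus_complex B s k (Suc n))"
proof -
  have "logable (bch_complex B s k t)" if "cmod t < 1" for t
    by (rule logable_bch_complex[OF s B]) (use that in auto)
  from sums_summable[OF magnus_complex_expansion(3)[OF B(1) zero_less_one this, of "of_real t"]] t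
  show ?thesis unfolding of_real_power[symmetric] scaleC_of_real by simp
qed

lemma magnus_complex_on_closed_disc:
  fixes B :: "nat \<Rightarrow> 'a::chilbert_space \<Rightarrow>\<^sub>L 'a" and s :: "nat \<Rightarrow> real"
  assumes s: "\<And>i. i \<in> {1..k} \<Longrightarrow> 0 < s i" "(\<Sum>i=1..k. s i) = pi"
    and B: "\<And>i. i \<in> {1..k} \<Longrightarrow> complex_linear (B i)" "\<And>i. i \<in> {1..k} \<Longrightarrow> norm (B i) \<le> 1"
    and not: "\<And>z. cmod z = 1 \<Longrightarrow> \<not> approx_eigenvalue_complex B k z"
  shows "cmod t \<le> 1 \<Longrightarrow> logable (bch_complex B s k t)"
    and "cmod t \<le> 1 \<Longrightarrow> summable (\<lambda>n. norm (t ^ Suc n *\<^sub>C magnus_complex B s k (Suc n)))"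
    and "cmod t \<le> 1 \<Longrightarrow> (\<lambda>n. t ^ Suc n *\<^sub>C magnus_complex B s k (Suc n)) sums op_log (bch_complex B s k t)"
    and "logable_radius (bch_complex B s k) > 1"
proof -
  show log: "logable (bch_complex B s k t)" if "cmod t \<le> 1" for t
    by (rule logable_bch_complex[OF s B that]) (auto intro!: not simp: norm_divide)
  obtain R where R: "R > 1" "\<And>t. cmod t < R \<Longrightarrow> logable (bch_complex B s k t)"
    using logable_beyond_disc[OF B(1) log] by blast
  then have "R > 0" by simp
  show "summable (\<lambda>n. norm (t ^ Suc n *\<^sub>C magnus_complex B s k (Suc n)))" if "cmod t \<le> 1"
    by (rule magnus_complex_expansion(2)[OF B(1) \<open>R > 0\<close> R(2)]) (use that R in auto)
  show "(\<lambda>n. t ^ Suc n *\<^sub>C magnus_complex B s k (Suc n)) sums op_log (bch_complex B s k t)" if "cmod t \<le> 1"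
    by (rule magnus_complex_expansion(3)[OF B(1) \<open>R > 0\<close> R(2)]) (use that R in auto)
  show "logable_radius (bch_complex B s k) > 1"
    by (rule logable_radius_gt[OF R])
qed

section \<open>Complexification\<close>

lemma complexify_apply: "complexify f z = Complexification (f (repart z)) (f (impart z))"
  by (simp add: complexify.rep_eq)

lemma bounded_linear_repart: "bounded_linear (repart :: 'a::real_normed_vector complexification \<Rightarrow> 'a)"
  by (rule bounded_linear_intro[where K = 1])
    (simp_all add: plus_complexification_def scaleR_complexification_def norm_complexification_def
      real_le_rsqrt)

lemma bounded_linear_impart: "bounded_linear (impart :: 'a::real_normed_vector complexification \<Rightarrow> 'a)"
  by (rule bounded_linear_intro[where K = 1])
    (simp_all add: plus_complexification_def scaleR_complexification_def norm_complexification_def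
      real_le_rsqrt)

lemma bounded_linear_Complexification0: "bounded_linear (\<lambda>x :: 'a::real_normed_vector. Complexification x 0)"
  by (rule bounded_linear_intro[where K = 1])
    (simp_all add: plus_complexification_def scaleR_complexification_def norm_complexification_def)

lemma complexify_add: "complexify (f + g) = complexify f + complexify g"
  by (rule blinfun_eqI) (simp add: complexify_apply blinfun.add_left plus_complexification_def)

lemma complexify_diff: "complexify (f - g) = complexify f - complexify g"
  by (rule blinfun_eqI) (simp add: complexify_apply blinfun.diff_left minus_complexification_def)

lemma complexify_scaleR: "complexify (r *\<^sub>R f) = r *\<^sub>R complexify f"
  by (rule blinfun_eqI) (simp add: complexify_apply blinfun.scaleR_left scaleR_complexification_def)

lemma complexify_compose: "complexify (f o\<^sub>L g) = complexify f o\<^sub>L complexify g"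
  by (rule blinfun_eqI) (simp add: complexify_apply)

lemma complexify_id [simp]: "complexify id_blinfun = id_blinfun"
  by (rule blinfun_eqI) (simp add: complexify_apply)

lemma norm_complexify_le: "norm (complexify f) \<le> norm f"
proof (rule norm_blinfun_bound)
  fix z
  have "(norm (f (repart z)))\<^sup>2 + (norm (f (impart z)))\<^sup>2 \<le> (norm f * norm (repart z))\<^sup>2 + (norm f * norm (impart z))\<^sup>2"
    by (intro add_mono power_mono norm_blinfun) auto
  also have "\<dots> = (norm f * norm z)\<^sup>2"
    by (simp add: norm_complexification_def power_mult_distrib algebra_simps)
  finally show "norm (complexify f z) \<le> norm f * norm z"
    by (simp add: complexify_apply norm_complexification_def[of "Complexification _ _"] real_le_lsqrt)
qed simp

lemma bounded_linear_complexify: "bounded_linear complexify"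
  by (rule bounded_linear_intro[where K = 1])
    (simp_all add: complexify_add complexify_scaleR norm_complexify_le)

lemma complex_linear_complexify:
  "complex_linear (complexify (f :: 'a::real_inner \<Rightarrow>\<^sub>L 'b::real_inner))"
  by (simp add: complex_linear_def complexify_apply scaleC_complexification_def
    blinfun.diff_right blinfun.add_right blinfun.scaleR_right)

definition realify :: "('a::real_normed_vector complexification \<Rightarrow>\<^sub>L 'b::real_normed_vector complexification) \<Rightarrow> 'a \<Rightarrow>\<^sub>L 'b" where
  "realify X = (Blinfun repart o\<^sub>L X) o\<^sub>L Blinfun (\<lambda>x. Complexification x 0)"

lemma realify_apply: "realify X x = repart (X (Complexification x 0))"
  by (simp add: realify_def bounded_linear_Blinfun_apply bounded_linear_repart bounded_linear_Complexification0)

lemma bounded_linear_realify: "bounded_linear realify"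
  unfolding realify_def[abs_def]
  by (rule bounded_linear_compose[OF ocomp.bounded_linear_left ocomp.bounded_linear_right])

lemma realify_complexify [simp]: "realify (complexify f) = f"
  by (rule blinfun_eqI) (simp add: realify_apply complexify_apply)

lemma op_invertible_complexify:
  assumes "op_invertible (complexify f)"
  shows "op_invertible f"
  unfolding op_invertible_def
proof (intro exI conjI blinfun_eqI)
  let ?C = "op_inverse (complexify f)"
  fix x
  have "f (repart (?C (Complexification x 0))) = repart (complexify f (?C (Complexification x 0)))"
    by (simp add: complexify_apply)
  then show "(f o\<^sub>L realify ?C) x = id_blinfun x"
    by (simp add: realify_apply op_inverse_apply assms)
  have "Complexification (f x) 0 = complexify f (Complexification x 0)"
    by (simp add: complexify_apply)
  then show "(realify ?C o\<^sub>L f) x = id_blinfun x"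
    by (simp add: realify_apply op_inverse_apply assms)
qed

lemma op_inverse_complexify:
  assumes "op_invertible f"
  shows "op_inverse (complexify f) = complexify (op_inverse f)"
  by (rule op_inverse_eqI) (simp_all add: complexify_compose[symmetric] op_inverse assms)

lemma op_exp_complexify:
  fixes A :: "'a::banach \<Rightarrow>\<^sub>L 'a"
  shows "complexify (op_exp A) = op_exp (complexify A)"
proof -
  have "complexify (op_pow A n) = op_pow (complexify A) n" for n
    by (induction n) (simp_all add: complexify_compose)
  then have "(\<lambda>n. (1 / fact n) *\<^sub>R op_pow (complexify A) n) sums complexify (op_exp A)"
    using bounded_linear.sums[OF bounded_linear_complexify op_exp_sums[of A]]
    by (simp add: complexify_scaleR)
  then show ?thesis using op_exp_sums sums_unique2 by blast
qed

lemma bch_complex_complexify: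
  fixes A :: "nat \<Rightarrow> 'a::{real_inner, banach} \<Rightarrow>\<^sub>L 'a"
  shows "bch_complex (\<lambda>i. complexify (A i)) s k (of_real t) = complexify (bch_real A s k t)"
proof -
  have "ordered_exp (\<lambda>i. complexify (T i)) j = complexify (ordered_exp T j)" for T :: "nat \<Rightarrow> 'a \<Rightarrow>\<^sub>L 'a" and j
    by (induction j) (simp_all add: op_exp_complexify complexify_compose)
  from this[of "\<lambda>i. (t * s i) *\<^sub>R A i"] show ?thesis
    unfolding bch_complex_def bch_real_def of_real_mult[symmetric] scaleC_of_real
    by (simp add: complexify_scaleR)
qed

lemma op_log_complexify:
  fixes A :: "'a::banach \<Rightarrow>\<^sub>L 'a"
  assumes "segment_invertible (complexify A)"
  shows "op_log (complexify A) = complexify (op_log A)"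
proof -
  have eq: "l *\<^sub>R id_blinfun + (1 - l) *\<^sub>R complexify A = complexify (l *\<^sub>R id_blinfun + (1 - l) *\<^sub>R A)" for l
    by (simp add: complexify_add complexify_scaleR)
  then have inv: "segment_invertible A"
    using assms unfolding segment_invertible_def by (auto intro: op_invertible_complexify)
  let ?g = "\<lambda>l. (A - id_blinfun) o\<^sub>L op_inverse (l *\<^sub>R id_blinfun + (1 - l) *\<^sub>R A)"
  have "op_log (complexify A) = integral {0..1} (\<lambda>l. complexify (?g l))"
    unfolding op_log_def
  proof (rule integral_cong)
    fix l :: real assume l: "l \<in> {0..1}"
    then have "op_invertible (l *\<^sub>R id_blinfun + (1 - l) *\<^sub>R A)"
      using inv by (simp add: segment_invertible_def)
    then show "(complexify A - id_blinfun) o\<^sub>L op_inverse (l *\<^sub>R id_blinfun + (1 - l) *\<^sub>R complexify A)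
        = complexify (?g l)"
      unfolding eq by (simp add: op_inverse_complexify complexify_compose complexify_diff)
  qed
  also have "\<dots> = complexify (op_log A)"
    using integral_linear[OF op_log_integrable[OF inv] bounded_linear_complexify]
    by (simp add: o_def op_log_def)
  finally show ?thesis .
qed

lemma magnus_real_eq:
  fixes A :: "nat \<Rightarrow> 'a::{real_inner, banach} \<Rightarrow>\<^sub>L 'a"
  assumes log: "\<And>t. cmod t < 1 \<Longrightarrow> logable (bch_complex (\<lambda>i. complexify (A i)) s k t)"
  shows "magnus_real A s k n = realify (magnus_complex (\<lambda>i. complexify (A i)) s k n)"
    and "complexify (magnus_real A s k n) = magnus_complex (\<lambda>i. complexify (A i)) s k n"
proof -
  let ?B = "\<lambda>i. complexify (A i)"
  let ?\<mu> = "magnus_complex ?B s k"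
  note exp = magnus_complex_expansion[where B = ?B, OF complex_linear_complexify zero_less_one log]
  have op_log: "op_log (bch_complex ?B s k (of_real t)) = complexify (op_log (bch_real A s k t))" if "\<bar>t\<bar> < 1" for t
    unfolding bch_complex_complexify
    by (rule op_log_complexify) (use log[of "of_real t"] that in \<open>simp add: logable_iff bch_complex_complexify\<close>)
  have sums: "(\<lambda>n. t ^ Suc n *\<^sub>R ?\<mu> (Suc n)) sums complexify (op_log (bch_real A s k t))" if "\<bar>t\<bar> < 1" for t
    using exp(3)[of "of_real t"] that
    unfolding op_log[OF that] of_real_power[symmetric] scaleC_of_real by simp
  have eq: "magnus_real A s k = (\<lambda>n. realify (?\<mu> n))"
  proof (rule magnus_realI[OF _ zero_less_one])
    show "realify (?\<mu> 0) = 0" by (simp add: exp(1) linear_simps(3)[OF bounded_linear_realify])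
    show "(\<lambda>n. t ^ Suc n *\<^sub>R realify (?\<mu> (Suc n))) sums op_log (bch_real A s k t)" if "\<bar>t\<bar> < 1" for t
      using bounded_linear.sums[OF bounded_linear_realify sums[OF that]]
      by (simp add: linear_simps(5)[OF bounded_linear_realify])
  qed
  then show 1: "magnus_real A s k n = realify (?\<mu> n)" for n by simp
  have "(\<lambda>n. complexify (realify (?\<mu> n))) = ?\<mu>"
  proof (rule power_series_unique[OF zero_less_one])
    fix t :: real assume t: "\<bar>t\<bar> < 1"
    show 2: "(\<lambda>n. t ^ n *\<^sub>R ?\<mu> n) sums complexify (op_log (bch_real A s k t))"
      using sums_Suc_zero[of "\<lambda>n. t ^ n *\<^sub>R ?\<mu> n"] sums[OF t] exp(1) by simp
    have "bounded_linear (\<lambda>X. complexify (realify X))"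
      by (rule bounded_linear_compose[OF bounded_linear_complexify bounded_linear_realify])
    from bounded_linear.sums[OF this 2]
    show "(\<lambda>n. t ^ n *\<^sub>R complexify (realify (?\<mu> n))) sums complexify (op_log (bch_real A s k t))"
      by (simp add: complexify_scaleR linear_simps(5)[OF bounded_linear_realify])
  qed
  then show "complexify (magnus_real A s k n) = ?\<mu> n"
    unfolding eq by (rule fun_cong)
qed

section \<open>Eigenblocks of real operators\<close>

lemma approx_eigenblockI:
  fixes A :: "nat \<Rightarrow> 'a::real_inner \<Rightarrow>\<^sub>L 'a"
  assumes orth: "\<forall>\<^sub>F m in sequentially. norm (x m) = 1 \<and> norm (y m) = 1 \<and> x m \<bullet> y m = 0"
    and x: "\<And>i. i \<in> {1..k} \<Longrightarrow> (\<lambda>m. A i (x m) - (cos \<alpha> *\<^sub>R x m + sin \<alpha> *\<^sub>R y m)) \<longlonglongrightarrow> 0"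
    and y: "\<And>i. i \<in> {1..k} \<Longrightarrow> (\<lambda>m. A i (y m) - (- sin \<alpha> *\<^sub>R x m + cos \<alpha> *\<^sub>R y m)) \<longlonglongrightarrow> 0"
  shows "approx_eigenblock A k \<alpha>"
proof -
  obtain N where "\<And>m. m \<ge> N \<Longrightarrow> norm (x m) = 1 \<and> norm (y m) = 1 \<and> x m \<bullet> y m = 0"
    using orth unfolding eventually_sequentially by blast
  then show ?thesis
    unfolding approx_eigenblock_def
    by (intro exI[of _ "\<lambda>m. x (m + N)"] exI[of _ "\<lambda>m. y (m + N)"])
      (use LIMSEQ_ignore_initial_segment[OF x, of _ N] LIMSEQ_ignore_initial_segment[OF y, of _ N] in simp)
qed

lemma approx_eigenblock_minus:
  assumes "approx_eigenblock A k \<alpha>"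
  shows "approx_eigenblock A k (- \<alpha>)"
proof -
  obtain x y where o: "\<forall>m. norm (x m) = 1 \<and> norm (y m) = 1 \<and> x m \<bullet> y m = 0"
    and xy: "\<forall>i\<in>{1..k}. (\<lambda>m. A i (x m) - (cos \<alpha> *\<^sub>R x m + sin \<alpha> *\<^sub>R y m)) \<longlonglongrightarrow> 0 \<and>
      (\<lambda>m. A i (y m) - (- sin \<alpha> *\<^sub>R x m + cos \<alpha> *\<^sub>R y m)) \<longlonglongrightarrow> 0"
    using assms unfolding approx_eigenblock_def by (elim exE conjE) (rule that)
  have x: "(\<lambda>m. A i (x m) - (cos \<alpha> *\<^sub>R x m + sin \<alpha> *\<^sub>R y m)) \<longlonglongrightarrow> 0"
    and y: "(\<lambda>m. A i (y m) - (- sin \<alpha> *\<^sub>R x m + cos \<alpha> *\<^sub>R y m)) \<longlonglongrightarrow> 0" if "i \<in> {1..k}" for i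
    using bspec[OF xy that] by simp_all
  have "(\<lambda>m. A i (- y m) - (- sin (- \<alpha>) *\<^sub>R x m + cos (- \<alpha>) *\<^sub>R - y m)) \<longlonglongrightarrow> 0" if "i \<in> {1..k}" for i
    using tendsto_minus[OF y[OF that]] by (simp add: blinfun.minus_right algebra_simps)
  then show ?thesis
    by (intro approx_eigenblockI[of x "\<lambda>m. - y m"]) (use o x in auto)
qed

lemma contraction_defect:
  fixes A :: "'a::real_inner \<Rightarrow>\<^sub>L 'a"
  assumes "norm A \<le> 1" "norm v \<le> 2"
  shows "u \<bullet> u - v \<bullet> v \<le> 4 * norm (A v - u) + (norm (A v - u))\<^sup>2"
proof -
  let ?e = "norm (A v - u)"
  have "norm u \<le> norm (A v) + ?e" using norm_triangle_ineq4[of "A v" "A v - u"] by simp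
  also have "norm (A v) \<le> norm v"
    using order_trans[OF norm_blinfun mult_right_mono[OF assms(1) norm_ge_zero]] by simp
  finally have "(norm u)\<^sup>2 \<le> (norm v + ?e)\<^sup>2" by (intro power_mono) auto
  also have "\<dots> = (norm v)\<^sup>2 + 2 * norm v * ?e + ?e\<^sup>2" by (simp add: power2_sum)
  also have "2 * norm v * ?e \<le> 4 * ?e" using assms(2) by (intro mult_right_mono) auto
  finally show ?thesis by (simp add: power2_norm_eq_inner)
qed

text \<open>A contraction acting on a plane almost like a rotation that is not \<open>\<plusminus> 1\<close> almost preserves
  the quadratic form induced on the plane, so this form is almost a multiple of the standard one:
  testing with \<open>x\<close>, \<open>y\<close>, \<open>x + y\<close> and \<open>x - y\<close> gives inequalities with opposite signs.\<close>

lemma rotation_plane_orthonormal: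
  fixes A :: "'a::real_inner \<Rightarrow>\<^sub>L 'a"
  assumes A: "norm A \<le> 1" and "sin \<alpha> \<noteq> 0"
    and n: "\<And>m. (norm (x m))\<^sup>2 + (norm (y m))\<^sup>2 = 1"
    and x: "(\<lambda>m. A (x m) - (cos \<alpha> *\<^sub>R x m - sin \<alpha> *\<^sub>R y m)) \<longlonglongrightarrow> 0"
    and y: "(\<lambda>m. A (y m) - (sin \<alpha> *\<^sub>R x m + cos \<alpha> *\<^sub>R y m)) \<longlonglongrightarrow> 0"
  shows "(\<lambda>m. x m \<bullet> x m) \<longlonglongrightarrow> 1 / 2" "(\<lambda>m. y m \<bullet> y m) \<longlonglongrightarrow> 1 / 2" "(\<lambda>m. x m \<bullet> y m) \<longlonglongrightarrow> 0"
proof -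
  define c s where "c = cos \<alpha>" and "s = sin \<alpha>"
  have s0: "s \<noteq> 0" and cs: "c\<^sup>2 + s\<^sup>2 = 1" using assms(2) by (simp_all add: c_def s_def)
  define p where "p m = x m \<bullet> x m - y m \<bullet> y m" for m
  define q where "q m = 2 * (x m \<bullet> y m)" for m
  define a where "a m = A (x m) - (c *\<^sub>R x m - s *\<^sub>R y m)" for m
  define b where "b m = A (y m) - (s *\<^sub>R x m + c *\<^sub>R y m)" for m
  define \<eta> where "\<eta> e = 4 * norm e + (norm e)\<^sup>2" for e :: 'a
  have ab: "a \<longlonglongrightarrow> 0" "b \<longlonglongrightarrow> 0" using x y by (simp_all add: a_def[abs_def] b_def[abs_def] c_def s_def)
  have \<eta>: "(\<lambda>m. \<eta> (e m)) \<longlonglongrightarrow> 0" if "e \<longlonglongrightarrow> 0" for e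
  proof -
    have "(\<lambda>m. \<eta> (e m)) \<longlonglongrightarrow> 4 * norm (0::'a) + (norm (0::'a))\<^sup>2"
      unfolding \<eta>_def by (intro tendsto_intros that)
    then show ?thesis by simp
  qed
  have sq: "(norm (x m))\<^sup>2 \<le> 1\<^sup>2" "(norm (y m))\<^sup>2 \<le> 1\<^sup>2" for m
    using n[of m] zero_le_power2[of "norm (x m)"] zero_le_power2[of "norm (y m)"]
    unfolding one_power2 by linarith+
  have le1: "norm (x m) \<le> 1" "norm (y m) \<le> 1" for m
    by (rule power2_le_imp_le[OF sq(1)], simp) (rule power2_le_imp_le[OF sq(2)], simp)
  have le2: "norm (x m) \<le> 2" "norm (y m) \<le> 2" "norm (x m + y m) \<le> 2" "norm (x m - y m) \<le> 2" for m
    using norm_triangle_ineq[of "x m" "y m"] norm_triangle_ineq4[of "x m" "y m"] le1[of m] by linarith+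
  define F where "F m g h = g\<^sup>2 * (x m \<bullet> x m) + g * h * q m + h\<^sup>2 * (y m \<bullet> y m)" for m g h
  have F: "(g *\<^sub>R x m + h *\<^sub>R y m) \<bullet> (g *\<^sub>R x m + h *\<^sub>R y m) = F m g h" for m g h
    unfolding F_def q_def by (simp add: inner_add inner_commute[of "y m" "x m"] algebra_simps power2_eq_square)
  have key: "F m (c * g + s * h) (c * h - s * g) - F m g h \<le> \<eta> (g *\<^sub>R a m + h *\<^sub>R b m)"
    if "norm (g *\<^sub>R x m + h *\<^sub>R y m) \<le> 2" for m g h
  proof -
    have e: "A (g *\<^sub>R x m + h *\<^sub>R y m) - ((c * g + s * h) *\<^sub>R x m + (c * h - s * g) *\<^sub>R y m)
        = g *\<^sub>R a m + h *\<^sub>R b m"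
      by (simp add: a_def b_def blinfun.add_right blinfun.scaleR_right algebra_simps)
    show ?thesis
      using contraction_defect[OF A that, of "(c * g + s * h) *\<^sub>R x m + (c * h - s * g) *\<^sub>R y m"]
      unfolding e F \<eta>_def .
  qed
  define Q1 Q2 where "Q1 m = s\<^sup>2 * p m + c * s * q m" and "Q2 m = 2 * (c * s * p m - s\<^sup>2 * q m)" for m
  have "- Q1 m \<le> \<eta> (a m)" for m
  proof -
    have "F m (c * 1 + s * 0) (c * 0 - s * 1) - F m 1 0 = - Q1 m"
      using cs by (simp add: F_def Q1_def p_def) algebra
    then show ?thesis using key[of 1 m 0] le2(1)[of m] by simp
  qed
  moreover have "Q1 m \<le> \<eta> (b m)" for m
  proof -
    have "F m (c * 0 + s * 1) (c * 1 - s * 0) - F m 0 1 = Q1 m"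
      using cs by (simp add: F_def Q1_def p_def) algebra
    then show ?thesis using key[of 0 m 1] le2(2)[of m] by simp
  qed
  moreover have "Q2 m \<le> \<eta> (a m + b m)" for m
  proof -
    have "F m (c * 1 + s * 1) (c * 1 - s * 1) - F m 1 1 = Q2 m"
      using cs by (simp add: F_def Q2_def p_def) algebra
    then show ?thesis using key[of 1 m 1] le2(3)[of m] by simp
  qed
  moreover have "- Q2 m \<le> \<eta> (a m - b m)" for m
  proof -
    have "F m (c * 1 + s * (- 1)) (c * (- 1) - s * 1) - F m 1 (- 1) = - Q2 m"
      using cs by (simp add: F_def Q2_def p_def) algebra
    then show ?thesis using key[of 1 m "- 1"] le2(4)[of m] by simp
  qed
  moreover have "(\<lambda>m. a m + b m) \<longlonglongrightarrow> 0" "(\<lambda>m. a m - b m) \<longlonglongrightarrow> 0"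
    using tendsto_add[OF ab] tendsto_diff[OF ab] by simp_all
  moreover have sandwich: "f \<longlonglongrightarrow> 0" if "\<And>m. - f m \<le> g m" "\<And>m. f m \<le> h m" "g \<longlonglongrightarrow> 0" "h \<longlonglongrightarrow> 0"
    for f g h :: "nat \<Rightarrow> real"
  proof (rule tendsto_sandwich[of "\<lambda>m. - g m"])
    show "\<forall>\<^sub>F m in sequentially. - g m \<le> f m" "\<forall>\<^sub>F m in sequentially. f m \<le> h m"
      using that(2) minus_le_iff that(1) by (auto intro!: always_eventually simp: minus_le_iff)
    show "(\<lambda>m. - g m) \<longlonglongrightarrow> 0" using tendsto_minus[OF that(3)] by simp
  qed (use that in auto)
  ultimately have Q: "Q1 \<longlonglongrightarrow> 0" "Q2 \<longlonglongrightarrow> 0"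
    using \<eta> ab by (auto intro: sandwich[of Q1 "\<lambda>m. \<eta> (a m)" "\<lambda>m. \<eta> (b m)"]
      sandwich[of Q2 "\<lambda>m. \<eta> (a m - b m)" "\<lambda>m. \<eta> (a m + b m)"])
  have p_eq: "p m = Q1 m + c / (2 * s) * Q2 m" for m
  proof -
    have "Q1 m + c / (2 * s) * Q2 m = (c\<^sup>2 + s\<^sup>2) * p m"
      using s0 by (simp add: Q1_def Q2_def field_simps power2_eq_square)
    then show ?thesis by (simp add: cs)
  qed
  have q_eq: "q m = c / s * Q1 m - Q2 m / 2" for m
  proof -
    have "c / s * Q1 m - Q2 m / 2 = (c\<^sup>2 + s\<^sup>2) * q m"
      using s0 by (simp add: Q1_def Q2_def field_simps power2_eq_square)
    then show ?thesis by (simp add: cs)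
  qed
  have "(\<lambda>m. Q1 m + c / (2 * s) * Q2 m) \<longlonglongrightarrow> 0 + c / (2 * s) * 0"
    by (intro tendsto_intros Q)
  then have p: "p \<longlonglongrightarrow> 0" by (simp add: p_eq[abs_def])
  have "(\<lambda>m. c / s * Q1 m - Q2 m / 2) \<longlonglongrightarrow> c / s * 0 - 0 / 2"
    by (intro tendsto_intros Q) simp
  then have q: "q \<longlonglongrightarrow> 0" by (simp add: q_eq[abs_def])
  have X: "x m \<bullet> x m = (1 + p m) / 2" "y m \<bullet> y m = (1 - p m) / 2" for m
    using n[of m] by (simp_all add: p_def power2_norm_eq_inner)
  have "(\<lambda>m. (1 + p m) / 2) \<longlonglongrightarrow> (1 + 0) / 2" "(\<lambda>m. (1 - p m) / 2) \<longlonglongrightarrow> (1 - 0) / 2"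
    "(\<lambda>m. q m / 2) \<longlonglongrightarrow> 0 / 2"
    by (intro tendsto_intros p q; simp)+
  then show "(\<lambda>m. x m \<bullet> x m) \<longlonglongrightarrow> 1 / 2" "(\<lambda>m. y m \<bullet> y m) \<longlonglongrightarrow> 1 / 2" "(\<lambda>m. x m \<bullet> y m) \<longlonglongrightarrow> 0"
    by (simp_all add: X q_def)
qed

lemma approx_eigenblock_complexify:
  fixes A :: "nat \<Rightarrow> 'a::{real_inner, banach} \<Rightarrow>\<^sub>L 'a"
  assumes A: "\<And>i. i \<in> {1..k} \<Longrightarrow> norm (A i) \<le> 1" and k: "k \<ge> 1" and sin: "sin \<alpha> \<noteq> 0"
    and eig: "approx_eigenvalue_complex (\<lambda>i. complexify (A i)) k (cis \<alpha>)"
  shows "approx_eigenblock A k \<alpha>"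
proof -
  obtain z where z: "\<And>m. norm (z m) = 1"
    "\<And>i. i \<in> {1..k} \<Longrightarrow> (\<lambda>m. complexify (A i) (z m) - cis \<alpha> *\<^sub>C z m) \<longlonglongrightarrow> 0"
    using eig unfolding approx_eigenvalue_complex_def by blast
  define x y where "x m = repart (z m)" and "y m = impart (z m)" for m
  have n: "(norm (x m))\<^sup>2 + (norm (y m))\<^sup>2 = 1" for m
    using z(1)[of m] unfolding norm_complexification_def x_def y_def by simp
  have x: "(\<lambda>m. A i (x m) - (cos \<alpha> *\<^sub>R x m - sin \<alpha> *\<^sub>R y m)) \<longlonglongrightarrow> 0"
    and y: "(\<lambda>m. A i (y m) - (sin \<alpha> *\<^sub>R x m + cos \<alpha> *\<^sub>R y m)) \<longlonglongrightarrow> 0" if "i \<in> {1..k}" for i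
    using bounded_linear.tendsto_zero[OF bounded_linear_repart z(2)[OF that]]
      bounded_linear.tendsto_zero[OF bounded_linear_impart z(2)[OF that]]
    by (simp_all add: complexify_apply minus_complexification_def scaleC_complexification_def x_def y_def
      add.commute)
  have one: "1 \<in> {1..k}" using k by simp
  note lims = rotation_plane_orthonormal[OF A[OF one] sin n x[OF one] y[OF one]]
  define r where "r = sqrt (1 / 2)"
  have r: "r > 0" "r * r = 1 / 2" by (simp_all add: r_def)
  have nx: "(\<lambda>m. norm (x m)) \<longlonglongrightarrow> r" and ny: "(\<lambda>m. norm (y m)) \<longlonglongrightarrow> r"
    unfolding norm_eq_sqrt_inner r_def by (intro tendsto_real_sqrt lims)+
  define x' where "x' m = (1 / norm (x m)) *\<^sub>R x m" for m
  define g where "g m = y m - (y m \<bullet> x' m) *\<^sub>R x' m" for m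
  define y' where "y' m = - (1 / norm (g m)) *\<^sub>R g m" for m
  have scaled: "(\<lambda>m. (1 / norm (v m)) *\<^sub>R v m - (1 / r) *\<^sub>R v m) \<longlonglongrightarrow> 0"
    if "(\<lambda>m. norm (v m)) \<longlonglongrightarrow> r" for v :: "nat \<Rightarrow> 'a"
  proof (rule tendsto_norm_zero_cancel)
    have "(\<lambda>m. \<bar>1 / norm (v m) - 1 / r\<bar> * norm (v m)) \<longlonglongrightarrow> \<bar>1 / r - 1 / r\<bar> * r"
      by (intro tendsto_intros that) (use r in auto)
    then show "(\<lambda>m. norm ((1 / norm (v m)) *\<^sub>R v m - (1 / r) *\<^sub>R v m)) \<longlonglongrightarrow> 0"
      by (simp add: scaleR_diff_left[symmetric])
  qed
  have x'r: "(\<lambda>m. x' m - (1 / r) *\<^sub>R x m) \<longlonglongrightarrow> 0"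
    unfolding x'_def by (rule scaled[OF nx])
  have proj: "(\<lambda>m. y m \<bullet> x' m) \<longlonglongrightarrow> 0"
  proof -
    have "(\<lambda>m. (1 / norm (x m)) * (x m \<bullet> y m)) \<longlonglongrightarrow> (1 / r) * 0"
      by (intro tendsto_intros nx lims) (use r in auto)
    then show ?thesis by (simp add: x'_def inner_commute)
  qed
  have nz: "\<forall>\<^sub>F m in sequentially. norm (x m) > 0"
    by (rule order_tendstoD(1)[OF nx r(1)])
  have nx': "norm (x' m) \<le> 1" for m by (simp add: x'_def)
  have gy: "(\<lambda>m. g m - y m) \<longlonglongrightarrow> 0"
  proof (rule Lim_null_comparison)
    show "\<forall>\<^sub>F m in sequentially. norm (g m - y m) \<le> \<bar>y m \<bullet> x' m\<bar>"
      using nx' by (auto simp: g_def intro!: always_eventually mult_left_le)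
    show "(\<lambda>m. \<bar>y m \<bullet> x' m\<bar>) \<longlonglongrightarrow> 0" using proj by (rule tendsto_rabs_zero)
  qed
  have ng: "(\<lambda>m. norm (g m)) \<longlonglongrightarrow> r"
  proof -
    have "(\<lambda>m. norm (g m) - norm (y m)) \<longlonglongrightarrow> 0"
      by (rule Lim_null_comparison[OF _ tendsto_norm_zero[OF gy]])
        (auto intro!: always_eventually norm_triangle_ineq3)
    from tendsto_add[OF this ny] show ?thesis by simp
  qed
  have y'r: "(\<lambda>m. y' m + (1 / r) *\<^sub>R y m) \<longlonglongrightarrow> 0"
  proof -
    have "(\<lambda>m. - ((1 / norm (g m)) *\<^sub>R g m - (1 / r) *\<^sub>R g m) - (1 / r) *\<^sub>R (g m - y m)) \<longlonglongrightarrow> - 0 - (1 / r) *\<^sub>R 0"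
      by (intro tendsto_intros scaled[OF ng] gy)
    then show ?thesis by (simp add: y'_def algebra_simps)
  qed
  have gz: "\<forall>\<^sub>F m in sequentially. norm (g m) > 0"
    by (rule order_tendstoD(1)[OF ng r(1)])
  show ?thesis
  proof (rule approx_eigenblockI[of x' y'])
    show "\<forall>\<^sub>F m in sequentially. norm (x' m) = 1 \<and> norm (y' m) = 1 \<and> x' m \<bullet> y' m = 0"
      using nz gz
    proof eventually_elim
      case (elim m)
      have n1: "norm (x' m) = 1" using elim by (simp add: x'_def)
      then have "x' m \<bullet> x' m = 1" by (simp add: power2_norm_eq_inner[symmetric])
      then have "x' m \<bullet> g m = 0" by (simp add: g_def inner_diff_right inner_commute)
      then show ?case using n1 elim by (simp add: y'_def)
    qed
    fix i assume i: "i \<in> {1..k}"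
    have "(\<lambda>m. A i (x' m - (1 / r) *\<^sub>R x m) + (1 / r) *\<^sub>R (A i (x m) - (cos \<alpha> *\<^sub>R x m - sin \<alpha> *\<^sub>R y m))
        - cos \<alpha> *\<^sub>R (x' m - (1 / r) *\<^sub>R x m) - sin \<alpha> *\<^sub>R (y' m + (1 / r) *\<^sub>R y m))
        \<longlonglongrightarrow> A i 0 + (1 / r) *\<^sub>R 0 - cos \<alpha> *\<^sub>R 0 - sin \<alpha> *\<^sub>R 0"
      by (intro tendsto_intros x'r y'r x[OF i])
    then show "(\<lambda>m. A i (x' m) - (cos \<alpha> *\<^sub>R x' m + sin \<alpha> *\<^sub>R y' m)) \<longlonglongrightarrow> 0"
      by (simp add: blinfun.diff_right blinfun.scaleR_right algebra_simps)
    have "(\<lambda>m. A i (y' m + (1 / r) *\<^sub>R y m) - (1 / r) *\<^sub>R (A i (y m) - (sin \<alpha> *\<^sub>R x m + cos \<alpha> *\<^sub>R y m))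
        + sin \<alpha> *\<^sub>R (x' m - (1 / r) *\<^sub>R x m) - cos \<alpha> *\<^sub>R (y' m + (1 / r) *\<^sub>R y m))
        \<longlonglongrightarrow> A i 0 - (1 / r) *\<^sub>R 0 + sin \<alpha> *\<^sub>R 0 - cos \<alpha> *\<^sub>R 0"
      by (intro tendsto_intros x'r y'r y[OF i])
    then show "(\<lambda>m. A i (y' m) - (- sin \<alpha> *\<^sub>R x' m + cos \<alpha> *\<^sub>R y' m)) \<longlonglongrightarrow> 0"
      by (simp add: blinfun.add_right blinfun.scaleR_right algebra_simps)
  qed
qed

lemma approx_eigenvalue_real_complexify:
  fixes A :: "nat \<Rightarrow> 'a::{real_inner, banach} \<Rightarrow>\<^sub>L 'a"
  assumes "approx_eigenvalue_complex (\<lambda>i. complexify (A i)) k (of_real r)"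
  shows "approx_eigenvalue_real A k r"
proof -
  obtain z where z: "\<And>m. norm (z m) = 1"
    "\<And>i. i \<in> {1..k} \<Longrightarrow> (\<lambda>m. complexify (A i) (z m) - of_real r *\<^sub>C z m) \<longlonglongrightarrow> 0"
    using assms unfolding approx_eigenvalue_complex_def by blast
  define v where "v m = (if (norm (repart (z m)))\<^sup>2 \<ge> 1 / 4 then repart (z m) else impart (z m))" for m
  have v: "norm (v m) \<ge> 1 / 2" for m
  proof -
    have "(norm (repart (z m)))\<^sup>2 + (norm (impart (z m)))\<^sup>2 = 1"
      using z(1)[of m] unfolding norm_complexification_def by simp
    then have "(1 / 2)\<^sup>2 \<le> (norm (v m))\<^sup>2"
      unfolding v_def by (auto simp: power2_eq_square)
    then show ?thesis by (rule power2_le_imp_le) simp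
  qed
  have "(\<lambda>m. A i (sgn (v m)) - r *\<^sub>R sgn (v m)) \<longlonglongrightarrow> 0" if i: "i \<in> {1..k}" for i
  proof (rule Lim_null_comparison)
    let ?e = "\<lambda>m. complexify (A i) (z m) - of_real r *\<^sub>C z m"
    have "norm (A i (sgn (v m)) - r *\<^sub>R sgn (v m)) \<le> 2 * norm (?e m)" for m
    proof -
      have "repart (?e m) = A i (repart (z m)) - r *\<^sub>R repart (z m)"
        "impart (?e m) = A i (impart (z m)) - r *\<^sub>R impart (z m)"
        by (simp_all add: complexify_apply minus_complexification_def scaleC_of_real scaleR_complexification_def)
      moreover have "norm (repart (?e m)) \<le> norm (?e m)" "norm (impart (?e m)) \<le> norm (?e m)"
        by (simp_all add: norm_complexification_def real_le_rsqrt)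
      ultimately have e: "norm (A i (v m) - r *\<^sub>R v m) \<le> norm (?e m)" by (auto simp: v_def)
      have "A i (sgn (v m)) - r *\<^sub>R sgn (v m) = (1 / norm (v m)) *\<^sub>R (A i (v m) - r *\<^sub>R v m)"
        by (simp add: sgn_div_norm blinfun.scaleR_right scaleR_diff_right divide_inverse mult.commute)
      then have "norm (A i (sgn (v m)) - r *\<^sub>R sgn (v m)) = (1 / norm (v m)) * norm (A i (v m) - r *\<^sub>R v m)"
        by simp
      also have "\<dots> \<le> 2 * norm (?e m)"
        using v[of m] by (intro mult_mono e) (auto simp: divide_le_eq)
      finally show ?thesis .
    qed
    then show "\<forall>\<^sub>F m in sequentially. norm (A i (sgn (v m)) - r *\<^sub>R sgn (v m)) \<le> 2 * norm (?e m)"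
      by (intro always_eventually) auto
    have "(\<lambda>m. 2 * norm (?e m)) \<longlonglongrightarrow> 2 * norm (0 :: 'a complexification)"
      by (intro tendsto_intros z(2)[OF i])
    then show "(\<lambda>m. 2 * norm (?e m)) \<longlonglongrightarrow> 0" by simp
  qed
  moreover have "norm (sgn (v m)) = 1" for m
    using v[of m] by (auto simp: norm_sgn)
  ultimately show ?thesis
    unfolding approx_eigenvalue_real_def by (intro exI[of _ "\<lambda>m. sgn (v m)"]) simp
qed

lemma approx_eigenvalue_real_differences:
  assumes "approx_eigenvalue_real A k r"
  shows "differences_approx_zero A k"
proof -
  obtain x where x: "\<And>m. norm (x m) = 1"
    "\<And>i. i \<in> {1..k} \<Longrightarrow> (\<lambda>m. A i (x m) - r *\<^sub>R x m) \<longlonglongrightarrow> 0"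
    using assms unfolding approx_eigenvalue_real_def by blast
  have "(\<lambda>m. (A i - A j) (x m)) \<longlonglongrightarrow> 0" if "i \<in> {1..k}" "j \<in> {1..k}" for i j
    using tendsto_diff[OF x(2)[OF that(1)] x(2)[OF that(2)]] by (simp add: blinfun.diff_left)
  with x(1) show ?thesis unfolding differences_approx_zero_def by blast
qed

lemma approx_eigenblock_differences:
  assumes "approx_eigenblock A k \<alpha>"
  shows "differences_approx_zero A k"
proof -
  obtain x y where x: "\<forall>m. norm (x m) = 1 \<and> norm (y m) = 1 \<and> x m \<bullet> y m = 0"
    and b: "\<forall>i\<in>{1..k}. (\<lambda>m. A i (x m) - (cos \<alpha> *\<^sub>R x m + sin \<alpha> *\<^sub>R y m)) \<longlonglongrightarrow> 0 \<and>
      (\<lambda>m. A i (y m) - (- sin \<alpha> *\<^sub>R x m + cos \<alpha> *\<^sub>R y m)) \<longlonglongrightarrow> 0"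
    using assms unfolding approx_eigenblock_def by (elim exE conjE) (rule that)
  have "(\<lambda>m. (A i - A j) (x m)) \<longlonglongrightarrow> 0" if "i \<in> {1..k}" "j \<in> {1..k}" for i j
    using tendsto_diff[OF conjunct1[OF bspec[OF b that(1)]] conjunct1[OF bspec[OF b that(2)]]]
    by (simp add: blinfun.diff_left)
  with x show ?thesis unfolding differences_approx_zero_def by (intro exI[of _ x]) simp
qed

lemma no_approx_eigenvalue_complexify:
  fixes A :: "nat \<Rightarrow> 'a::{real_inner, banach} \<Rightarrow>\<^sub>L 'a"
  assumes A: "\<And>i. i \<in> {1..k} \<Longrightarrow> norm (A i) \<le> 1" and "k \<ge> 1"
    and "\<not> approx_eigenvalue_real A k 1" "\<not> approx_eigenvalue_real A k (- 1)"
    and "\<And>\<alpha>. \<not> approx_eigenblock A k \<alpha>" and "cmod z = 1"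
  shows "\<not> approx_eigenvalue_complex (\<lambda>i. complexify (A i)) k z"
proof
  assume eig: "approx_eigenvalue_complex (\<lambda>i. complexify (A i)) k z"
  have z: "z = cis (Arg z)"
    using rcis_cmod_Arg[of z] \<open>cmod z = 1\<close> by (simp add: rcis_def)
  show False
  proof (cases "sin (Arg z) = 0")
    case True
    then have "cos (Arg z) = 1 \<or> cos (Arg z) = -1"
      using sin_cos_squared_add[of "Arg z"] by (simp add: power2_eq_1_iff)
    then have "z = of_real 1 \<or> z = of_real (-1)"
      using True by (subst (1 2) z) (auto simp: complex_eq_iff simp del: cis_Arg)
    then show False
      using approx_eigenvalue_real_complexify[of A k 1] approx_eigenvalue_real_complexify[of A k "-1"] eig assms
      by auto
  next
    case False
    then show False
      using approx_eigenblock_complexify[where A = A, OF A \<open>k \<ge> 1\<close> False] eig z assms(5) by simp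
  qed
qed

theorem theorem3p15:
  fixes k :: nat and s :: "nat \<Rightarrow> real"
    and B :: "nat \<Rightarrow> ('h::chilbert_space \<Rightarrow>\<^sub>L 'h)"
    and A :: "nat \<Rightarrow> ('r::{real_inner, banach} \<Rightarrow>\<^sub>L 'r)"
  assumes "\<forall>i\<in>{1..k}. s i > 0" and "(\<Sum>i=1..k. s i) = pi"
  shows
    "((\<forall>i\<in>{1..k}. complex_linear (B i) \<and> norm (B i) = 1) \<longrightarrow>
        (\<not> approx_eigenvalue_complex B k \<i> \<and> \<not> approx_eigenvalue_complex B k (- \<i>) \<longrightarrow>
           logable (bch_complex B s k 1) \<and>
           (\<forall>t::real. 0 \<le> t \<and> t < 1 \<longrightarrow> summable (\<lambda>n. t ^ Suc n *\<^sub>R magnus_complex B s k (Suc n))) \<and>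
           ((\<lambda>t::real. \<Sum>n. t ^ Suc n *\<^sub>R magnus_complex B s k (Suc n))
              \<longlongrightarrow> op_log (bch_complex B s k 1)) (at_left 1)) \<and>
        ((\<not> (\<exists>z. cmod z = 1 \<and> approx_eigenvalue_complex B k z)) \<or> \<not> differences_approx_zero B k \<longrightarrow>
           (\<forall>t::complex. cmod t \<le> 1 \<longrightarrow>
              logable (bch_complex B s k t) \<and>
              summable (\<lambda>n. norm (t ^ Suc n *\<^sub>C magnus_complex B s k (Suc n))) \<and>
              (\<lambda>n. t ^ Suc n *\<^sub>C magnus_complex B s k (Suc n)) sums op_log (bch_complex B s k t)) \<and>
           logable_radius (bch_complex B s k) > 1))
     \<and>
     ((\<forall>i\<in>{1..k}. norm (A i) = 1) \<longrightarrow>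
        (\<not> approx_eigenblock A k (pi / 2) \<longrightarrow>
           logable (complexify (bch_real A s k 1)) \<and>
           (\<forall>t::real. 0 \<le> t \<and> t < 1 \<longrightarrow> summable (\<lambda>n. t ^ Suc n *\<^sub>R magnus_real A s k (Suc n))) \<and>
           ((\<lambda>t::real. \<Sum>n. t ^ Suc n *\<^sub>R magnus_real A s k (Suc n))
              \<longlongrightarrow> op_log (bch_real A s k 1)) (at_left 1)) \<and>
        ((\<not> approx_eigenvalue_real A k 1 \<and> \<not> approx_eigenvalue_real A k (- 1) \<and>
             \<not> (\<exists>\<alpha>. approx_eigenblock A k \<alpha>)) \<or> \<not> differences_approx_zero A k \<longrightarrow>
           (\<forall>t::complex. cmod t \<le> 1 \<longrightarrow>
              logable (bch_complex (\<lambda>i. complexify (A i)) s k t) \<and>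
              summable (\<lambda>n. norm (t ^ Suc n *\<^sub>C complexify (magnus_real A s k (Suc n)))) \<and>
              (\<lambda>n. t ^ Suc n *\<^sub>C complexify (magnus_real A s k (Suc n)))
                sums op_log (bch_complex (\<lambda>i. complexify (A i)) s k t)) \<and>
           logable_radius (bch_complex (\<lambda>i. complexify (A i)) s k) > 1))"
proof (intro conjI[of "_ \<longrightarrow> _" "_ \<longrightarrow> _"] impI)
  have s: "\<And>i. i \<in> {1..k} \<Longrightarrow> 0 < s i" using assms(1) by blast
  note s = this assms(2)
  {
    assume "\<forall>i\<in>{1..k}. complex_linear (B i) \<and> norm (B i) = 1"
    then have B: "complex_linear (B i)" "norm (B i) \<le> 1" if "i \<in> {1..k}" for i
      using that by auto
    show "logable (bch_complex B s k 1) \<and>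
        (\<forall>t::real. 0 \<le> t \<and> t < 1 \<longrightarrow> summable (\<lambda>n. t ^ Suc n *\<^sub>R magnus_complex B s k (Suc n))) \<and>
        ((\<lambda>t::real. \<Sum>n. t ^ Suc n *\<^sub>R magnus_complex B s k (Suc n))
          \<longlongrightarrow> op_log (bch_complex B s k 1)) (at_left 1)"
      if "\<not> approx_eigenvalue_complex B k \<i> \<and> \<not> approx_eigenvalue_complex B k (- \<i>)"
      using that
      by (intro conjI allI impI; (intro magnus_complex_abel_at_one[where B = B, OF s B]
        magnus_complex_summable[where B = B, OF s B])?; simp)
    show "(\<forall>t::complex. cmod t \<le> 1 \<longrightarrow>
          logable (bch_complex B s k t) \<and>
          summable (\<lambda>n. norm (t ^ Suc n *\<^sub>C magnus_complex B s k (Suc n))) \<and>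
          (\<lambda>n. t ^ Suc n *\<^sub>C magnus_complex B s k (Suc n)) sums op_log (bch_complex B s k t)) \<and>
        logable_radius (bch_complex B s k) > 1"
      if "\<not> (\<exists>z. cmod z = 1 \<and> approx_eigenvalue_complex B k z) \<or> \<not> differences_approx_zero B k"
    proof -
      have "\<not> approx_eigenvalue_complex B k z" if "cmod z = 1" for z
        using \<open>_ \<or> _\<close> that approx_eigenvalue_complex_differences[of B k z] by blast
      then show ?thesis
        by (intro conjI allI impI; intro magnus_complex_on_closed_disc[where B = B, OF s B]; simp)
    qed
  }
  {
    let ?B = "\<lambda>i. complexify (A i)"
    assume A1: "\<forall>i\<in>{1..k}. norm (A i) = 1"
    then have A: "norm (A i) \<le> 1" if "i \<in> {1..k}" for i using that by auto
    have B: "complex_linear (?B i)" "norm (?B i) \<le> 1" if "i \<in> {1..k}" for i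
      using complex_linear_complexify order_trans[OF norm_complexify_le A[OF that]] by auto
    have "k \<ge> 1" using assms(2) by (cases k) auto
    have log: "logable (bch_complex ?B s k t)" if "cmod t < 1" for t
      by (rule logable_bch_complex[where B = ?B, OF s B]) (use that in auto)
    have magnus: "magnus_real A s k n = realify (magnus_complex ?B s k n)"
      "complexify (magnus_real A s k n) = magnus_complex ?B s k n" for n
      by (rule magnus_real_eq[where A = A, OF log]; assumption)+
    note realify_scaleR = linear_simps(5)[OF bounded_linear_realify]
    show "logable (complexify (bch_real A s k 1)) \<and>
        (\<forall>t::real. 0 \<le> t \<and> t < 1 \<longrightarrow> summable (\<lambda>n. t ^ Suc n *\<^sub>R magnus_real A s k (Suc n))) \<and>
        ((\<lambda>t::real. \<Sum>n. t ^ Suc n *\<^sub>R magnus_real A s k (Suc n))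
          \<longlongrightarrow> op_log (bch_real A s k 1)) (at_left 1)"
      if block: "\<not> approx_eigenblock A k (pi / 2)"
    proof (intro conjI allI impI)
      have "\<not> approx_eigenvalue_complex ?B k \<i>"
        using approx_eigenblock_complexify[where A = A, OF A \<open>k \<ge> 1\<close>, of "pi / 2"] block by auto
      moreover have "\<not> approx_eigenvalue_complex ?B k (- \<i>)"
        using approx_eigenblock_complexify[where A = A, OF A \<open>k \<ge> 1\<close>, of "- (pi / 2)"]
          approx_eigenblock_minus[of A k "- (pi / 2)"] block by (auto simp: cis_cnj[symmetric] simp del: cis_cnj)
      ultimately have a: "logable (bch_complex ?B s k 1)"
        "((\<lambda>t::real. \<Sum>n. t ^ Suc n *\<^sub>R magnus_complex ?B s k (Suc n))
          \<longlongrightarrow> op_log (bch_complex ?B s k 1)) (at_left 1)"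
        by (intro magnus_complex_abel_at_one[where B = ?B, OF s B]; simp)+
      have one: "bch_complex ?B s k 1 = complexify (bch_real A s k 1)"
        using bch_complex_complexify[of A s k 1] by simp
      show log1: "logable (complexify (bch_real A s k 1))" using a(1) by (simp add: one)
      have sum: "summable (\<lambda>n. t ^ Suc n *\<^sub>R magnus_complex ?B s k (Suc n))" if "0 \<le> t" "t < 1" for t :: real
        by (rule magnus_complex_summable[where B = ?B, OF s B that])
      show "summable (\<lambda>n. t ^ Suc n *\<^sub>R magnus_real A s k (Suc n))" if "0 \<le> t \<and> t < 1" for t :: real
        using bounded_linear.summable[OF bounded_linear_realify sum[of t]] that
        by (simp add: magnus(1) realify_scaleR)
      have "((\<lambda>t::real. realify (\<Sum>n. t ^ Suc n *\<^sub>R magnus_complex ?B s k (Suc n)))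
          \<longlongrightarrow> realify (op_log (bch_complex ?B s k 1))) (at_left 1)"
        by (rule bounded_linear.tendsto[OF bounded_linear_realify a(2)])
      moreover have "realify (op_log (bch_complex ?B s k 1)) = op_log (bch_real A s k 1)"
        unfolding one using log1 by (simp add: op_log_complexify logable_iff)
      moreover have "\<forall>\<^sub>F t::real in at_left 1. realify (\<Sum>n. t ^ Suc n *\<^sub>R magnus_complex ?B s k (Suc n))
          = (\<Sum>n. t ^ Suc n *\<^sub>R magnus_real A s k (Suc n))"
      proof -
        have "realify (\<Sum>n. t ^ Suc n *\<^sub>R magnus_complex ?B s k (Suc n))
          = (\<Sum>n. t ^ Suc n *\<^sub>R magnus_real A s k (Suc n))" if "0 < t" "t < 1" for t :: real
          using bounded_linear.suminf[OF bounded_linear_realify sum[of t]] that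
          by (simp add: magnus(1) realify_scaleR)
        then show ?thesis
          by (auto simp: eventually_at_left_field intro!: exI[of _ 0])
      qed
      ultimately show "((\<lambda>t::real. \<Sum>n. t ^ Suc n *\<^sub>R magnus_real A s k (Suc n))
          \<longlongrightarrow> op_log (bch_real A s k 1)) (at_left 1)"
        using Lim_transform_eventually by fastforce
    qed
    show "(\<forall>t::complex. cmod t \<le> 1 \<longrightarrow>
          logable (bch_complex ?B s k t) \<and>
          summable (\<lambda>n. norm (t ^ Suc n *\<^sub>C complexify (magnus_real A s k (Suc n)))) \<and>
          (\<lambda>n. t ^ Suc n *\<^sub>C complexify (magnus_real A s k (Suc n))) sums op_log (bch_complex ?B s k t)) \<and>
        logable_radius (bch_complex ?B s k) > 1"
      if h: "(\<not> approx_eigenvalue_real A k 1 \<and> \<not> approx_eigenvalue_real A k (- 1) \<and>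
             \<not> (\<exists>\<alpha>. approx_eigenblock A k \<alpha>)) \<or> \<not> differences_approx_zero A k"
    proof -
      have "\<not> approx_eigenvalue_real A k 1" "\<not> approx_eigenvalue_real A k (- 1)"
        "\<And>\<alpha>. \<not> approx_eigenblock A k \<alpha>"
        using h approx_eigenvalue_real_differences approx_eigenblock_differences by blast+
      then have "\<not> approx_eigenvalue_complex ?B k z" if "cmod z = 1" for z
        using no_approx_eigenvalue_complexify[where A = A, OF A \<open>k \<ge> 1\<close> _ _ _ that] by blast
      then show ?thesis
        unfolding magnus(2)
        by (intro conjI allI impI; intro magnus_complex_on_closed_disc[where B = ?B, OF s B]; simp)
    qed
  }
qed

end
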